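(* Let $a\in S^m_{\rho,\delta}(n,2)$ with $0\le\delta\le\rho\le1$, $\delta<1$, and let $p,q,r\in[1,\infty]$ satisfy $1/r=1/q+1/p$ and \[ m<n(\rho-1)\max\Big\{\tfrac12,\ \tfrac2p-\tfrac12,\ \tfrac2q-\tfrac12,\ \tfrac32-\tfrac2r\Big\}. \] Then $\|T_a(f,g)\|_{L^r(\mathbb{R}^n)}\le C\|f\|_{L^q(\mathbb{R}^n)}\|g\|_{L^p(\mathbb{R}^n)}$ for all Schwartz functions $f,g$, with $C$ independent of $f,g$.
   Context: A symbol $a:\mathbb{R}^n\times\mathbb{R}^n\times\mathbb{R}^n\to\mathbb{C}$ belongs to $S^m_{\rho,\delta}(n,2)$ if for all multi-indices $\alpha,\beta,\gamma\in\mathbb{Z}_+^n$ there is $C_{\alpha,\beta,\gamma}$ with $|\partial_\xi^\alpha\partial_\eta^\beta\partial_x^\gamma a(x,\xi,\eta)|\le C_{\alpha,\beta,\gamma}(1+|\xi|^2+|\eta|^2)^{(m-\rho(|\alpha|+|\beta|)+\delta|\gamma|)/2}$. The bilinear operator is $T_a(f,g)(x)=\int\int a(x,\xi,\eta)\widehat f(\xi)\widehat g(\eta)e^{ix\cdot(\xi+\eta)}d\xi\,d\eta$, with $\widehat f(\xi)=\int f(y)e^{-iy\cdot\xi}dy$. *)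

theory Defs
  imports "HOL-Analysis.Analysis" "HOL-Probability.Essential_Supremum"
begin

fun iter_dderiv :: "'a::real_normed_vector list \<Rightarrow> ('a \<Rightarrow> 'b::real_normed_vector) \<Rightarrow> 'a \<Rightarrow> 'b" where
  "iter_dderiv [] f = f"
| "iter_dderiv (v # vs) f =
     (\<lambda>z. vector_derivative (\<lambda>t. iter_dderiv vs f (z + t *\<^sub>R v)) (at 0))"

definition smooth_fun :: "('a::euclidean_space \<Rightarrow> 'b::real_normed_vector) \<Rightarrow> bool" where
  "smooth_fun f \<longleftrightarrow> (\<forall>vs. set vs \<subseteq> Basis \<longrightarrow> (\<forall>z. iter_dderiv vs f differentiable (at z)))"

definition schwartz :: "(real^'n \<Rightarrow> complex) \<Rightarrow> bool" where
  "schwartz f \<longleftrightarrow> smooth_fun f \<and>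
     (\<forall>vs. set vs \<subseteq> Basis \<longrightarrow> (\<forall>k::nat. \<exists>C. \<forall>x. (1 + norm x) ^ k * norm (iter_dderiv vs f x) \<le> C))"

text \<open>Bilinear symbol class S^m_{rho,delta}(n,2). A symbol a(x,xi,eta) is viewed as a
  function on the product space; a basis direction of the product lies in exactly one
  of the x-, xi- or eta-blocks, and |alpha|, |beta|, |gamma| count these.\<close>
definition bisymbol :: "real \<Rightarrow> real \<Rightarrow> real \<Rightarrow> (real^'n \<Rightarrow> real^'n \<Rightarrow> real^'n \<Rightarrow> complex) \<Rightarrow> bool" where
  "bisymbol m \<rho> \<delta> a \<longleftrightarrow>
     (let A = (\<lambda>(x, \<xi>, \<eta>). a x \<xi> \<eta>) in
      smooth_fun A \<and>
      (\<forall>vs. set vs \<subseteq> Basis \<longrightarrow>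
         (let kx = length (filter (\<lambda>v. fst v \<noteq> 0) vs);
              k\<xi> = length (filter (\<lambda>v. fst (snd v) \<noteq> 0) vs);
              k\<eta> = length (filter (\<lambda>v. snd (snd v) \<noteq> 0) vs) in
          \<exists>C. \<forall>x \<xi> \<eta>. norm (iter_dderiv vs A (x, \<xi>, \<eta>))
               \<le> C * (1 + (norm \<xi>)\<^sup>2 + (norm \<eta>)\<^sup>2) powr
                     ((m - \<rho> * real (k\<xi> + k\<eta>) + \<delta> * real kx) / 2))))"

definition fourier :: "(real^'n \<Rightarrow> complex) \<Rightarrow> real^'n \<Rightarrow> complex" where
  "fourier f \<xi> = integral\<^sup>L lborel (\<lambda>y. f y * cis (- (y \<bullet> \<xi>)))"

definition bilinear_op :: "(real^'n \<Rightarrow> real^'n \<Rightarrow> real^'n \<Rightarrow> complex) \<Rightarrow>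
    (real^'n \<Rightarrow> complex) \<Rightarrow> (real^'n \<Rightarrow> complex) \<Rightarrow> real^'n \<Rightarrow> complex" where
  "bilinear_op a f g x = integral\<^sup>L lborel
     (\<lambda>(\<xi>, \<eta>). a x \<xi> \<eta> * fourier f \<xi> * fourier g \<eta> * cis (x \<bullet> (\<xi> + \<eta>)))"

definition Lp_norm :: "ennreal \<Rightarrow> (real^'n \<Rightarrow> complex) \<Rightarrow> ennreal" where
  "Lp_norm p f =
     (if p = \<infinity> then esssup lborel (\<lambda>x. ennreal (norm (f x)))
      else (let I = (\<integral>\<^sup>+ x. ennreal (norm (f x) powr enn2real p) \<partial>lborel) in
            if I = \<infinity> then \<infinity> else ennreal (enn2real I powr (1 / enn2real p))))"

end

theory Submission
  imports Defs "HOL-Probability.Probability"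
begin

text \<open>
  Decompose \<open>a\<close> dyadically in the frequency \<open>\<zeta> = (\<xi>, \<eta>)\<close>. The piece at \<open>1 + |\<zeta>|\<^sup>2 ~ 2\<^sup>j\<close> becomes, after dilating
  \<open>x\<close> and \<open>\<zeta>\<close> by \<open>2 powr (j \<rho> / 2)\<close>, a symbol of size \<open>2 powr (j m / 2)\<close> all of whose derivatives are bounded by that size
  and whose frequency support lies in a cube of side \<open>R ~ 2 powr (j (1 - \<rho>) / 2)\<close>. Such a symbol maps
  \<open>L\<^sup>q \<times> L\<^sup>p\<close> to \<open>L\<^sup>r\<close> with norm at most its size times \<open>R powr (n \<lambda>)\<close>, where
  \<open>\<lambda> = max (1/2) (1 - 1/r) + max 0 (1/q - 1/2) + max 0 (1/p - 1/2)\<close>. As \<open>\<lambda>\<close> is at most the maximum in the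
  hypothesis, the norms of the pieces form a geometric series.

  For a single scale, the output is estimated on a unit cube \<open>Q\<close>. Integrating by parts twice in every frequency variable replaces
  \<open>f\<close> by \<open>f / W\<close> with \<open>|W y| = \<Prod>\<^sub>i (1 + y\<^sub>i\<^sup>2)\<close>, so that \<open>f\<close> enters only through its
  norm with an integrable weight centred at \<open>Q\<close>. For a symbol independent of \<open>x\<close>, Plancherel's inequality in the output frequency
  \<open>\<xi> + \<eta>\<close> and the Cauchy-Schwarz inequality on the support give \<open>L\<^sup>2 \<times> L\<^sup>2\<close> to \<open>L\<^sup>2\<close> with loss
  \<open>R powr (n/2)\<close> and to \<open>L\<^sup>\<infinity>\<close> with loss \<open>R powr n\<close>; the dependence on \<open>x\<close> in \<open>Q\<close> is
  removed one coordinate at a time by a Sobolev argument. Exponents below 2 cost \<open>R powr (n (1/q - 1/2))\<close>, and integrating over all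
  translates of \<open>Q\<close> gives the global estimate.
\<close>

text \<open>After the dilation differentiation no longer gains anything: each piece behaves like a
  symbol of type (0, 0), whose kernel lives at distance O(1) from the diagonal. This fixes the unit
  cube as the localisation in \<open>x\<close>, and it leaves the size of the frequency support as
  the only source of decay to be traded against the order \<open>m\<close>. The obstacle is that
  Plancherel's theorem needs a symbol independent of \<open>x\<close>, whereas the pieces are as
  rough in \<open>x\<close> as in frequency; the Sobolev step converts one
  \<open>x\<close>-derivative per coordinate into this independence. Intermediate exponents are
  reached by elementary pointwise inequalities such as \<open>x powr \<theta> \<le> 1 + x\<close>,
  applied after normalising by the relevant norm, rather than by an interpolation theorem; the
  exponents 1 and \<infinity> are therefore on the same footing as the others. The number 5n of
  derivatives is 4n for the weights (two for each of the 2n frequency variables) plus n for the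
  Sobolev step. All constants are chosen before the symbol, its size and its support, because they
  must be common to all dyadic pieces.\<close>

section \<open>Functions with bounded derivatives\<close>

text \<open>Derivatives along basis vectors up to order \<open>N\<close> exist and are continuous everywhere, but are bounded only on \<open>S\<close>.
  The family \<open>D\<close> below is determined by \<open>f\<close>, so the existential quantifier makes no choice.\<close>

primrec bnd :: "'a::euclidean_space set \<Rightarrow> nat \<Rightarrow> real \<Rightarrow> ('a \<Rightarrow> complex) \<Rightarrow> bool" where
  "bnd S 0 C f \<longleftrightarrow> continuous_on UNIV f \<and> (\<forall>z\<in>S. norm (f z) \<le> C)"
| "bnd S (Suc N) C f \<longleftrightarrow> continuous_on UNIV f \<and> (\<forall>z\<in>S. norm (f z) \<le> C) \<and>
     (\<exists>D. \<forall>b\<in>Basis. (\<forall>z. ((\<lambda>t. f (z + t *\<^sub>R b)) has_vector_derivative D b z) (at 0)) \<and> bnd S N C (D b))"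

lemma bnd_continuous: "bnd S N C f \<Longrightarrow> continuous_on UNIV f"
  by (cases N) auto

lemma bnd_bound: "bnd S N C f \<Longrightarrow> z \<in> S \<Longrightarrow> norm (f z) \<le> C"
  by (cases N) auto

lemma bnd_SucI:
  assumes "continuous_on UNIV f" "\<And>z. z \<in> S \<Longrightarrow> norm (f z) \<le> C"
    and "\<And>b z. b \<in> Basis \<Longrightarrow> ((\<lambda>t. f (z + t *\<^sub>R b)) has_vector_derivative D b z) (at 0)"
    and "\<And>b. b \<in> Basis \<Longrightarrow> bnd S N C (D b)"
  shows "bnd S (Suc N) C f"
  using assms unfolding bnd.simps by blast

lemma bnd_SucE:
  assumes "bnd S (Suc N) C f"
  obtains D where "\<And>b z. b \<in> Basis \<Longrightarrow> ((\<lambda>t. f (z + t *\<^sub>R b)) has_vector_derivative D b z) (at 0)"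
    "\<And>b. b \<in> Basis \<Longrightarrow> bnd S N C (D b)"
  using assms by auto

lemma bnd_mono:
  "bnd S N C f \<Longrightarrow> M \<le> N \<Longrightarrow> C \<le> C' \<Longrightarrow> S' \<subseteq> S \<Longrightarrow> bnd S' M C' f"
proof (induction M arbitrary: N f)
  case 0
  then show ?case by (auto dest: bnd_continuous bnd_bound intro: order_trans)
next
  case (Suc M)
  then obtain N' where N: "N = Suc N'" by (cases N) auto
  obtain D where "\<And>b z. b \<in> Basis \<Longrightarrow> ((\<lambda>t. f (z + t *\<^sub>R b)) has_vector_derivative D b z) (at 0)"
    "\<And>b. b \<in> Basis \<Longrightarrow> bnd S N' C (D b)"
    using bnd_SucE Suc.prems(1) unfolding N by metis
  moreover have "continuous_on UNIV f" "\<And>z. z \<in> S' \<Longrightarrow> norm (f z) \<le> C'"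
    using Suc.prems by (auto dest: bnd_continuous bnd_bound intro: order_trans)
  ultimately show ?case
    using Suc.IH[of N'] Suc.prems(2-4) N by (intro bnd_SucI[where D=D]) blast+
qed

lemma bnd_const: "norm c \<le> C \<Longrightarrow> bnd S N C (\<lambda>_. c)"
proof (induction N arbitrary: c)
  case (Suc N)
  have "bnd S N C (\<lambda>_. 0)" using Suc by (metis norm_ge_zero norm_zero order_trans)
  then show ?case using Suc.prems
    by (intro bnd_SucI[where D="\<lambda>_ _. 0"]) auto
qed auto

lemma bnd_add: "bnd S N C f \<Longrightarrow> bnd S N D g \<Longrightarrow> bnd S N (C + D) (\<lambda>z. f z + g z)"
proof (induction N arbitrary: f g)
  case 0
  then show ?case by (auto intro!: continuous_intros norm_triangle_mono)
next
  case (Suc N)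
  obtain F where F: "\<And>b z. b \<in> Basis \<Longrightarrow> ((\<lambda>t. f (z + t *\<^sub>R b)) has_vector_derivative F b z) (at 0)"
    "\<And>b. b \<in> Basis \<Longrightarrow> bnd S N C (F b)" using bnd_SucE Suc.prems(1) by metis
  obtain G where G: "\<And>b z. b \<in> Basis \<Longrightarrow> ((\<lambda>t. g (z + t *\<^sub>R b)) has_vector_derivative G b z) (at 0)"
    "\<And>b. b \<in> Basis \<Longrightarrow> bnd S N D (G b)" using bnd_SucE Suc.prems(2) by metis
  show ?case
    using Suc.prems[THEN bnd_continuous] Suc.prems[THEN bnd_bound] Suc.IH F G
    by (intro bnd_SucI[where D="\<lambda>b z. F b z + G b z"])
       (auto intro!: continuous_intros norm_triangle_mono has_vector_derivative_add)
qed

lemma bnd_scale: "bnd S N C f \<Longrightarrow> bnd S N (norm c * C) (\<lambda>z. c * f z)"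
proof (induction N arbitrary: f)
  case 0
  then show ?case by (auto intro!: continuous_intros simp: norm_mult mult_left_mono)
next
  case (Suc N)
  obtain F where F: "\<And>b z. b \<in> Basis \<Longrightarrow> ((\<lambda>t. f (z + t *\<^sub>R b)) has_vector_derivative F b z) (at 0)"
    "\<And>b. b \<in> Basis \<Longrightarrow> bnd S N C (F b)" using bnd_SucE Suc.prems(1) by metis
  show ?case
    using Suc.prems[THEN bnd_continuous] Suc.prems[THEN bnd_bound] Suc.IH F
    by (intro bnd_SucI[where D="\<lambda>b z. c * F b z"])
       (auto intro!: continuous_intros has_vector_derivative_mult_right simp: norm_mult mult_left_mono)
qed

text \<open>Each differentiation turns a product into a sum of two products, so the constant doubles
  with every order.\<close>

lemma bnd_mult:
  assumes "0 \<le> C" "0 \<le> D"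
  shows "bnd S N C f \<Longrightarrow> bnd S N D g \<Longrightarrow> bnd S N (2^N * C * D) (\<lambda>z. f z * g z)"
proof (induction N arbitrary: f g)
  case 0
  then show ?case using assms by (auto intro!: continuous_intros mult_mono simp: norm_mult)
next
  case (Suc N)
  obtain F where F: "\<And>b z. b \<in> Basis \<Longrightarrow> ((\<lambda>t. f (z + t *\<^sub>R b)) has_vector_derivative F b z) (at 0)"
    "\<And>b. b \<in> Basis \<Longrightarrow> bnd S N C (F b)" using bnd_SucE Suc.prems(1) by metis
  obtain G where G: "\<And>b z. b \<in> Basis \<Longrightarrow> ((\<lambda>t. g (z + t *\<^sub>R b)) has_vector_derivative G b z) (at 0)"
    "\<And>b. b \<in> Basis \<Longrightarrow> bnd S N D (G b)" using bnd_SucE Suc.prems(2) by metis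
  have lower: "bnd S N C f" "bnd S N D g" using Suc.prems by (auto elim!: bnd_mono simp del: bnd.simps)
  show ?case
  proof (rule bnd_SucI[where D="\<lambda>b z. f z * G b z + F b z * g z"])
    show "continuous_on UNIV (\<lambda>z. f z * g z)"
      using Suc.prems by (auto intro!: continuous_intros dest: bnd_continuous)
    show "norm (f z * g z) \<le> 2 ^ Suc N * C * D" if "z \<in> S" for z
    proof -
      have "norm (f z * g z) \<le> C * D"
        using assms that Suc.prems[THEN bnd_bound] by (auto simp: norm_mult intro!: mult_mono)
      also have "\<dots> \<le> 2 ^ Suc N * (C * D)"
        using mult_right_mono[of 1 "2 ^ Suc N" "C * D"] assms one_le_power[of "2::real" "Suc N"] by auto
      finally show ?thesis by (simp add: mult.assoc)
    qed
    show "((\<lambda>t. f (z + t *\<^sub>R b) * g (z + t *\<^sub>R b)) has_vector_derivative f z * G b z + F b z * g z) (at 0)"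
      if "b \<in> Basis" for b z
      using has_vector_derivative_mult[OF F(1)[OF that, of z] G(1)[OF that, of z]] by simp
    show "bnd S N (2 ^ Suc N * C * D) (\<lambda>z. f z * G b z + F b z * g z)" if "b \<in> Basis" for b
      using bnd_add[OF Suc.IH[OF lower(1) G(2)[OF that]] Suc.IH[OF F(2)[OF that] lower(2)]]
      by (simp add: algebra_simps)
  qed
qed

text \<open>The first derivatives are the constants \<open>b \<bullet> v\<close> and all later ones
  vanish, which makes the bound independent of \<open>N\<close>.\<close>

lemma bnd_inner:
  assumes "\<And>z. z \<in> S \<Longrightarrow> \<bar>z \<bullet> v\<bar> \<le> C" "\<And>b. b \<in> Basis \<Longrightarrow> \<bar>b \<bullet> v\<bar> \<le> C"
  shows "bnd S N C (\<lambda>z. complex_of_real (z \<bullet> v))"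
proof (cases N)
  case 0
  then show ?thesis using assms by (auto intro!: continuous_intros)
next
  case (Suc M)
  have "bnd S (Suc M) C (\<lambda>z. complex_of_real (z \<bullet> v))"
  proof (rule bnd_SucI[where D="\<lambda>b _. of_real (b \<bullet> v)"])
    show "((\<lambda>t. complex_of_real ((z + t *\<^sub>R b) \<bullet> v)) has_vector_derivative of_real (b \<bullet> v)) (at 0)" for z b
      by (auto simp: inner_add_left intro!: derivative_eq_intros has_vector_derivative_of_real)
  qed (use assms in \<open>auto intro!: continuous_intros bnd_const\<close>)
  then show ?thesis using Suc by simp
qed

text \<open>Since \<open>L\<close> moves along a basis vector or not at all when its argument moves
  along one, the chain rule stays among basis derivatives and produces no constant. The value 0 of
  \<open>\<beta>\<close> describes a frozen coordinate, \<open>\<beta> b = b\<close> a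
  translation.\<close>

lemma bnd_affine:
  assumes L: "continuous_on UNIV L" "\<And>z. z \<in> S \<Longrightarrow> L z \<in> S'" and C: "0 \<le> C"
    and B: "\<And>b. b \<in> Basis \<Longrightarrow> \<beta> b \<in> insert 0 Basis"
    and Lb: "\<And>b z t. b \<in> Basis \<Longrightarrow> L (z + t *\<^sub>R b) = L z + t *\<^sub>R \<beta> b"
  shows "bnd S' N C f \<Longrightarrow> bnd S N C (\<lambda>z. f (L z))"
proof (induction N arbitrary: f)
  case 0
  then show ?case using L continuous_on_compose2[of UNIV f UNIV L] by auto
next
  case (Suc N)
  obtain F where F: "\<And>b z. b \<in> Basis \<Longrightarrow> ((\<lambda>t. f (z + t *\<^sub>R b)) has_vector_derivative F b z) (at 0)"
    "\<And>b. b \<in> Basis \<Longrightarrow> bnd S' N C (F b)" using bnd_SucE Suc.prems(1) by metis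
  show ?case
  proof (rule bnd_SucI[where D="\<lambda>b z. if \<beta> b = 0 then 0 else F (\<beta> b) (L z)"])
    show "continuous_on UNIV (\<lambda>z. f (L z))"
      using Suc.prems L continuous_on_compose2[of UNIV f UNIV L] by (auto dest: bnd_continuous)
    show "norm (f (L z)) \<le> C" if "z \<in> S" for z
      using bnd_bound[OF Suc.prems] L that by auto
    show "((\<lambda>t. f (L (z + t *\<^sub>R b))) has_vector_derivative (if \<beta> b = 0 then 0 else F (\<beta> b) (L z))) (at 0)"
      if "b \<in> Basis" for b z
      using F(1)[of "\<beta> b" "L z"] B[OF that] by (auto simp: Lb[OF that])
    show "bnd S N C (\<lambda>z. if \<beta> b = 0 then 0 else F (\<beta> b) (L z))" if "b \<in> Basis" for b
      using Suc.IH[OF F(2)[of "\<beta> b"]] B[OF that] bnd_const[of 0 C] C by (cases "\<beta> b = 0") auto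
  qed
qed

lemma derivative_zero_open:
  fixes z :: "'a::real_normed_vector"
  assumes "open U" "z \<in> U" "\<And>y. y \<in> U \<Longrightarrow> f y = 0"
    and "((\<lambda>t. f (z + t *\<^sub>R b)) has_vector_derivative D) (at 0)"
  shows "D = 0"
proof -
  have "continuous_on UNIV (\<lambda>t. z + t *\<^sub>R b)" by (intro continuous_intros)
  then have "open ((\<lambda>t. z + t *\<^sub>R b) -` U)" using assms(1) by (auto intro: open_vimage)
  from has_vector_derivative_transform_within_open[OF has_vector_derivative_const[of 0] this, of 0 "\<lambda>t. f (z + t *\<^sub>R b)"]
  have "((\<lambda>t. f (z + t *\<^sub>R b)) has_vector_derivative 0) (at 0)"
    using assms(2,3) by simp
  then show ?thesis using assms(4) vector_derivative_unique_at by blast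
qed

text \<open>On the open set where \<open>f\<close> vanishes all its derivatives vanish too. This
  turns bounds that hold on one frequency shell into global ones once a cutoff is attached.\<close>

lemma bnd_zero_ext:
  assumes "open U" "0 \<le> C" "S \<union> U = UNIV"
  shows "bnd S N C f \<Longrightarrow> (\<And>z. z \<in> U \<Longrightarrow> f z = 0) \<Longrightarrow> bnd UNIV N C f"
proof (induction N arbitrary: f)
  case 0
  then show ?case using assms by (metis UNIV_I UnE bnd.simps(1) norm_zero)
next
  case (Suc N)
  obtain F where F: "\<And>b z. b \<in> Basis \<Longrightarrow> ((\<lambda>t. f (z + t *\<^sub>R b)) has_vector_derivative F b z) (at 0)"
    "\<And>b. b \<in> Basis \<Longrightarrow> bnd S N C (F b)" using bnd_SucE Suc.prems(1) by metis
  have "F b z = 0" if "b \<in> Basis" "z \<in> U" for b z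
    using derivative_zero_open[OF assms(1) that(2) Suc.prems(2) F(1)[OF that(1)]] by auto
  then have "bnd UNIV N C (F b)" if "b \<in> Basis" for b using Suc.IH F(2) that by blast
  moreover have "norm (f z) \<le> C" for z
    using bnd_bound[OF Suc.prems(1), of z] Suc.prems(2)[of z] assms by (cases "z \<in> U") auto
  ultimately show ?case
    using F(1) bnd_continuous[OF Suc.prems(1)] by (intro bnd_SucI[where D=F]) auto
qed

section \<open>Truncated powers, the building blocks of the cutoff\<close>

lemma DERIV_plus_power:
  "((\<lambda>x. (max 0 x) ^ Suc (Suc l)) has_real_derivative real (Suc (Suc l)) * (max 0 x) ^ Suc l) (at x)"
proof -
  consider "x > 0" | "x < 0" | "x = 0" by linarith
  then show ?thesis
  proof cases
    case 1
    have "((\<lambda>x. x ^ Suc (Suc l)) has_real_derivative real (Suc (Suc l)) * x ^ Suc l) (at x)"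
      using DERIV_pow[of "Suc (Suc l)" x] by simp
    then have "((\<lambda>x. (max 0 x) ^ Suc (Suc l)) has_real_derivative real (Suc (Suc l)) * x ^ Suc l) (at x)"
      by (rule has_field_derivative_transform_within_open[where S="{0<..}"]) (use 1 in auto)
    then show ?thesis using 1 by simp
  next
    case 2
    have "((\<lambda>x. 0) has_real_derivative 0) (at x)" by simp
    then have "((\<lambda>x. (max 0 x) ^ Suc (Suc l)) has_real_derivative 0) (at x)"
      by (rule has_field_derivative_transform_within_open[where S="{..<0}"]) (use 2 in auto)
    then show ?thesis using 2 by simp
  next
    case 3
    \<comment> \<open>At the kink the difference quotient is at most a positive power of
      \<open>\<bar>h\<bar>\<close>, because the exponent is at least 2.\<close>
    have "((\<lambda>h. ((max 0 (0 + h)) ^ Suc (Suc l) - (max 0 0) ^ Suc (Suc l)) / h) \<longlongrightarrow> (0::real)) (at 0)"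
    proof (rule Lim_null_comparison)
      show "\<forall>\<^sub>F h in at (0::real). norm (((max 0 (0 + h)) ^ Suc (Suc l) - (max 0 0) ^ Suc (Suc l)) / h) \<le> \<bar>h\<bar> ^ Suc l"
      proof (intro always_eventually allI)
        fix h :: real
        show "norm (((max 0 (0 + h)) ^ Suc (Suc l) - (max 0 0) ^ Suc (Suc l)) / h) \<le> \<bar>h\<bar> ^ Suc l"
          by (cases "h > 0") (auto simp: max_def mult_nonpos_nonneg)
      qed
      show "((\<lambda>h::real. \<bar>h\<bar> ^ Suc l) \<longlongrightarrow> 0) (at 0)"
        by (auto intro!: tendsto_eq_intros)
    qed
    then show ?thesis unfolding 3 DERIV_def by simp
  qed
qed

text \<open>A truncated power of exponent \<open>l\<close> is of class C to the
  \<open>l - 1\<close>, whence \<open>N < l\<close>. Its derivative is the next lower truncated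
  power times a derivative of \<open>v\<close>, so the induction lowers \<open>N\<close> and
  \<open>l\<close> together. \<open>K\<close> precedes \<open>S\<close> and \<open>v\<close>, which
  later makes it the same for all dyadic scales.\<close>

lemma bnd_plus_power:
  fixes C :: real
  assumes "N < l" "0 \<le> C"
  shows "\<exists>K\<ge>0. \<forall>(S::'a::euclidean_space set) v. bnd S N C (\<lambda>z. complex_of_real (v z)) \<longrightarrow>
    bnd S N K (\<lambda>z. complex_of_real ((max 0 (v z)) ^ l))"
  using assms(1)
proof (induction N arbitrary: l)
  case 0
  have "continuous_on UNIV (\<lambda>z. complex_of_real ((max 0 (v z)) ^ l))"
    if "continuous_on UNIV (\<lambda>z. complex_of_real (v z))" for v :: "'a \<Rightarrow> real"
    using continuous_on_Re[OF that] by (auto intro!: continuous_intros)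
  moreover have "norm (complex_of_real (v ^ l)) \<le> C ^ l" if "0 \<le> v" "v \<le> C" for v
    using that by (auto simp: norm_power intro!: power_mono)
  moreover have "max 0 v \<le> C" if "norm (complex_of_real v) \<le> C" for v using that assms by auto
  ultimately show ?case
    using assms by (intro exI[of _ "C ^ l"]) (auto simp: norm_power abs_le_iff intro!: power_mono)
next
  case (Suc N)
  then obtain k where l: "l = Suc (Suc k)" by (metis Suc_lessE less_imp_Suc_add)
  obtain K where K: "K \<ge> 0" "\<And>(S::'a set) v. bnd S N C (\<lambda>z. complex_of_real (v z)) \<Longrightarrow>
    bnd S N K (\<lambda>z. complex_of_real ((max 0 (v z)) ^ Suc k))"
    using Suc.IH[of "Suc k"] Suc.prems l by auto
  define K' where "K' = C ^ l + real l * (2 ^ N * K * C)"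
  have Kl: "0 \<le> real l * (2 ^ N * K * C)" "0 \<le> C ^ l" using K assms by auto
  have "bnd S (Suc N) K' (\<lambda>z. complex_of_real ((max 0 (v z)) ^ l))"
    if v: "bnd S (Suc N) C (\<lambda>z. complex_of_real (v z))" for S :: "'a set" and v
  proof -
    obtain F where F: "\<And>b z. b \<in> Basis \<Longrightarrow> ((\<lambda>t. complex_of_real (v (z + t *\<^sub>R b))) has_vector_derivative F b z) (at 0)"
      "\<And>b. b \<in> Basis \<Longrightarrow> bnd S N C (F b)" using bnd_SucE[OF v] by metis
    show ?thesis
    proof (rule bnd_SucI[where D="\<lambda>b z. of_nat l * (complex_of_real ((max 0 (v z)) ^ Suc k) * F b z)"])
      have "continuous_on UNIV v" using continuous_on_Re[OF bnd_continuous[OF v]] by simp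
      then show "continuous_on UNIV (\<lambda>z. complex_of_real ((max 0 (v z)) ^ l))"
        by (auto intro!: continuous_intros)
      show "norm (complex_of_real ((max 0 (v z)) ^ l)) \<le> K'" if "z \<in> S" for z
      proof -
        have "norm (complex_of_real ((max 0 (v z)) ^ l)) \<le> C ^ l"
          using bnd_bound[OF v that] assms by (auto simp: norm_power abs_le_iff intro!: power_mono)
        then show ?thesis using Kl unfolding K'_def by linarith
      qed
      fix b :: 'a assume b: "b \<in> Basis"
      show "bnd S N K' (\<lambda>z. of_nat l * (complex_of_real ((max 0 (v z)) ^ Suc k) * F b z))"
      proof (rule bnd_mono[OF bnd_scale[OF bnd_mult[OF K(1) assms(2) K(2) F(2)[OF b]]] order_refl _ order_refl])
        show "bnd S N C (\<lambda>z. complex_of_real (v z))" using v by (rule bnd_mono) auto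
        show "norm (of_nat l :: complex) * (2 ^ N * K * C) \<le> K'" using Kl unfolding K'_def by (simp add: mult.assoc)
      qed
      fix z
      have R: "((\<lambda>t. v (z + t *\<^sub>R b)) has_real_derivative Re (F b z)) (at 0)"
        using bounded_linear.has_vector_derivative[OF bounded_linear_Re F(1)[OF b, of z]] by (simp add: has_real_derivative_iff_has_vector_derivative)
      \<comment> \<open>\<open>bnd\<close> supplies a complex-valued derivative of a real-valued
        function; that it is real follows because its imaginary part is the derivative of 0.\<close>
      have "((\<lambda>t. 0) has_vector_derivative Im (F b z)) (at 0)"
        using bounded_linear.has_vector_derivative[OF bounded_linear_Im F(1)[OF b, of z]] by simp
      then have "Im (F b z) = 0" using vector_derivative_unique_at[OF _ has_vector_derivative_const] by metis
      then have Fre: "F b z = of_real (Re (F b z))" by (simp add: complex_eq_iff)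
      have "((\<lambda>t. (max 0 (v (z + t *\<^sub>R b))) ^ l) has_real_derivative real l * (max 0 (v z)) ^ Suc k * Re (F b z)) (at 0)"
        using DERIV_chain2[OF DERIV_plus_power R, of k] l by simp
      from has_vector_derivative_of_real[OF this]
      show "((\<lambda>t. complex_of_real ((max 0 (v (z + t *\<^sub>R b))) ^ l)) has_vector_derivative
          of_nat l * (complex_of_real ((max 0 (v z)) ^ Suc k) * F b z)) (at 0)"
        by (subst Fre) (simp add: mult.assoc)
    qed
  qed
  then show ?case using Kl by (intro exI[of _ K']) (auto simp: K'_def simp del: bnd.simps)
qed

section \<open>Plancherel's inequality\<close>

lemma borel_measurable_cis [measurable (raw)]:
  "f \<in> borel_measurable M \<Longrightarrow> (\<lambda>x. cis (f x)) \<in> borel_measurable M"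
  by (erule measurable_compose) (intro borel_measurable_continuous_onI continuous_intros)

lemma borel_measurable_cnj [measurable (raw)]:
  "f \<in> borel_measurable M \<Longrightarrow> (\<lambda>x. cnj (f x)) \<in> borel_measurable M"
  by (erule measurable_compose) (intro borel_measurable_continuous_onI continuous_intros)

lemma nn_integral_lborel_affine:
  fixes f :: "'a::euclidean_space \<Rightarrow> ennreal"
  assumes [measurable]: "f \<in> borel_measurable borel" and c: "c \<noteq> 0"
  shows "(\<integral>\<^sup>+x. f x \<partial>lborel) = \<bar>c\<bar> ^ DIM('a) * (\<integral>\<^sup>+x. f (t + c *\<^sub>R x) \<partial>lborel)"
  by (subst lborel_affine[OF c, of t]) (simp add: nn_integral_density nn_integral_distr nn_integral_cmult ennreal_power)

lemma integral_lborel_affine: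
  fixes f :: "'a::euclidean_space \<Rightarrow> complex"
  assumes [measurable]: "f \<in> borel_measurable borel" and c: "c \<noteq> 0"
  shows "(\<integral>x. f x \<partial>lborel) = complex_of_real (\<bar>c\<bar> ^ DIM('a)) * (\<integral>x. f (t + c *\<^sub>R x) \<partial>lborel)"
  by (subst lborel_affine[OF c, of t])
     (simp add: integral_density integral_distr scaleR_conv_of_real of_real_power[symmetric] del: of_real_power)

lemma integral_lborel_prod:
  fixes h :: "'a::euclidean_space \<Rightarrow> real \<Rightarrow> complex"
  assumes "\<And>b. b \<in> Basis \<Longrightarrow> integrable lborel (h b)"
  shows "integrable lborel (\<lambda>x::'a. \<Prod>b\<in>Basis. h b (x \<bullet> b))"
    and "(\<integral>x. (\<Prod>b\<in>Basis. h b (x \<bullet> b)) \<partial>(lborel :: 'a measure)) = (\<Prod>b\<in>Basis. \<integral>x. h b x \<partial>lborel)"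
proof -
  interpret product_sigma_finite "\<lambda>_::'a. lborel :: real measure" by standard
  have [measurable]: "h b \<in> borel_measurable borel" if "b \<in> Basis" for b
    using borel_measurable_integrable[OF assms[OF that]] by simp
  have eq: "(\<Prod>b\<in>Basis. h b ((\<Sum>c\<in>Basis. f c *\<^sub>R c) \<bullet> b)) = (\<Prod>b\<in>Basis. h b (f b))" for f :: "'a \<Rightarrow> real"
    by (intro prod.cong) auto
  show "integrable lborel (\<lambda>x::'a. \<Prod>b\<in>Basis. h b (x \<bullet> b))"
    by (subst lborel_eq, subst integrable_distr_eq) (auto simp: eq intro!: product_integrable_prod assms)
  show "(\<integral>x. (\<Prod>b\<in>Basis. h b (x \<bullet> b)) \<partial>(lborel :: 'a measure)) = (\<Prod>b\<in>Basis. \<integral>x. h b x \<partial>lborel)"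
    by (subst lborel_eq, subst integral_distr) (auto simp: eq intro!: product_integral_prod assms)
qed

section \<open>Gaussians and their Fourier transforms\<close>

lemma gaussian_integral_real:
  assumes "s > 0"
  shows "integrable lborel (\<lambda>t. exp (- s * t\<^sup>2 / 2))" "(\<integral>t. exp (- s * t\<^sup>2 / 2) \<partial>lborel) = sqrt (2 * pi / s)"
proof -
  define \<sigma> where "\<sigma> = sqrt (1 / s)"
  have \<sigma>: "\<sigma> > 0" "\<sigma>\<^sup>2 = 1 / s" using assms by (auto simp: \<sigma>_def)
  have eq: "exp (- s * t\<^sup>2 / 2) = sqrt (2 * pi / s) * normal_density 0 \<sigma> t" for t
    using assms unfolding normal_density_def \<sigma>(2) by (simp add: real_sqrt_divide real_sqrt_mult)
  show "integrable lborel (\<lambda>t. exp (- s * t\<^sup>2 / 2))" unfolding eq using \<sigma> by auto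
  show "(\<integral>t. exp (- s * t\<^sup>2 / 2) \<partial>lborel) = sqrt (2 * pi / s)" unfolding eq using \<sigma> by simp
qed

text \<open>This is the characteristic function of the standard normal distribution after the
  substitution by \<open>sqrt s\<close>.\<close>

lemma gaussian_fourier_real:
  assumes "s > 0"
  shows "integrable lborel (\<lambda>t. complex_of_real (exp (- s * t\<^sup>2 / 2)) * cis (- (t * y)))"
    and "(\<integral>t. complex_of_real (exp (- s * t\<^sup>2 / 2)) * cis (- (t * y)) \<partial>lborel) =
      complex_of_real (sqrt (2 * pi / s) * exp (- (1 / s) * y\<^sup>2 / 2))"
proof -
  show "integrable lborel (\<lambda>t. complex_of_real (exp (- s * t\<^sup>2 / 2)) * cis (- (t * y)))"
    by (rule Bochner_Integration.integrable_bound[OF gaussian_integral_real(1)[OF assms]])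
       (auto simp: norm_mult)
  define t where "t = - y / sqrt s"
  have s: "sqrt s > 0" "sqrt s * sqrt s = s" using assms by auto
  have "complex_of_real (exp (- t\<^sup>2 / 2)) = (CLINT x|std_normal_distribution. iexp (t * x))"
    using fun_cong[OF char_std_normal_distribution, of t] unfolding char_def by simp
  also have "\<dots> = (\<integral>x. std_normal_density x *\<^sub>R cis (t * x) \<partial>lborel)"
    by (subst integral_density) (auto simp: normal_density_nonneg cis_conv_exp)
  also have "\<dots> = \<bar>sqrt s\<bar> *\<^sub>R (\<integral>x. std_normal_density (0 + sqrt s * x) *\<^sub>R cis (t * (0 + sqrt s * x)) \<partial>lborel)"
    using s by (intro lborel_integral_real_affine) auto
  also have "(\<lambda>x. std_normal_density (0 + sqrt s * x) *\<^sub>R cis (t * (0 + sqrt s * x))) =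
      (\<lambda>x. complex_of_real (1 / sqrt (2 * pi)) * (complex_of_real (exp (- s * x\<^sup>2 / 2)) * cis (- (x * y))))"
    using s assms by (auto simp: fun_eq_iff std_normal_density_def t_def power_mult_distrib scaleR_conv_of_real mult.commute)
  finally have eq: "complex_of_real (exp (- t\<^sup>2 / 2)) = complex_of_real (sqrt s / sqrt (2 * pi)) *
      (\<integral>x. complex_of_real (exp (- s * x\<^sup>2 / 2)) * cis (- (x * y)) \<partial>lborel)"
    using s by (simp add: scaleR_conv_of_real)
  have "(\<integral>x. complex_of_real (exp (- s * x\<^sup>2 / 2)) * cis (- (x * y)) \<partial>lborel) =
      complex_of_real (sqrt (2 * pi) / sqrt s) * complex_of_real (exp (- t\<^sup>2 / 2))"
    unfolding eq using s by (simp add: field_simps)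
  moreover have "t\<^sup>2 = (1 / s) * y\<^sup>2" using assms by (simp add: t_def power_divide)
  ultimately show "(\<integral>t. complex_of_real (exp (- s * t\<^sup>2 / 2)) * cis (- (t * y)) \<partial>lborel) =
      complex_of_real (sqrt (2 * pi / s) * exp (- (1 / s) * y\<^sup>2 / 2))"
    by (simp add: real_sqrt_divide)
qed

lemma exp_norm_prod:
  fixes x :: "'a::euclidean_space"
  shows "exp (- s * (norm x)\<^sup>2 / 2) = (\<Prod>b\<in>Basis. exp (- s * (x \<bullet> b)\<^sup>2 / 2))"
  unfolding exp_sum[OF finite_Basis, symmetric] power2_norm_eq_inner euclidean_inner[of x x]
  by (simp add: sum_divide_distrib sum_distrib_left power2_eq_square)

lemma cis_sum: "finite A \<Longrightarrow> cis (\<Sum>a\<in>A. f a) = (\<Prod>a\<in>A. cis (f a))"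
  by (induction A rule: finite_induct) (auto simp: cis_mult[symmetric])

lemma cis_inner_prod:
  fixes x y :: "'a::euclidean_space"
  shows "cis (- (x \<bullet> y)) = (\<Prod>b\<in>Basis. cis (- ((x \<bullet> b) * (y \<bullet> b))))"
  unfolding euclidean_inner[of x y] sum_negf[symmetric] by (rule cis_sum) simp

text \<open>The Fourier transform of \<open>exp (- s * (norm x)\<^sup>2 / 2)\<close>: an approximate
  identity as \<open>s\<close> tends to 0, with total mass \<open>(2 * pi) ^ n\<close> in dimension
  \<open>n\<close> for every \<open>s\<close>.\<close>

definition gauss_kernel :: "real \<Rightarrow> 'a::euclidean_space \<Rightarrow> real" where
  "gauss_kernel s y = (\<Prod>b\<in>Basis. sqrt (2 * pi / s) * exp (- (1 / s) * (y \<bullet> b)\<^sup>2 / 2))"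

lemma gaussian_fourier:
  fixes y :: "'a::euclidean_space"
  assumes "s > 0"
  shows "integrable lborel (\<lambda>x::'a. exp (- s * (norm x)\<^sup>2 / 2))"
    and "(\<integral>x. complex_of_real (exp (- s * (norm x)\<^sup>2 / 2)) * cis (- (x \<bullet> y)) \<partial>lborel) = complex_of_real (gauss_kernel s y)"
proof -
  have eq: "complex_of_real (exp (- s * (norm x)\<^sup>2 / 2)) * cis (- (x \<bullet> y)) =
     (\<Prod>b\<in>Basis. complex_of_real (exp (- s * (x \<bullet> b)\<^sup>2 / 2)) * cis (- ((x \<bullet> b) * (y \<bullet> b))))" for x :: 'a
    by (simp only: exp_norm_prod cis_inner_prod of_real_prod prod.distrib)
  have "integrable lborel (\<lambda>x. complex_of_real (exp (- s * (norm x)\<^sup>2 / 2)) * cis (- (x \<bullet> y)))"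
    unfolding eq by (intro integral_lborel_prod(1)[where h="\<lambda>b t. complex_of_real (exp (- s * t\<^sup>2 / 2)) * cis (- (t * (y \<bullet> b)))"]
       gaussian_fourier_real(1) assms)
  then show "integrable lborel (\<lambda>x::'a. exp (- s * (norm x)\<^sup>2 / 2))"
    by (rule Bochner_Integration.integrable_bound) (auto simp: norm_mult)
  show "(\<integral>x. complex_of_real (exp (- s * (norm x)\<^sup>2 / 2)) * cis (- (x \<bullet> y)) \<partial>lborel) = complex_of_real (gauss_kernel s y)"
    unfolding eq gauss_kernel_def of_real_prod
    using integral_lborel_prod(2)[where h="\<lambda>b t. complex_of_real (exp (- s * t\<^sup>2 / 2)) * cis (- (t * (y \<bullet> b)))"]
      gaussian_fourier_real[OF assms] by simp
qed

lemma gauss_kernel_pos: "s > 0 \<Longrightarrow> gauss_kernel s y > 0"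
  unfolding gauss_kernel_def by (intro prod_pos) auto

lemma gauss_kernel_measurable [measurable]: "gauss_kernel s \<in> borel_measurable borel"
  unfolding gauss_kernel_def[abs_def] by measurable

lemma nn_integral_gauss_kernel:
  assumes "s > 0"
  shows "(\<integral>\<^sup>+y. ennreal (gauss_kernel s (y::'a::euclidean_space)) \<partial>lborel) = ennreal ((2 * pi) ^ DIM('a))"
proof -
  have "(\<integral>\<^sup>+y. ennreal (gauss_kernel s (y::'a)) \<partial>lborel) =
     (\<integral>\<^sup>+y. (\<Prod>b\<in>Basis. ennreal (sqrt (2 * pi / s) * exp (- (1 / s) * ((y::'a) \<bullet> b)\<^sup>2 / 2))) \<partial>lborel)"
    unfolding gauss_kernel_def using assms by (subst prod_ennreal) auto
  also have "\<dots> = (\<Prod>b\<in>(Basis::'a set). \<integral>\<^sup>+t. ennreal (sqrt (2 * pi / s) * exp (- (1 / s) * t\<^sup>2 / 2)) \<partial>lborel)"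
    by (subst nn_integral_lborel_prod) auto
  also have "(\<integral>\<^sup>+t. ennreal (sqrt (2 * pi / s) * exp (- (1 / s) * t\<^sup>2 / 2)) \<partial>lborel) =
      ennreal (\<integral>t. sqrt (2 * pi / s) * exp (- (1 / s) * t\<^sup>2 / 2) \<partial>lborel)"
    using gaussian_integral_real(1)[of "1 / s"] assms by (intro nn_integral_eq_integral integrable_mult_right) auto
  also have "(\<integral>t. sqrt (2 * pi / s) * exp (- (1 / s) * t\<^sup>2 / 2) \<partial>lborel) = sqrt (2 * pi / s) * sqrt (2 * pi * s)"
    using gaussian_integral_real(2)[of "1 / s"] assms by simp
  also have "\<dots> = 2 * pi"
    using assms by (simp add: real_sqrt_mult[symmetric] real_sqrt_divide[symmetric] power2_eq_square[symmetric] real_sqrt_unique)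
  finally show ?thesis by (simp add: ennreal_power)
qed

section \<open>The Fourier transform of integrable functions and Plancherel's inequality\<close>

definition ft :: "('a::euclidean_space \<Rightarrow> complex) \<Rightarrow> 'a \<Rightarrow> complex" where
  "ft f \<xi> = (\<integral>y. f y * cis (- (y \<bullet> \<xi>)) \<partial>lborel)"

lemma integrable_lborelD [measurable_dest]: "integrable lborel f \<Longrightarrow> f \<in> borel_measurable borel"
  using borel_measurable_integrable[of lborel f] by simp

lemma ft_measurable [measurable]:
  assumes [measurable]: "f \<in> borel_measurable borel"
  shows "ft f \<in> borel_measurable borel"
  unfolding ft_def[abs_def] by measurable

lemma integrable_mult_unimodular:
  fixes f :: "'a::euclidean_space \<Rightarrow> complex"
  assumes "integrable lborel f" "g \<in> borel_measurable borel" "\<And>x. norm (g x) = 1"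
  shows "integrable lborel (\<lambda>x. f x * g x)"
  using assms(2) by (intro Bochner_Integration.integrable_bound[OF assms(1)])
    (use assms in \<open>auto simp: norm_mult intro: borel_measurable_times\<close>)

text \<open>If \<open>f\<close> is not integrable, its Bochner integral is 0 by convention and the
  inequality is trivial.\<close>

lemma norm_integral_le_nn_integral: "ennreal (norm (integral\<^sup>L M f)) \<le> (\<integral>\<^sup>+x. norm (f x) \<partial>M)"
  by (cases "integrable M f") (auto simp: not_integrable_integral_eq intro: integral_norm_bound_ennreal)

lemma norm_ft_le: "integrable lborel f \<Longrightarrow> norm (ft f \<xi>) \<le> (\<integral>y. norm (f y) \<partial>lborel)"
  unfolding ft_def by (rule order_trans[OF integral_norm_bound]) (simp add: norm_mult)

lemma integrable_product:
  fixes f :: "'a::euclidean_space \<Rightarrow> complex" and g :: "'b::euclidean_space \<Rightarrow> complex"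
  assumes f: "integrable lborel f" and g: "integrable lborel g"
  shows "integrable (lborel \<Otimes>\<^sub>M lborel) (\<lambda>(x, y). f x * g y)"
proof -
  note [measurable] = integrable_lborelD[OF f] integrable_lborelD[OF g]
  show ?thesis
    by (rule lborel_pair.Fubini_integrable) (use f g in \<open>auto simp: norm_mult\<close>)
qed

text \<open>Fubini's theorem shows that the Fourier transform is symmetric. This moves the transform
  from the data to the symbol, where derivatives become multiplications, and back.\<close>

lemma ft_multiplication:
  fixes f g :: "'a::euclidean_space \<Rightarrow> complex"
  assumes f: "integrable lborel f" and g: "integrable lborel g"
  shows "(\<integral>x. f x * ft g x \<partial>lborel) = (\<integral>x. ft f x * g x \<partial>lborel)"
proof -
  note [measurable] = integrable_lborelD[OF f] integrable_lborelD[OF g]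
  have "integrable (lborel \<Otimes>\<^sub>M lborel) (\<lambda>(x, y). f x * g y * cis (- (y \<bullet> x)))"
    by (rule Bochner_Integration.integrable_bound[OF integrable_product[OF f g]]) (auto simp: norm_mult)
  from lborel_pair.Fubini_integral[OF this]
  have "(\<integral>y. (\<integral>x. f x * g y * cis (- (y \<bullet> x)) \<partial>lborel) \<partial>lborel) = (\<integral>x. (\<integral>y. f x * g y * cis (- (y \<bullet> x)) \<partial>lborel) \<partial>lborel)"
    by simp
  moreover have "(\<integral>x. f x * g y * cis (- (y \<bullet> x)) \<partial>lborel) = ft f y * g y" for y
  proof -
    have "(\<integral>x. f x * g y * cis (- (y \<bullet> x)) \<partial>lborel) = (\<integral>x. (f x * cis (- (x \<bullet> y))) * g y \<partial>lborel)"
      by (simp add: mult_ac inner_commute)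
    then show ?thesis unfolding ft_def by simp
  qed
  moreover have "(\<integral>y. f x * g y * cis (- (y \<bullet> x)) \<partial>lborel) = f x * ft g x" for x
    unfolding ft_def by (simp add: mult.assoc)
  ultimately show ?thesis by simp
qed

text \<open>Expanding the square and carrying out the \<open>\<xi>\<close>-integral first yields the
  form \<open>u y * cnj (u z) * gauss_kernel s (y - z)\<close> in two variables. Schur's test bounds
  it: split the product of moduli by \<open>a * b \<le> a\<^sup>2 / 2 + b\<^sup>2 / 2\<close> and
  use that the kernel has mass \<open>(2 * pi) ^ n\<close> in either variable.\<close>

lemma plancherel_gauss:
  fixes u :: "'a::euclidean_space \<Rightarrow> complex"
  assumes u: "integrable lborel u" and s: "s > 0"
  shows "(\<integral>\<^sup>+\<xi>. ennreal ((norm (ft u \<xi>))\<^sup>2 * exp (- s * (norm \<xi>)\<^sup>2 / 2)) \<partial>lborel) \<le>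
     ennreal ((2 * pi) ^ DIM('a)) * (\<integral>\<^sup>+y. ennreal ((norm (u y))\<^sup>2) \<partial>lborel)"
proof -
  note [measurable] = integrable_lborelD[OF u]
  let ?e = "\<lambda>\<xi>::'a. exp (- s * (norm \<xi>)\<^sup>2 / 2)"
  let ?U = "\<lambda>(y, z). u y * cnj (u z)"
  have cu: "integrable lborel (\<lambda>z. cnj (u z))" using u by simp
  have U: "integrable (lborel \<Otimes>\<^sub>M lborel) ?U" by (rule integrable_product[OF u cu])
  then have U': "integrable (lborel :: ('a \<times> 'a) measure) ?U" by (simp add: lborel_prod)
  have e: "integrable lborel (\<lambda>\<xi>::'a. complex_of_real (?e \<xi>))" using gaussian_fourier(1)[OF s, where 'a='a] by (rule integrable_of_real)
  have ftsq: "complex_of_real ((norm (ft u \<xi>))\<^sup>2) = (\<integral>(y, z). u y * cnj (u z) * cis (- (\<xi> \<bullet> (y - z))) \<partial>(lborel \<Otimes>\<^sub>M lborel))" for \<xi>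
  proof -
    have "integrable lborel (\<lambda>y. u y * cis (- (y \<bullet> \<xi>)))"
      by (intro integrable_mult_unimodular u) auto
    from integrable_product[OF this integrable_cnj[OF this]]
    have "(\<integral>(y, z). (u y * cis (- (y \<bullet> \<xi>))) * cnj (u z * cis (- (z \<bullet> \<xi>))) \<partial>(lborel \<Otimes>\<^sub>M lborel)) =
      (\<integral>y. \<integral>z. (u y * cis (- (y \<bullet> \<xi>))) * cnj (u z * cis (- (z \<bullet> \<xi>))) \<partial>lborel \<partial>lborel)"
      by (subst lborel_pair.integral_fst'[symmetric]) auto
    also have "\<dots> = ft u \<xi> * cnj (ft u \<xi>)" unfolding ft_def by (simp del: complex_cnj_mult)
    also have "\<dots> = complex_of_real ((norm (ft u \<xi>))\<^sup>2)" using complex_norm_square[of "ft u \<xi>"] by simp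
    finally have "complex_of_real ((norm (ft u \<xi>))\<^sup>2) =
       (\<integral>(y, z). (u y * cis (- (y \<bullet> \<xi>))) * cnj (u z * cis (- (z \<bullet> \<xi>))) \<partial>(lborel \<Otimes>\<^sub>M lborel))" by simp
    also have "\<dots> = (\<integral>(y, z). u y * cnj (u z) * cis (- (\<xi> \<bullet> (y - z))) \<partial>(lborel \<Otimes>\<^sub>M lborel))"
    proof (intro Bochner_Integration.integral_cong refl, clarify)
      fix y z
      have "cis (- (\<xi> \<bullet> (y - z))) = cis (- (y \<bullet> \<xi>)) * cis (z \<bullet> \<xi>)"
        by (simp add: cis_mult inner_diff_right inner_commute)
      then show "(u y * cis (- (y \<bullet> \<xi>))) * cnj (u z * cis (- (z \<bullet> \<xi>))) = u y * cnj (u z) * cis (- (\<xi> \<bullet> (y - z)))"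
        by (simp add: cis_cnj)
    qed
    finally show ?thesis .
  qed
  \<comment> \<open>The Gaussian supplies the decay in \<open>\<xi>\<close> without which the triple
    integral would not converge absolutely and the order of integration could not be
    changed.\<close>
  have int3: "integrable (lborel \<Otimes>\<^sub>M lborel) (\<lambda>(\<xi>, w). complex_of_real (?e \<xi>) * ?U w * cis (- (\<xi> \<bullet> (fst w - snd w))))"
  proof (rule Bochner_Integration.integrable_bound[OF integrable_product[OF e U']])
    have "(\<lambda>p. complex_of_real (?e (fst p)) * (u (fst (snd p)) * cnj (u (snd (snd p)))) *
        cis (- (fst p \<bullet> (fst (snd p) - snd (snd p))))) \<in> borel_measurable (borel \<Otimes>\<^sub>M (borel \<Otimes>\<^sub>M borel))"
      by measurable
    then show "(\<lambda>(\<xi>, w). complex_of_real (?e \<xi>) * ?U w * cis (- (\<xi> \<bullet> (fst w - snd w)))) \<in>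
        borel_measurable (lborel \<Otimes>\<^sub>M lborel)"
      by (simp add: lborel_prod borel_prod split_beta)
  qed (auto simp: norm_mult split_beta)
  have "complex_of_real (\<integral>\<xi>. (norm (ft u \<xi>))\<^sup>2 * ?e \<xi> \<partial>lborel) =
     (\<integral>\<xi>. complex_of_real ((norm (ft u \<xi>))\<^sup>2) * complex_of_real (?e \<xi>) \<partial>lborel)"
    by (simp only: integral_complex_of_real[symmetric] of_real_mult)
  also have "\<dots> = (\<integral>\<xi>. (\<integral>w. complex_of_real (?e \<xi>) * ?U w * cis (- (\<xi> \<bullet> (fst w - snd w))) \<partial>lborel) \<partial>lborel)"
    unfolding ftsq lborel_prod
    by (intro Bochner_Integration.integral_cong refl)
       (simp add: case_prod_unfold mult.assoc mult.commute[of _ "complex_of_real (exp _)"])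
  also have "\<dots> = (\<integral>w. (\<integral>\<xi>. complex_of_real (?e \<xi>) * ?U w * cis (- (\<xi> \<bullet> (fst w - snd w))) \<partial>lborel) \<partial>lborel)"
    using lborel_pair.Fubini_integral[OF int3] by simp
  also have "\<dots> = (\<integral>w. ?U w * complex_of_real (gauss_kernel s (fst w - snd w)) \<partial>lborel)"
  proof (intro Bochner_Integration.integral_cong refl)
    fix w :: "'a \<times> 'a"
    have "(\<integral>\<xi>. complex_of_real (?e \<xi>) * ?U w * cis (- (\<xi> \<bullet> (fst w - snd w))) \<partial>lborel) =
      (\<integral>\<xi>. ?U w * (complex_of_real (?e \<xi>) * cis (- (\<xi> \<bullet> (fst w - snd w)))) \<partial>lborel)"
      by (simp add: mult_ac)
    then show "(\<integral>\<xi>. complex_of_real (?e \<xi>) * ?U w * cis (- (\<xi> \<bullet> (fst w - snd w))) \<partial>lborel) =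
       ?U w * complex_of_real (gauss_kernel s (fst w - snd w))"
      using gaussian_fourier(2)[OF s, of "fst w - snd w"] by simp
  qed
  finally have main: "complex_of_real (\<integral>\<xi>. (norm (ft u \<xi>))\<^sup>2 * ?e \<xi> \<partial>lborel) =
      (\<integral>w. ?U w * complex_of_real (gauss_kernel s (fst w - snd w)) \<partial>lborel)" .
  let ?I = "\<integral>y. norm (u y) \<partial>lborel"
  have int: "integrable lborel (\<lambda>\<xi>. (norm (ft u \<xi>))\<^sup>2 * ?e \<xi>)"
  proof (rule Bochner_Integration.integrable_bound[of _ "\<lambda>\<xi>. ?I\<^sup>2 * ?e \<xi>"])
    show "integrable lborel (\<lambda>\<xi>::'a. ?I\<^sup>2 * ?e \<xi>)" using gaussian_fourier(1)[OF s] by auto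
    show "AE \<xi> in lborel. norm ((norm (ft u \<xi>))\<^sup>2 * ?e \<xi>) \<le> norm (?I\<^sup>2 * ?e \<xi>)"
      using norm_ft_le[OF u] by (auto intro!: mult_right_mono power_mono AE_I2)
  qed measurable
  have "(\<integral>\<^sup>+\<xi>. ennreal ((norm (ft u \<xi>))\<^sup>2 * ?e \<xi>) \<partial>lborel) = ennreal (\<integral>\<xi>. (norm (ft u \<xi>))\<^sup>2 * ?e \<xi> \<partial>lborel)"
    by (intro nn_integral_eq_integral int) auto
  also have "\<dots> = ennreal (norm (complex_of_real (\<integral>\<xi>. (norm (ft u \<xi>))\<^sup>2 * ?e \<xi> \<partial>lborel)))"
    by simp
  also have "\<dots> \<le> (\<integral>\<^sup>+w. norm (?U w * complex_of_real (gauss_kernel s (fst w - snd w))) \<partial>lborel)"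
    unfolding main by (rule norm_integral_le_nn_integral)
  also have "\<dots> = (\<integral>\<^sup>+y. \<integral>\<^sup>+z. norm (u y) * norm (u z) * gauss_kernel s (y - z) \<partial>lborel \<partial>lborel)"
    unfolding lborel_prod[symmetric] using gauss_kernel_pos[OF s, where 'a='a]
    by (subst lborel.nn_integral_fst[symmetric]) (auto simp: norm_mult split_beta less_imp_le)
  also have "\<dots> \<le> (\<integral>\<^sup>+y. \<integral>\<^sup>+z. ennreal ((norm (u y))\<^sup>2 / 2) * gauss_kernel s (y - z) +
      ennreal ((norm (u z))\<^sup>2 / 2) * gauss_kernel s (y - z) \<partial>lborel \<partial>lborel)"
  proof (intro nn_integral_mono)
    fix y z
    have "norm (u y) * norm (u z) \<le> (norm (u y))\<^sup>2 / 2 + (norm (u z))\<^sup>2 / 2"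
      using sum_squares_bound[of "norm (u y)" "norm (u z)"] by linarith
    then have "norm (u y) * norm (u z) * gauss_kernel s (y - z) \<le>
        (norm (u y))\<^sup>2 / 2 * gauss_kernel s (y - z) + (norm (u z))\<^sup>2 / 2 * gauss_kernel s (y - z)"
      using gauss_kernel_pos[OF s, of "y - z"] unfolding distrib_right[symmetric] by (intro mult_right_mono) auto
    then show "ennreal (norm (u y) * norm (u z) * gauss_kernel s (y - z)) \<le>
        ennreal ((norm (u y))\<^sup>2 / 2) * gauss_kernel s (y - z) + ennreal ((norm (u z))\<^sup>2 / 2) * gauss_kernel s (y - z)"
      using gauss_kernel_pos[OF s, of "y - z"] by (simp add: ennreal_mult[symmetric] ennreal_plus[symmetric] del: ennreal_plus)
  qed
  also have "\<dots> = (\<integral>\<^sup>+y. \<integral>\<^sup>+z. ennreal ((norm (u y))\<^sup>2 / 2) * gauss_kernel s (y - z) \<partial>lborel \<partial>lborel) +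
      (\<integral>\<^sup>+y. \<integral>\<^sup>+z. ennreal ((norm (u z))\<^sup>2 / 2) * gauss_kernel s (y - z) \<partial>lborel \<partial>lborel)"
    by (simp add: nn_integral_add)
  also have "(\<integral>\<^sup>+y. \<integral>\<^sup>+z. ennreal ((norm (u z))\<^sup>2 / 2) * gauss_kernel s (y - z) \<partial>lborel \<partial>lborel) =
     (\<integral>\<^sup>+z. \<integral>\<^sup>+y. ennreal ((norm (u z))\<^sup>2 / 2) * gauss_kernel s (y - z) \<partial>lborel \<partial>lborel)"
    by (rule lborel_pair.Fubini') measurable
  also have "(\<integral>\<^sup>+y. \<integral>\<^sup>+z. ennreal ((norm (u y))\<^sup>2 / 2) * gauss_kernel s (y - z) \<partial>lborel \<partial>lborel) =
     (\<integral>\<^sup>+y. ennreal ((norm (u y))\<^sup>2 / 2) * ennreal ((2 * pi) ^ DIM('a)) \<partial>lborel)"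
  proof (intro nn_integral_cong)
    fix y :: 'a
    have "(\<integral>\<^sup>+z. ennreal (gauss_kernel s (y - z)) \<partial>lborel) = ennreal ((2 * pi) ^ DIM('a))"
      using nn_integral_lborel_affine[of "\<lambda>z. ennreal (gauss_kernel s z)" "-1" y]
      by (simp add: nn_integral_gauss_kernel[OF s])
    then show "(\<integral>\<^sup>+z. ennreal ((norm (u y))\<^sup>2 / 2) * gauss_kernel s (y - z) \<partial>lborel) =
       ennreal ((norm (u y))\<^sup>2 / 2) * ennreal ((2 * pi) ^ DIM('a))"
      by (simp add: nn_integral_cmult)
  qed
  also have "(\<integral>\<^sup>+z. \<integral>\<^sup>+y. ennreal ((norm (u z))\<^sup>2 / 2) * gauss_kernel s (y - z) \<partial>lborel \<partial>lborel) =
     (\<integral>\<^sup>+z. ennreal ((norm (u z))\<^sup>2 / 2) * ennreal ((2 * pi) ^ DIM('a)) \<partial>lborel)"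
  proof (intro nn_integral_cong)
    fix z :: 'a
    have "(\<integral>\<^sup>+y. ennreal (gauss_kernel s (y - z)) \<partial>lborel) = ennreal ((2 * pi) ^ DIM('a))"
      using nn_integral_lborel_affine[of "\<lambda>z. ennreal (gauss_kernel s z)" "1" "-z"]
      by (simp add: nn_integral_gauss_kernel[OF s])
    then show "(\<integral>\<^sup>+y. ennreal ((norm (u z))\<^sup>2 / 2) * gauss_kernel s (y - z) \<partial>lborel) =
       ennreal ((norm (u z))\<^sup>2 / 2) * ennreal ((2 * pi) ^ DIM('a))"
      by (simp add: nn_integral_cmult)
  qed
  also have "(\<integral>\<^sup>+y. ennreal ((norm (u y))\<^sup>2 / 2) * ennreal ((2 * pi) ^ DIM('a)) \<partial>lborel) +
      (\<integral>\<^sup>+y. ennreal ((norm (u y))\<^sup>2 / 2) * ennreal ((2 * pi) ^ DIM('a)) \<partial>lborel) =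
      (\<integral>\<^sup>+y. ennreal ((2 * pi) ^ DIM('a)) * ennreal ((norm (u y))\<^sup>2) \<partial>lborel)"
    by (subst nn_integral_add[symmetric])
       (auto intro!: nn_integral_cong simp: ennreal_mult[symmetric] ennreal_plus[symmetric] simp del: ennreal_plus)
  also have "\<dots> = ennreal ((2 * pi) ^ DIM('a)) * (\<integral>\<^sup>+y. ennreal ((norm (u y))\<^sup>2) \<partial>lborel)"
    by (rule nn_integral_cmult) measurable
  finally show ?thesis .
qed

text \<open>The Gaussian damping increases to 1 as its parameter decreases to 0, while the bound
  does not depend on the parameter; monotone convergence removes it.\<close>

theorem plancherel_le:
  fixes u :: "'a::euclidean_space \<Rightarrow> complex"
  assumes u: "integrable lborel u"
  shows "(\<integral>\<^sup>+\<xi>. ennreal ((norm (ft u \<xi>))\<^sup>2) \<partial>lborel) \<le>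
     ennreal ((2 * pi) ^ DIM('a)) * (\<integral>\<^sup>+y. ennreal ((norm (u y))\<^sup>2) \<partial>lborel)"
proof (rule LIMSEQ_le_const2)
  note [measurable] = integrable_lborelD[OF u]
  let ?f = "\<lambda>k \<xi>. ennreal ((norm (ft u \<xi>))\<^sup>2 * exp (- inverse (real (Suc k)) * (norm \<xi>)\<^sup>2 / 2))"
  show "(\<lambda>k. \<integral>\<^sup>+\<xi>. ?f k \<xi> \<partial>lborel) \<longlonglongrightarrow> (\<integral>\<^sup>+\<xi>. ennreal ((norm (ft u \<xi>))\<^sup>2) \<partial>lborel)"
  proof (rule nn_integral_LIMSEQ)
    show "mono ?f"
    proof (intro monoI le_funI ennreal_leI mult_left_mono)
      fix i j :: nat and \<xi> :: 'a assume "i \<le> j"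
      then have "inverse (real (Suc j)) * (norm \<xi>)\<^sup>2 \<le> inverse (real (Suc i)) * (norm \<xi>)\<^sup>2"
        by (intro mult_right_mono le_imp_inverse_le) auto
      then show "exp (- inverse (real (Suc i)) * (norm \<xi>)\<^sup>2 / 2) \<le> exp (- inverse (real (Suc j)) * (norm \<xi>)\<^sup>2 / 2)"
        by simp
    qed simp
    show "(\<lambda>k. ?f k \<xi>) \<longlonglongrightarrow> ennreal ((norm (ft u \<xi>))\<^sup>2)" for \<xi>
    proof -
      have "(\<lambda>k. (norm (ft u \<xi>))\<^sup>2 * exp (- inverse (real (Suc k)) * (norm \<xi>)\<^sup>2 / 2)) \<longlonglongrightarrow> (norm (ft u \<xi>))\<^sup>2 * exp (- 0 * (norm \<xi>)\<^sup>2 / 2)"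
        by (intro tendsto_intros LIMSEQ_inverse_real_of_nat) auto
      then show ?thesis by (intro tendsto_ennrealI) simp
    qed
  qed measurable
  show "\<exists>N. \<forall>k\<ge>N. (\<integral>\<^sup>+\<xi>. ?f k \<xi> \<partial>lborel) \<le> ennreal ((2 * pi) ^ DIM('a)) * (\<integral>\<^sup>+y. ennreal ((norm (u y))\<^sup>2) \<partial>lborel)"
    using plancherel_gauss[OF u, of "inverse (real (Suc k))" for k] by auto
qed

section \<open>Integration by parts in the frequency variables\<close>

lemma integral_translate:
  fixes f :: "'a::euclidean_space \<Rightarrow> 'b::{banach, second_countable_topology}"
  assumes "f \<in> borel_measurable borel"
  shows "(\<integral>x. f (x + c) \<partial>lborel) = (\<integral>x. f x \<partial>lborel)"
    and "integrable lborel (\<lambda>x. f (x + c)) \<longleftrightarrow> integrable lborel f"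
proof -
  show "(\<integral>x. f (x + c) \<partial>lborel) = (\<integral>x. f x \<partial>lborel)"
    using assms by (subst (2) lborel_distr_plus[of c, symmetric], subst integral_distr) (auto simp: add.commute)
  show "integrable lborel (\<lambda>x. f (x + c)) \<longleftrightarrow> integrable lborel f"
    using assms by (subst (2) lborel_distr_plus[of c, symmetric], subst integrable_distr_eq) (auto simp: add.commute)
qed

lemma has_vector_derivative_cis: "(cis has_vector_derivative \<i> * cis t) (at t)"
proof -
  have "((\<lambda>w. exp (\<i> * w)) has_field_derivative \<i> * cis t) (at (of_real t))"
    by (auto intro!: derivative_eq_intros simp: cis_conv_exp)
  from has_vector_derivative_real_field[OF this] show ?thesis
    by (simp add: cis_conv_exp[abs_def])
qed

text \<open>\<open>bnd\<close> provides derivatives along lines only at parameter 0; integration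
  along a segment needs them at every parameter.\<close>

lemma has_vector_derivative_line_shift:
  fixes f :: "'a::real_normed_vector \<Rightarrow> 'b::real_normed_vector"
  assumes "((\<lambda>t. f ((z + s *\<^sub>R b) + t *\<^sub>R b)) has_vector_derivative D) (at 0)"
  shows "((\<lambda>t. f (z + t *\<^sub>R b)) has_vector_derivative D) (at s)"
proof -
  have "((\<lambda>t. t - s) has_real_derivative 1) (at s)" by (auto intro!: derivative_eq_intros)
  then have "((\<lambda>t. t - s) has_vector_derivative 1) (at s)"
    by (simp add: has_real_derivative_iff_has_vector_derivative)
  from vector_diff_chain_at[OF this, of "\<lambda>t. f ((z + s *\<^sub>R b) + t *\<^sub>R b)" D] assms
  moreover have "z + s *\<^sub>R b + (t - s) *\<^sub>R b = z + t *\<^sub>R b" for t by (simp add: scaleR_left_diff_distrib)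
  ultimately show ?thesis by (simp add: o_def)
qed

text \<open>The average of \<open>h'\<close> over the segment from \<open>z\<close> to
  \<open>z + b\<close> is \<open>h (z + b) - h z\<close>. Integrating over \<open>z\<close>, the
  left side gives the integral of \<open>h'\<close> by Fubini and the right side 0 by translation
  invariance. No boundary terms at infinity arise.\<close>

lemma integral_deriv_zero:
  fixes h :: "'a::euclidean_space \<Rightarrow> complex"
  assumes ch: "continuous_on UNIV h" "continuous_on UNIV h'"
    and ih: "integrable lborel h" "integrable lborel h'"
    and d: "\<And>z. ((\<lambda>t. h (z + t *\<^sub>R b)) has_vector_derivative h' z) (at 0)"
  shows "(\<integral>z. h' z \<partial>lborel) = 0"
proof -
  note [measurable] = integrable_lborelD[OF ih(1)] integrable_lborelD[OF ih(2)]
  let ?g = "\<lambda>(s::real) z. indicator {0..1} s *\<^sub>R h' (z + s *\<^sub>R b)"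
  have "integrable (lborel \<Otimes>\<^sub>M lborel) (case_prod ?g)"
  proof (rule lborel_pair.Fubini_integrable)
    show "(\<lambda>(s, z). ?g s z) \<in> borel_measurable (lborel \<Otimes>\<^sub>M lborel)"
      by measurable
    have "(\<integral>z. norm (?g s z) \<partial>lborel) = indicator {0..1} s * (\<integral>z. norm (h' z) \<partial>lborel)" for s
      using integral_translate(1)[of "\<lambda>z. norm (h' z)" "s *\<^sub>R b"] by simp
    then show "integrable lborel (\<lambda>s. \<integral>z. norm (case_prod ?g (s, z)) \<partial>lborel)"
      unfolding case_prod_conv by (simp only: integrable_mult_left_iff) simp
    show "AE s in lborel. integrable lborel (\<lambda>z. case_prod ?g (s, z))"
      using integral_translate(2)[of h'] ih by simp
  qed
  from lborel_pair.Fubini_integral[OF this]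
  have F: "(\<integral>z. (\<integral>s. ?g s z \<partial>lborel) \<partial>lborel) = (\<integral>s. (\<integral>z. ?g s z \<partial>lborel) \<partial>lborel)" by simp
  have "(\<integral>s. ?g s z \<partial>lborel) = h (z + b) - h z" for z
  proof -
    have "(\<integral>s. ?g s z \<partial>lborel) = h (z + 1 *\<^sub>R b) - h (z + 0 *\<^sub>R b)"
    proof (rule integral_FTC_atLeastAtMost)
      show "((\<lambda>s. h (z + s *\<^sub>R b)) has_vector_derivative h' (z + s *\<^sub>R b)) (at s within {0..1})" for s
        using has_vector_derivative_line_shift[OF d[of "z + s *\<^sub>R b"]] by (rule has_vector_derivative_at_within)
      show "continuous_on {0..1} (\<lambda>s. h' (z + s *\<^sub>R b))"
        by (rule continuous_on_compose2[OF ch(2)]) (auto intro!: continuous_intros)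
    qed auto
    then show ?thesis by simp
  qed
  then have "(\<integral>z. (\<integral>s. ?g s z \<partial>lborel) \<partial>lborel) = 0"
    using ih integral_translate[of h b] by simp
  moreover have "(\<integral>s. (\<integral>z. ?g s z \<partial>lborel) \<partial>lborel) = (\<integral>s. indicator {0..1::real} s *\<^sub>R (\<integral>z. h' z \<partial>lborel) \<partial>lborel)"
    using integral_translate(1)[of h' "s *\<^sub>R b" for s] by (intro Bochner_Integration.integral_cong) simp_all
  moreover have "(\<integral>s. indicator {0..1::real} s *\<^sub>R (\<integral>z. h' z \<partial>lborel) \<partial>lborel) = (\<integral>z. h' z \<partial>lborel)"
    by simp
  ultimately show ?thesis using F by (simp only:)
qed

lemma ft_deriv:
  fixes \<tau> :: "'a::euclidean_space \<Rightarrow> complex"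
  assumes c: "continuous_on UNIV \<tau>" "continuous_on UNIV \<tau>'"
    and i: "integrable lborel \<tau>" "integrable lborel \<tau>'"
    and d: "\<And>z. ((\<lambda>t. \<tau> (z + t *\<^sub>R b)) has_vector_derivative \<tau>' z) (at 0)"
  shows "ft \<tau>' y = \<i> * complex_of_real (y \<bullet> b) * ft \<tau> y"
proof -
  have i': "integrable lborel (\<lambda>z. \<tau> z * cis (- (z \<bullet> y)))" "integrable lborel (\<lambda>z. \<tau>' z * cis (- (z \<bullet> y)))"
    by (intro integrable_mult_unimodular i; auto)+
  have "(\<integral>z. \<tau>' z * cis (- (z \<bullet> y)) + - (\<i> * complex_of_real (y \<bullet> b)) * (\<tau> z * cis (- (z \<bullet> y))) \<partial>lborel) = 0"
  proof (rule integral_deriv_zero[where h="\<lambda>z. \<tau> z * cis (- (z \<bullet> y))" and b=b])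
    show "continuous_on UNIV (\<lambda>z. \<tau> z * cis (- (z \<bullet> y)))"
      "continuous_on UNIV (\<lambda>z. \<tau>' z * cis (- (z \<bullet> y)) + - (\<i> * complex_of_real (y \<bullet> b)) * (\<tau> z * cis (- (z \<bullet> y))))"
      by (intro continuous_intros c)+
    show "integrable lborel (\<lambda>z. \<tau>' z * cis (- (z \<bullet> y)) + - (\<i> * complex_of_real (y \<bullet> b)) * (\<tau> z * cis (- (z \<bullet> y))))"
      by (intro Bochner_Integration.integrable_add integrable_mult_right i')
    show "((\<lambda>t. \<tau> (z + t *\<^sub>R b) * cis (- ((z + t *\<^sub>R b) \<bullet> y))) has_vector_derivative
        \<tau>' z * cis (- (z \<bullet> y)) + - (\<i> * complex_of_real (y \<bullet> b)) * (\<tau> z * cis (- (z \<bullet> y)))) (at 0)" for z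
    proof -
      have "((\<lambda>t. - ((z + t *\<^sub>R b) \<bullet> y)) has_real_derivative - (y \<bullet> b)) (at 0)"
        unfolding inner_add_left inner_scaleR_left inner_commute[of y b] by (auto intro!: derivative_eq_intros)
      then have "((\<lambda>t. cis (- ((z + t *\<^sub>R b) \<bullet> y))) has_vector_derivative - (y \<bullet> b) *\<^sub>R (\<i> * cis (- (z \<bullet> y)))) (at 0)"
        using vector_diff_chain_at[of "\<lambda>t. - ((z + t *\<^sub>R b) \<bullet> y)" "- (y \<bullet> b)" 0 cis "\<i> * cis (- (z \<bullet> y))"]
          has_vector_derivative_cis[of "- (z \<bullet> y)"]
        by (simp add: o_def has_real_derivative_iff_has_vector_derivative)
      from has_vector_derivative_mult[OF d[of z] this]
      show ?thesis by (simp add: scaleR_conv_of_real algebra_simps)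
    qed
  qed (rule i')
  then show ?thesis
    unfolding ft_def using i' by (simp add: mult.assoc)
qed

lemma norm_one_plus_i: "1 \<le> norm (1 + \<i> * complex_of_real t)"
  by (simp add: cmod_def)

lemma one_plus_i_nz: "1 + \<i> * complex_of_real t \<noteq> 0"
  using norm_one_plus_i[of t] by force

lemma integrable_div_one_plus_i:
  fixes H :: "'a::euclidean_space \<Rightarrow> complex"
  assumes H: "integrable lborel H"
  shows "integrable lborel (\<lambda>y. H y / (1 + \<i> * complex_of_real (y \<bullet> b)))"
proof (rule Bochner_Integration.integrable_bound[OF H])
  note [measurable] = integrable_lborelD[OF H]
  show "(\<lambda>y. H y / (1 + \<i> * complex_of_real (y \<bullet> b))) \<in> borel_measurable lborel" by measurable
  show "AE y in lborel. norm (H y / (1 + \<i> * complex_of_real (y \<bullet> b))) \<le> norm (H y)"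
    using norm_one_plus_i by (auto simp: norm_divide divide_le_eq mult_le_cancel_left1 intro!: AE_I2)
qed

text \<open>The transform of \<open>\<tau> + \<tau>'\<close> is
  \<open>1 + \<i> * (y \<bullet> b)\<close> times that of \<open>\<tau>\<close>. Adding
  \<open>\<tau>\<close> to its derivative makes the factor free of zeros, so dividing the data by it
  is harmless also near the origin.\<close>

lemma ft_by_parts:
  fixes \<tau> H :: "'a::euclidean_space \<Rightarrow> complex"
  assumes c: "continuous_on UNIV \<tau>" "continuous_on UNIV \<tau>'"
    and i: "integrable lborel \<tau>" "integrable lborel \<tau>'"
    and d: "\<And>z. ((\<lambda>t. \<tau> (z + t *\<^sub>R b)) has_vector_derivative \<tau>' z) (at 0)"
    and H: "integrable lborel H"
  shows "(\<integral>z. \<tau> z * ft H z \<partial>lborel) =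
    (\<integral>z. (\<tau> z + \<tau>' z) * ft (\<lambda>y. H y / (1 + \<i> * complex_of_real (y \<bullet> b))) z \<partial>lborel)"
proof -
  have i2: "integrable lborel (\<lambda>z. \<tau> z + \<tau>' z)" using i by auto
  have "ft (\<lambda>z. \<tau> z + \<tau>' z) y = ft \<tau> y + ft \<tau>' y" for y
    unfolding ft_def distrib_right using i
    by (intro Bochner_Integration.integral_add integrable_mult_unimodular) auto
  then have e: "ft (\<lambda>z. \<tau> z + \<tau>' z) y = (1 + \<i> * complex_of_real (y \<bullet> b)) * ft \<tau> y" for y
    using ft_deriv[OF c i d] by (simp add: algebra_simps)
  show ?thesis
    unfolding ft_multiplication[OF i(1) H] ft_multiplication[OF i2 integrable_div_one_plus_i[OF H]] e
    using one_plus_i_nz by (intro Bochner_Integration.integral_cong) auto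
qed

lemma continuous_cbox_support_integrable:
  fixes f :: "'a::euclidean_space \<Rightarrow> complex"
  assumes "continuous_on UNIV f" "\<And>z. z \<notin> cbox a b \<Longrightarrow> f z = 0"
  shows "integrable lborel f"
proof -
  have "integrable lborel (\<lambda>x. indicator (cbox a b) x *\<^sub>R f x)"
    by (rule borel_integrable_compact) (auto intro: continuous_on_subset[OF assms(1)])
  also have "(\<lambda>x. indicator (cbox a b) x *\<^sub>R f x) = f"
    using assms(2) by (auto simp: fun_eq_iff split: split_indicator)
  finally show ?thesis .
qed

text \<open>A symbol is a function of \<open>(x, \<zeta>)\<close> with \<open>\<zeta> = (\<xi>, \<eta>)\<close>. Treating the two frequencies as one
  vector makes the bilinear operator a linear one applied to \<open>\<Phi> \<zeta> = ft f \<xi> * ft g \<eta>\<close>.\<close>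

definition freq_supp :: "real \<Rightarrow> ('v::euclidean_space \<times> ('v \<times> 'v) \<Rightarrow> complex) \<Rightarrow> bool" where
  "freq_supp R B \<longleftrightarrow> (\<forall>x \<zeta>. \<zeta> \<notin> cbox (- R *\<^sub>R One) (R *\<^sub>R One) \<longrightarrow> B (x, \<zeta>) = 0)"

text \<open>Here the factor \<open>(x, x) \<bullet> b\<close> that appears when the phase is
  differentiated in frequency is at most 1 in modulus.\<close>

definition unit_slab :: "('v::euclidean_space \<times> ('v \<times> 'v)) set" where
  "unit_slab = cbox 0 One \<times> UNIV"

text \<open>The phase \<open>(x, x) \<bullet> \<zeta>\<close> equals
  \<open>x \<bullet> (\<xi> + \<eta>)\<close>: the bilinear operator is a linear one in doubled
  dimension, restricted to the diagonal.\<close>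

definition mult_op :: "('v::euclidean_space \<times> ('v \<times> 'v) \<Rightarrow> complex) \<Rightarrow> ('v \<times> 'v \<Rightarrow> complex) \<Rightarrow> 'v \<Rightarrow> complex" where
  "mult_op B \<Phi> x = (\<integral>\<zeta>. B (x, \<zeta>) * \<Phi> \<zeta> * cis ((x, x) \<bullet> \<zeta>) \<partial>lborel)"

lemma freq_supp_deriv:
  assumes s: "freq_supp R B" and d: "\<And>z. ((\<lambda>t. B (z + t *\<^sub>R b)) has_vector_derivative D z) (at 0)"
  shows "freq_supp R D"
  unfolding freq_supp_def
proof (intro allI impI)
  fix x :: 'a and \<zeta> :: "'a \<times> 'a" assume z: "\<zeta> \<notin> cbox (- R *\<^sub>R One) (R *\<^sub>R One)"
  show "D (x, \<zeta>) = 0"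
  proof (rule derivative_zero_open[OF _ _ _ d])
    show "open (UNIV \<times> (- cbox (- R *\<^sub>R One) (R *\<^sub>R One)) :: ('a \<times> ('a \<times> 'a)) set)"
      by (intro open_Times open_UNIV open_Compl closed_cbox)
  qed (use z s in \<open>auto simp: freq_supp_def\<close>)
qed

text \<open>For fixed \<open>x\<close>, integration by parts is applied to the symbol times the
  exponential. The derivative falling on the exponential contributes
  \<open>\<i> * ((x, x) \<bullet> b)\<close>, so the new symbol is
  \<open>(1 + \<i> * ((x, x) \<bullet> b)) * B\<close> plus the derivative of \<open>B\<close>. One
  derivative of \<open>B\<close> is lost, the support is kept.\<close>

lemma mult_op_by_parts:
  fixes B :: "'v::euclidean_space \<times> ('v \<times> 'v) \<Rightarrow> complex"
  assumes B: "bnd unit_slab (Suc N) C B" "freq_supp R B" and C: "0 \<le> C" and b: "b \<in> Basis"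
  obtains B' where "bnd unit_slab N (2 ^ (N + 2) * C) B'" "freq_supp R B'"
    "\<And>H x. integrable lborel H \<Longrightarrow> mult_op B (ft H) x = mult_op B' (ft (\<lambda>y. H y / (1 + \<i> * complex_of_real (y \<bullet> b)))) x"
proof -
  have b': "(0, b) \<in> (Basis :: ('v \<times> ('v \<times> 'v)) set)" using b by (auto simp: Basis_prod_def)
  obtain D where D: "\<And>z. ((\<lambda>t. B (z + t *\<^sub>R (0, b))) has_vector_derivative D z) (at 0)" "bnd unit_slab N C D"
    using bnd_SucE[OF B(1)] b' by metis
  have sD: "freq_supp R D" using freq_supp_deriv[OF B(2) D(1)] .
  \<comment> \<open>The factor depends on \<open>x\<close> alone and is written as an inner product
    on the whole space, where \<open>bnd_inner\<close> applies. As \<open>b\<close> lies in a single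
    frequency block, \<open>v\<close> is a basis vector of the \<open>x\<close>-block.\<close>
  define v :: "'v \<times> ('v \<times> 'v)" where "v = (fst b + snd b, 0)"
  have v: "(x, \<zeta>) \<bullet> v = (x, x) \<bullet> b" for x \<zeta> by (simp add: v_def inner_prod_def inner_add_right)
  define B' where "B' z = (1 + \<i> * complex_of_real (z \<bullet> v)) * B z + D z" for z
  have b1: "(\<exists>c\<in>Basis. b = (c, 0)) \<or> (\<exists>c\<in>Basis. b = (0, c))" using b by (auto simp: Basis_prod_def)
  have "bnd unit_slab N 1 (\<lambda>z::'v \<times> ('v \<times> 'v). complex_of_real (z \<bullet> v))"
  proof (rule bnd_inner)
    show "\<bar>z \<bullet> v\<bar> \<le> 1" if "z \<in> unit_slab" for z
      using that b1 by (cases z) (auto simp: unit_slab_def v mem_box)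
    show "\<bar>e \<bullet> v\<bar> \<le> 1" if "e \<in> Basis" for e
      using that b1 by (auto simp: v_def Basis_prod_def inner_not_same_Basis abs_le_iff inner_Basis)
  qed
  from bnd_scale[OF this, of \<i>] have "bnd unit_slab N (1 + 1) (\<lambda>z::'v \<times> ('v \<times> 'v). 1 + \<i> * complex_of_real (z \<bullet> v))"
    by (intro bnd_add bnd_const) simp_all
  from bnd_mult[OF _ C this, of B] B(1)
  have "bnd unit_slab N (2 ^ N * (1 + 1) * C) (\<lambda>z. (1 + \<i> * complex_of_real (z \<bullet> v)) * B z)"
    using bnd_mono[OF B(1), of N C unit_slab] by simp
  from bnd_add[OF this D(2)] have bB': "bnd unit_slab N (2 ^ N * (1 + 1) * C + C) B'" by (simp add: B'_def[abs_def])
  \<comment> \<open>The first summand comes from the product rule with a factor of size 2, the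
    second from the derivative of \<open>B\<close>.\<close>
  have "2 ^ N * (1 + 1) * C + C \<le> 2 ^ (N + 2) * C"
    using C mult_right_mono[of 1 "2 ^ N" C] one_le_power[of "2::real" N] by (simp add: algebra_simps)
  then have 1: "bnd unit_slab N (2 ^ (N + 2) * C) B'" using bnd_mono[OF bB'] by blast
  have 2: "freq_supp R B'" using B(2) sD by (auto simp: freq_supp_def B'_def)
  have 3: "mult_op B (ft H) x = mult_op B' (ft (\<lambda>y. H y / (1 + \<i> * complex_of_real (y \<bullet> b)))) x"
    if H: "integrable lborel H" for H x
  proof -
    define \<tau> where "\<tau> \<zeta> = B (x, \<zeta>) * cis ((x, x) \<bullet> \<zeta>)" for \<zeta>
    define \<tau>' where "\<tau>' \<zeta> = B (x, \<zeta>) * (\<i> * complex_of_real ((x, x) \<bullet> b)) * cis ((x, x) \<bullet> \<zeta>) + D (x, \<zeta>) * cis ((x, x) \<bullet> \<zeta>)" for \<zeta>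
    have cB: "continuous_on UNIV (\<lambda>\<zeta>. B (x, \<zeta>))" "continuous_on UNIV (\<lambda>\<zeta>. D (x, \<zeta>))"
      by (auto intro!: continuous_on_compose2[OF bnd_continuous[OF B(1)]] continuous_on_compose2[OF bnd_continuous[OF D(2)]] continuous_intros)
    have c: "continuous_on UNIV \<tau>" "continuous_on UNIV \<tau>'"
      unfolding \<tau>_def[abs_def] \<tau>'_def[abs_def] by (intro continuous_intros cB)+
    have i: "integrable lborel \<tau>" "integrable lborel \<tau>'"
    proof -
      have z: "B (x, \<zeta>) = 0" "D (x, \<zeta>) = 0" if "\<zeta> \<notin> cbox (- R *\<^sub>R One) (R *\<^sub>R One)" for \<zeta>
        using that B(2) sD unfolding freq_supp_def by blast+
      show "integrable lborel \<tau>"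
        by (rule continuous_cbox_support_integrable[OF c(1), of "- R *\<^sub>R One" "R *\<^sub>R One"]) (simp only: \<tau>_def z(1) mult_zero_left simp_thms)
      show "integrable lborel \<tau>'"
        by (rule continuous_cbox_support_integrable[OF c(2), of "- R *\<^sub>R One" "R *\<^sub>R One"]) (simp only: \<tau>'_def z mult_zero_left add_0 simp_thms)
    qed
    have d: "((\<lambda>t. \<tau> (\<zeta> + t *\<^sub>R b)) has_vector_derivative \<tau>' \<zeta>) (at 0)" for \<zeta>
    proof -
      have "((\<lambda>t. (x, x) \<bullet> (\<zeta> + t *\<^sub>R b)) has_real_derivative (x, x) \<bullet> b) (at 0)"
        by (auto simp: inner_add_right intro!: derivative_eq_intros)
      then have e: "((\<lambda>t. cis ((x, x) \<bullet> (\<zeta> + t *\<^sub>R b))) has_vector_derivative ((x, x) \<bullet> b) *\<^sub>R (\<i> * cis ((x, x) \<bullet> \<zeta>))) (at 0)"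
        using vector_diff_chain_at[of "\<lambda>t. (x, x) \<bullet> (\<zeta> + t *\<^sub>R b)" "(x, x) \<bullet> b" 0 cis "\<i> * cis ((x, x) \<bullet> \<zeta>)"]
          has_vector_derivative_cis[of "(x, x) \<bullet> \<zeta>"]
        by (simp add: o_def has_real_derivative_iff_has_vector_derivative)
      have "((\<lambda>t. B (x, \<zeta> + t *\<^sub>R b)) has_vector_derivative D (x, \<zeta>)) (at 0)"
        using D(1)[of "(x, \<zeta>)"] by simp
      from has_vector_derivative_mult[OF this e] show ?thesis
        unfolding \<tau>_def[abs_def] \<tau>'_def by (simp add: scaleR_conv_of_real algebra_simps)
    qed
    have "mult_op B (ft H) x = (\<integral>\<zeta>. \<tau> \<zeta> * ft H \<zeta> \<partial>lborel)"
      unfolding mult_op_def \<tau>_def by (simp add: mult_ac)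
    also have "\<dots> = (\<integral>\<zeta>. (\<tau> \<zeta> + \<tau>' \<zeta>) * ft (\<lambda>y. H y / (1 + \<i> * complex_of_real (y \<bullet> b))) \<zeta> \<partial>lborel)"
      by (rule ft_by_parts[OF c i d H])
    also have "\<dots> = mult_op B' (ft (\<lambda>y. H y / (1 + \<i> * complex_of_real (y \<bullet> b)))) x"
      unfolding mult_op_def \<tau>_def \<tau>'_def B'_def v by (simp add: algebra_simps)
    finally show ?thesis .
  qed
  show ?thesis by (rule that[OF 1 2 3])
qed

text \<open>Each vector of the list uses up one derivative of \<open>B\<close>. The factor
  \<open>A\<close> depends only on \<open>N\<close> and the list, and \<open>H\<close> is quantified
  after \<open>B'\<close>, so a single new symbol serves all data.\<close>

lemma mult_op_by_parts_list:
  fixes bs :: "('v::euclidean_space \<times> 'v) list"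
  assumes "set bs \<subseteq> Basis"
  shows "\<exists>A\<ge>0. \<forall>B C R. 0 \<le> C \<longrightarrow> bnd unit_slab (N + length bs) C B \<longrightarrow> freq_supp R B \<longrightarrow>
    (\<exists>B'. bnd unit_slab N (A * C) B' \<and> freq_supp R B' \<and>
      (\<forall>H x. integrable lborel H \<longrightarrow>
        mult_op B (ft H) x = mult_op B' (ft (\<lambda>y. H y / (\<Prod>b\<leftarrow>bs. 1 + \<i> * complex_of_real (y \<bullet> b)))) x))"
  using assms
proof (induction bs)
  case Nil
  show ?case by (rule exI[of _ 1]) (auto simp del: bnd.simps)
next
  case (Cons b bs)
  let ?P = "\<lambda>bs A B C R. (\<exists>B'. bnd unit_slab N (A * C) B' \<and> freq_supp R B' \<and>
      (\<forall>H x. integrable lborel H \<longrightarrow>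
        mult_op B (ft H) x = mult_op B' (ft (\<lambda>y. H y / (\<Prod>b\<leftarrow>bs. 1 + \<i> * complex_of_real (y \<bullet> b)))) x))"
  obtain A where A: "A \<ge> 0" "\<And>B C R. 0 \<le> C \<Longrightarrow> bnd unit_slab (N + length bs) C B \<Longrightarrow> freq_supp R B \<Longrightarrow> ?P bs A B C R"
    using Cons by auto
  have "?P (b # bs) (A * 2 ^ (N + length bs + 2)) B C R"
    if hyps: "0 \<le> C" "bnd unit_slab (N + length (b # bs)) C B" "freq_supp R B" for B C R
  proof -
    obtain B1 where B1: "bnd unit_slab (N + length bs) (2 ^ (N + length bs + 2) * C) B1" "freq_supp R B1"
      "\<And>H x. integrable lborel H \<Longrightarrow> mult_op B (ft H) x = mult_op B1 (ft (\<lambda>y. H y / (1 + \<i> * complex_of_real (y \<bullet> b)))) x"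
    proof -
      have "bnd unit_slab (Suc (N + length bs)) C B" "b \<in> Basis"
        using hyps(2) Cons.prems unfolding length_Cons add_Suc_right by auto
      from mult_op_by_parts[OF this(1) hyps(3,1) this(2)] show ?thesis using that by blast
    qed
    have "0 \<le> 2 ^ (N + length bs + 2) * C" using hyps by simp
    from A(2)[OF this B1(1,2)] obtain B2 where B2: "bnd unit_slab N (A * (2 ^ (N + length bs + 2) * C)) B2" "freq_supp R B2"
      "\<And>H x. integrable lborel H \<Longrightarrow> mult_op B1 (ft H) x = mult_op B2 (ft (\<lambda>y. H y / (\<Prod>b\<leftarrow>bs. 1 + \<i> * complex_of_real (y \<bullet> b)))) x"
      by auto
    have "mult_op B (ft H) x = mult_op B2 (ft (\<lambda>y. H y / (\<Prod>b\<leftarrow>b # bs. 1 + \<i> * complex_of_real (y \<bullet> b)))) x"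
      if "integrable lborel H" for H x
      using B1(3)[OF that] B2(3)[OF integrable_div_one_plus_i[OF that]] by simp
    then show ?thesis using B2 by (intro exI[of _ B2]) (auto simp: mult.assoc)
  qed
  then show ?case using A(1) by (intro exI[of _ "A * 2 ^ (N + length bs + 2)"]) (auto simp del: bnd.simps)
qed

text \<open>The square of this function is the weight \<open>W\<close> produced by two integrations by parts in each variable;
  its modulus is \<open>\<Prod>\<^sub>i (1 + y\<^sub>i\<^sup>2)\<close>.\<close>

definition weight_root :: "'v::euclidean_space \<Rightarrow> complex" where
  "weight_root y = (\<Prod>b\<in>Basis. (1 + \<i> * complex_of_real (y \<bullet> b)))"

text \<open>The product of two transforms is one transform on the product space, which brings it
  within reach of the linear integration by parts.\<close>

lemma ft_tensor:
  fixes f g :: "'v::euclidean_space \<Rightarrow> complex"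
  assumes f: "integrable lborel f" and g: "integrable lborel g"
  shows "ft (\<lambda>(y, z). f y * g z) \<zeta> = ft f (fst \<zeta>) * ft g (snd \<zeta>)"
proof -
  have fg: "integrable lborel (\<lambda>y. f y * cis (- (y \<bullet> fst \<zeta>)))" "integrable lborel (\<lambda>y. g y * cis (- (y \<bullet> snd \<zeta>)))"
    by (intro integrable_mult_unimodular f g; auto)+
  have "ft (\<lambda>(y, z). f y * g z) \<zeta> = (\<integral>(y, z). (f y * cis (- (y \<bullet> fst \<zeta>))) * (g z * cis (- (z \<bullet> snd \<zeta>))) \<partial>(lborel \<Otimes>\<^sub>M lborel))"
    unfolding ft_def lborel_prod
  proof (intro Bochner_Integration.integral_cong refl, clarify)
    fix y z :: 'v
    have "cis (- ((y, z) \<bullet> \<zeta>)) = cis (- (y \<bullet> fst \<zeta>)) * cis (- (z \<bullet> snd \<zeta>))"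
      by (simp add: cis_mult inner_prod_def)
    then show "f y * g z * cis (- ((y, z) \<bullet> \<zeta>)) = f y * cis (- (y \<bullet> fst \<zeta>)) * (g z * cis (- (z \<bullet> snd \<zeta>)))"
      by simp
  qed
  also have "\<dots> = ft f (fst \<zeta>) * ft g (snd \<zeta>)"
    unfolding ft_def using lborel_pair.integral_fst'[OF integrable_product[OF fg]] by simp
  finally show ?thesis .
qed

lemma mult_op_weight:
  shows "\<exists>A\<ge>0. \<forall>(B::'v::euclidean_space \<times> ('v \<times> 'v) \<Rightarrow> complex) C R. 0 \<le> C \<longrightarrow> bnd unit_slab (N + 4 * DIM('v)) C B \<longrightarrow> freq_supp R B \<longrightarrow>
    (\<exists>B'. bnd unit_slab N (A * C) B' \<and> freq_supp R B' \<and>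
      (\<forall>f g x. integrable lborel f \<longrightarrow> integrable lborel g \<longrightarrow>
        mult_op B (\<lambda>\<zeta>. ft f (fst \<zeta>) * ft g (snd \<zeta>)) x =
        mult_op B' (\<lambda>\<zeta>. ft (\<lambda>y. f y / (weight_root y)\<^sup>2) (fst \<zeta>) * ft (\<lambda>y. g y / (weight_root y)\<^sup>2) (snd \<zeta>)) x))"
proof -
  obtain bl :: "'v list" where bl: "set bl = Basis" "distinct bl" using finite_distinct_list[OF finite_Basis] by blast
  \<comment> \<open>Every basis vector of both frequency blocks occurs twice. A single occurrence
    would give a factor of modulus \<open>sqrt (1 + y\<^sub>i\<^sup>2)\<close>, whose reciprocal is
    not integrable; its square has an integrable reciprocal.\<close>
  define bs :: "('v \<times> 'v) list" where "bs = map (\<lambda>b. (b, 0)) (bl @ bl) @ map (\<lambda>b. (0, b)) (bl @ bl)"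
  have bs: "set bs \<subseteq> Basis" using bl by (auto simp: bs_def Basis_prod_def)
  have lbl: "length bl = DIM('v)" using distinct_card[OF bl(2)] bl(1) by simp
  have len: "length bs = 4 * DIM('v)" by (simp add: bs_def lbl)
  have wr: "(\<Prod>b\<leftarrow>bl. 1 + \<i> * complex_of_real (y \<bullet> b)) = weight_root y" for y
    unfolding weight_root_def using prod.distinct_set_conv_list[OF bl(2)] bl(1) by metis
  have W: "(\<Prod>b\<leftarrow>bs. 1 + \<i> * complex_of_real ((y, z) \<bullet> b)) = (weight_root y)\<^sup>2 * (weight_root z)\<^sup>2" for y z
    by (simp add: bs_def o_def inner_prod_def wr power2_eq_square)
  have wge: "1 \<le> norm (weight_root y)" for y :: 'v
    unfolding weight_root_def prod_norm[symmetric] by (intro prod_ge_1 norm_one_plus_i)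
  have iw: "integrable lborel (\<lambda>y. f y / (weight_root y)\<^sup>2)" if "integrable lborel f" for f :: "'v \<Rightarrow> complex"
  proof (rule Bochner_Integration.integrable_bound[OF that])
    note [measurable] = integrable_lborelD[OF that]
    show "(\<lambda>y. f y / (weight_root y)\<^sup>2) \<in> borel_measurable lborel" unfolding weight_root_def by measurable
    have "1 \<le> (norm (weight_root y))\<^sup>2" for y :: 'v using wge by (rule one_le_power)
    then show "AE y in lborel. norm (f y / (weight_root y)\<^sup>2) \<le> norm (f y)"
      by (auto simp: norm_divide norm_power divide_le_eq mult_le_cancel_left1 intro!: AE_I2)
  qed
  obtain A where A: "A \<ge> 0" "\<And>B C R. 0 \<le> C \<Longrightarrow> bnd unit_slab (N + length bs) C B \<Longrightarrow> freq_supp R B \<Longrightarrow>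
    (\<exists>B'. bnd unit_slab N (A * C) B' \<and> freq_supp R B' \<and>
      (\<forall>H x. integrable lborel H \<longrightarrow>
        mult_op B (ft H) x = mult_op B' (ft (\<lambda>y. H y / (\<Prod>b\<leftarrow>bs. 1 + \<i> * complex_of_real (y \<bullet> b)))) x))"
    using mult_op_by_parts_list[OF bs, of N] by blast
  show ?thesis
  proof (intro exI[of _ A] conjI A(1) allI impI)
    fix B :: "'v \<times> ('v \<times> 'v) \<Rightarrow> complex" and C R
    assume "0 \<le> C" "bnd unit_slab (N + 4 * DIM('v)) C B" "freq_supp R B"
    then obtain B' where B': "bnd unit_slab N (A * C) B'" "freq_supp R B'"
      "\<And>H x. integrable lborel H \<Longrightarrow>
        mult_op B (ft H) x = mult_op B' (ft (\<lambda>y. H y / (\<Prod>b\<leftarrow>bs. 1 + \<i> * complex_of_real (y \<bullet> b)))) x"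
      using A(2)[unfolded len] by blast
    have "mult_op B (\<lambda>\<zeta>. ft f (fst \<zeta>) * ft g (snd \<zeta>)) x =
        mult_op B' (\<lambda>\<zeta>. ft (\<lambda>y. f y / (weight_root y)\<^sup>2) (fst \<zeta>) * ft (\<lambda>y. g y / (weight_root y)\<^sup>2) (snd \<zeta>)) x"
      if f: "integrable lborel f" and g: "integrable lborel g" for f g x
    proof -
      let ?H = "\<lambda>(y, z). f y * g z"
      have "integrable lborel ?H" using integrable_product[OF f g] by (simp add: lborel_prod)
      moreover have "mult_op B (ft ?H) x = mult_op B (\<lambda>\<zeta>. ft f (fst \<zeta>) * ft g (snd \<zeta>)) x"
        unfolding ft_tensor[OF f g, abs_def] ..
      moreover have "(\<lambda>y. ?H y / (\<Prod>b\<leftarrow>bs. 1 + \<i> * complex_of_real (y \<bullet> b))) =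
          (\<lambda>(y, z). f y / (weight_root y)\<^sup>2 * (g z / (weight_root z)\<^sup>2))"
        by (auto simp: fun_eq_iff W)
      ultimately show ?thesis
        using B'(3)[of ?H x] ft_tensor[OF iw[OF f] iw[OF g], abs_def] by simp
    qed
    then show "\<exists>B'. bnd unit_slab N (A * C) B' \<and> freq_supp R B' \<and>
      (\<forall>f g x. integrable lborel f \<longrightarrow> integrable lborel g \<longrightarrow>
        mult_op B (\<lambda>\<zeta>. ft f (fst \<zeta>) * ft g (snd \<zeta>)) x =
        mult_op B' (\<lambda>\<zeta>. ft (\<lambda>y. f y / (weight_root y)\<^sup>2) (fst \<zeta>) * ft (\<lambda>y. g y / (weight_root y)\<^sup>2) (snd \<zeta>)) x)"
      using B' by blast
  qed
qed

section \<open>Local estimates on the unit cube\<close>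

definition cube :: "real \<Rightarrow> 'v::euclidean_space set" where
  "cube R = cbox (- R *\<^sub>R One) (R *\<^sub>R One)"

lemma mem_cube: "x \<in> cube R \<longleftrightarrow> (\<forall>b\<in>Basis. \<bar>x \<bullet> b\<bar> \<le> R)"
  by (auto simp: cube_def mem_box abs_le_iff)

lemma cube_prod: "\<zeta> \<in> cube R \<longleftrightarrow> fst \<zeta> \<in> cube R \<and> snd \<zeta> \<in> cube R"
  by (cases \<zeta>) (auto simp: mem_cube Basis_prod_def ball_Un inner_prod_def)

lemma cube_borel [measurable]: "cube R \<in> sets borel"
  by (simp add: cube_def)

lemma emeasure_cube:
  assumes "0 \<le> R"
  shows "emeasure lborel (cube R :: 'v::euclidean_space set) = ennreal ((2 * R) ^ DIM('v))"
  using assms unfolding cube_def by (subst emeasure_lborel_cbox) (auto simp: algebra_simps)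

lemma integrable_indicator_cube: "integrable lborel (indicator (cube R :: 'v::euclidean_space set) :: 'v \<Rightarrow> complex)"
proof -
  have "integrable lborel (\<lambda>x::'v. indicator (cube R) x *\<^sub>R (1 :: complex))"
    unfolding cube_def by (rule borel_integrable_compact) auto
  moreover have "(\<lambda>x::'v. indicator (cube R) x *\<^sub>R (1 :: complex)) = indicator (cube R)"
    by (auto split: split_indicator)
  ultimately show ?thesis by simp
qed

lemma freq_supp_cube: "freq_supp R B \<longleftrightarrow> (\<forall>x \<zeta>. \<zeta> \<notin> cube R \<longrightarrow> B (x, \<zeta>) = 0)"
  by (simp add: freq_supp_def cube_def)

section \<open>Bilinear multipliers independent of \<open>x\<close>\<close>

lemma nn_integral_set_CS:
  fixes f :: "'a \<Rightarrow> ennreal"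
  assumes [measurable]: "f \<in> borel_measurable M" "A \<in> sets M"
  shows "(\<integral>\<^sup>+x. indicator A x * f x \<partial>M)\<^sup>2 \<le> emeasure M A * (\<integral>\<^sup>+x. indicator A x * (f x)\<^sup>2 \<partial>M)"
proof -
  have "(\<integral>\<^sup>+x. indicator A x * f x \<partial>M) = (\<integral>\<^sup>+x. indicator A x * (indicator A x * f x) \<partial>M)"
    by (intro nn_integral_cong) (auto split: split_indicator)
  also have "\<dots>\<^sup>2 \<le> (\<integral>\<^sup>+x. (indicator A x)\<^sup>2 \<partial>M) * (\<integral>\<^sup>+x. (indicator A x * f x)\<^sup>2 \<partial>M)"
    by (rule Cauchy_Schwarz_nn_integral) auto
  also have "(\<integral>\<^sup>+x. (indicator A x)\<^sup>2 \<partial>M) = emeasure M A"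
  proof -
    have "(\<lambda>x. (indicator A x)\<^sup>2 :: ennreal) = indicator A" by (auto split: split_indicator)
    then show ?thesis by simp
  qed
  also have "(\<integral>\<^sup>+x. (indicator A x * f x)\<^sup>2 \<partial>M) = (\<integral>\<^sup>+x. indicator A x * (f x)\<^sup>2 \<partial>M)"
    by (intro nn_integral_cong) (auto split: split_indicator)
  finally show ?thesis .
qed

text \<open>The square of the L2 norm over the frequency cube. The local estimates see the two data
  only through this quantity.\<close>

definition energy :: "real \<Rightarrow> ('v::euclidean_space \<Rightarrow> complex) \<Rightarrow> ennreal" where
  "energy R \<phi> = (\<integral>\<^sup>+\<xi>. indicator (cube R) \<xi> * ennreal ((norm (\<phi> \<xi>))\<^sup>2) \<partial>lborel)"

text \<open>The bound \<open>M\<close> gives absolute convergence for Fubini's theorem; the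
  resulting estimates are expressed through \<open>energy\<close> and do not contain it.\<close>

locale freq_pair =
  fixes R :: real and \<phi> \<gamma> :: "'v::euclidean_space \<Rightarrow> complex" and M :: real
  assumes R: "0 \<le> R"
    and meas [measurable]: "\<phi> \<in> borel_measurable borel" "\<gamma> \<in> borel_measurable borel"
    and bdd: "\<And>\<xi>. norm (\<phi> \<xi>) \<le> M" "\<And>\<xi>. norm (\<gamma> \<xi>) \<le> M"
begin

lemma M_nonneg: "0 \<le> M" using bdd(1)[of 0] norm_ge_zero order_trans by blast

definition \<Phi> :: "'v \<times> 'v \<Rightarrow> complex" where "\<Phi> \<zeta> = \<phi> (fst \<zeta>) * \<gamma> (snd \<zeta>)"

lemma \<Phi>_measurable [measurable]: "\<Phi> \<in> borel_measurable borel"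
proof -
  have "(\<lambda>\<zeta>. \<phi> (fst \<zeta>) * \<gamma> (snd \<zeta>)) \<in> borel_measurable (borel \<Otimes>\<^sub>M borel)" by measurable
  then show ?thesis by (simp add: \<Phi>_def[abs_def] borel_prod)
qed

lemma \<Phi>_bound: "norm (\<Phi> \<zeta>) \<le> M\<^sup>2"
  using bdd M_nonneg by (auto simp: \<Phi>_def norm_mult power2_eq_square intro!: mult_mono)

context
  fixes \<sigma> :: "'v \<times> 'v \<Rightarrow> complex" and C :: real
  assumes \<sigma>_meas [measurable]: "\<sigma> \<in> borel_measurable borel"
    and \<sigma>_bound: "\<And>\<zeta>. norm (\<sigma> \<zeta>) \<le> C" and \<sigma>_supp: "\<And>\<zeta>. \<zeta> \<notin> cube R \<Longrightarrow> \<sigma> \<zeta> = 0"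
begin

lemma C_nonneg: "0 \<le> C" using \<sigma>_bound[of 0] norm_ge_zero order_trans by blast

lemma integrable_\<sigma>\<Phi>: "integrable lborel (\<lambda>\<zeta>. \<sigma> \<zeta> * \<Phi> \<zeta>)"
proof (rule Bochner_Integration.integrable_bound)
  show "integrable lborel (\<lambda>\<zeta>::'v \<times> 'v. indicator (cube R) \<zeta> * complex_of_real (C * M\<^sup>2))"
    by (intro integrable_mult_left integrable_indicator_cube)
  have "norm (\<sigma> \<zeta> * \<Phi> \<zeta>) \<le> norm (indicator (cube R) \<zeta> * complex_of_real (C * M\<^sup>2))" for \<zeta>
    using \<sigma>_bound[of \<zeta>] \<Phi>_bound[of \<zeta>] \<sigma>_supp[of \<zeta>] C_nonneg
    by (auto simp: norm_mult norm_power split: split_indicator intro!: mult_mono)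
  then show "AE \<zeta> in lborel. norm (\<sigma> \<zeta> * \<Phi> \<zeta>) \<le> norm (indicator (cube R) \<zeta> * complex_of_real (C * M\<^sup>2))" by simp
qed measurable

text \<open>Absolute values inside the integral separate the variables, and the Cauchy-Schwarz
  inequality in \<open>\<xi>\<close> and in \<open>\<eta>\<close> each costs the volume of a cube of
  side \<open>2 * R\<close>.\<close>

lemma frozen_sup: "ennreal ((norm (\<integral>\<zeta>. \<sigma> \<zeta> * \<Phi> \<zeta> * cis ((x, x) \<bullet> \<zeta>) \<partial>lborel))\<^sup>2) \<le>
   ennreal (C\<^sup>2 * ((2 * R) ^ DIM('v))\<^sup>2) * (energy R \<phi> * energy R \<gamma>)"
proof -
  let ?f = "\<lambda>\<xi>. indicator (cube R) \<xi> * ennreal (norm (\<phi> \<xi>))" and ?g = "\<lambda>\<xi>. indicator (cube R) \<xi> * ennreal (norm (\<gamma> \<xi>))"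
  have "ennreal (norm (\<integral>\<zeta>. \<sigma> \<zeta> * \<Phi> \<zeta> * cis ((x, x) \<bullet> \<zeta>) \<partial>lborel)) \<le> (\<integral>\<^sup>+\<zeta>. norm (\<sigma> \<zeta> * \<Phi> \<zeta> * cis ((x, x) \<bullet> \<zeta>)) \<partial>lborel)"
    by (rule norm_integral_le_nn_integral)
  also have "\<dots> \<le> (\<integral>\<^sup>+\<zeta>. ennreal C * (?f (fst \<zeta>) * ?g (snd \<zeta>)) \<partial>lborel)"
  proof (intro nn_integral_mono)
    fix \<zeta>
    have "norm (\<sigma> \<zeta> * \<Phi> \<zeta>) \<le> C * (norm (\<phi> (fst \<zeta>)) * norm (\<gamma> (snd \<zeta>)))"
      using \<sigma>_bound[of \<zeta>] by (auto simp: \<Phi>_def norm_mult intro!: mult_right_mono)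
    then show "ennreal (norm (\<sigma> \<zeta> * \<Phi> \<zeta> * cis ((x, x) \<bullet> \<zeta>))) \<le> ennreal C * (?f (fst \<zeta>) * ?g (snd \<zeta>))"
      using \<sigma>_supp[of \<zeta>] C_nonneg
      by (cases "\<zeta> \<in> cube R") (auto simp: cube_prod norm_mult ennreal_mult[symmetric] intro!: ennreal_leI)
  qed
  also have "\<dots> = (\<integral>\<^sup>+(\<xi>, \<eta>). ennreal C * (?f \<xi> * ?g \<eta>) \<partial>(lborel \<Otimes>\<^sub>M lborel))"
    by (simp add: lborel_prod case_prod_unfold)
  also have "\<dots> = (\<integral>\<^sup>+\<xi>. \<integral>\<^sup>+\<eta>. ennreal C * (?f \<xi> * ?g \<eta>) \<partial>lborel \<partial>lborel)"
    by (subst lborel.nn_integral_fst[symmetric]) auto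
  also have "\<dots> = ennreal C * ((\<integral>\<^sup>+\<xi>. ?f \<xi> \<partial>lborel) * (\<integral>\<^sup>+\<xi>. ?g \<xi> \<partial>lborel))"
    by (simp add: nn_integral_cmult nn_integral_multc)
  finally have "(ennreal (norm (\<integral>\<zeta>. \<sigma> \<zeta> * \<Phi> \<zeta> * cis ((x, x) \<bullet> \<zeta>) \<partial>lborel)))\<^sup>2 \<le>
     (ennreal C * ((\<integral>\<^sup>+\<xi>. ?f \<xi> \<partial>lborel) * (\<integral>\<^sup>+\<xi>. ?g \<xi> \<partial>lborel)))\<^sup>2"
    by (intro power_mono) auto
  also have "\<dots> = (ennreal C)\<^sup>2 * ((\<integral>\<^sup>+\<xi>. ?f \<xi> \<partial>lborel)\<^sup>2 * (\<integral>\<^sup>+\<xi>. ?g \<xi> \<partial>lborel)\<^sup>2)"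
    by (simp add: power_mult_distrib)
  also have "\<dots> \<le> (ennreal C)\<^sup>2 * ((emeasure lborel (cube R :: 'v set) * (\<integral>\<^sup>+\<xi>. indicator (cube R) \<xi> * (ennreal (norm (\<phi> \<xi>)))\<^sup>2 \<partial>lborel)) *
      (emeasure lborel (cube R :: 'v set) * (\<integral>\<^sup>+\<xi>. indicator (cube R) \<xi> * (ennreal (norm (\<gamma> \<xi>)))\<^sup>2 \<partial>lborel)))"
    by (intro mult_mono nn_integral_set_CS) auto
  also have "\<dots> = ennreal (C\<^sup>2 * ((2 * R) ^ DIM('v))\<^sup>2) * (energy R \<phi> * energy R \<gamma>)"
    using R C_nonneg by (simp add: emeasure_cube energy_def ennreal_power ennreal_mult power2_eq_square mult_ac)
  finally show ?thesis by (simp add: ennreal_power)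
qed

text \<open>Orthogonality of the output frequencies: for fixed \<open>\<theta> = \<xi> + \<eta>\<close> the Cauchy-Schwarz inequality costs
  only one cube volume, not two.\<close>

lemma frozen_L2: "(\<integral>\<^sup>+x. ennreal ((norm (\<integral>\<zeta>. \<sigma> \<zeta> * \<Phi> \<zeta> * cis ((x, x) \<bullet> \<zeta>) \<partial>lborel))\<^sup>2) \<partial>lborel) \<le>
   ennreal ((2 * pi) ^ DIM('v) * C\<^sup>2 * (2 * R) ^ DIM('v)) * (energy R \<phi> * energy R \<gamma>)"
proof -
  define \<psi> where "\<psi> \<xi> \<eta> = \<sigma> (\<xi>, \<eta>) * \<Phi> (\<xi>, \<eta>)" for \<xi> \<eta>
  have \<psi>i: "integrable (lborel \<Otimes>\<^sub>M lborel) (\<lambda>(\<xi>, \<eta>). \<psi> \<xi> \<eta>)"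
    using integrable_\<sigma>\<Phi> by (simp add: \<psi>_def lborel_prod case_prod_unfold)
  have \<psi>m[measurable]: "(\<lambda>(\<xi>, \<eta>). \<psi> \<xi> \<eta>) \<in> borel_measurable (borel \<Otimes>\<^sub>M borel)"
    unfolding \<psi>_def by measurable
  have \<psi>m1[measurable]: "\<psi> \<xi> \<in> borel_measurable borel" for \<xi> unfolding \<psi>_def[abs_def] by measurable
  \<comment> \<open>\<open>h \<theta>\<close> gathers all contributions with output frequency
    \<open>\<xi> + \<eta> = \<theta>\<close>, so that the operator is the Fourier transform of
    \<open>h\<close> at \<open>- x\<close>.\<close>
  define h where "h \<theta> = (\<integral>\<xi>. \<psi> \<xi> (\<theta> - \<xi>) \<partial>lborel)" for \<theta>
  have F: "integrable (lborel \<Otimes>\<^sub>M lborel) (\<lambda>(\<xi>, \<theta>). \<psi> \<xi> (\<theta> - \<xi>) * cis (x \<bullet> \<theta>))" for x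
  proof (rule lborel_pair.Fubini_integrable)
    let ?F = "\<lambda>(\<xi>, \<theta>). \<psi> \<xi> (\<theta> - \<xi>) * cis (x \<bullet> \<theta>)"
    show "(\<lambda>(\<xi>, \<theta>). \<psi> \<xi> (\<theta> - \<xi>) * cis (x \<bullet> \<theta>)) \<in> borel_measurable (lborel \<Otimes>\<^sub>M lborel)"
      unfolding \<psi>_def by measurable
    have "(\<integral>\<theta>. norm (\<psi> \<xi> (\<theta> - \<xi>) * cis (x \<bullet> \<theta>)) \<partial>lborel) = (\<integral>\<eta>. norm (\<psi> \<xi> \<eta>) \<partial>lborel)" for \<xi>
      using integral_translate(1)[of "\<lambda>\<eta>. norm (\<psi> \<xi> \<eta>)" "-\<xi>"] by (simp add: norm_mult)
    moreover have "integrable lborel (\<lambda>\<xi>. \<integral>\<eta>. norm (\<psi> \<xi> \<eta>) \<partial>lborel)"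
      using lborel_pair.integrable_fst'[OF integrable_norm[OF \<psi>i]] by simp
    ultimately show "integrable lborel (\<lambda>\<xi>. \<integral>\<theta>. norm (?F (\<xi>, \<theta>)) \<partial>lborel)"
      by simp
    have "integrable lborel (\<lambda>\<theta>. \<psi> \<xi> (\<theta> - \<xi>) * cis (x \<bullet> \<theta>))" if "integrable lborel (\<psi> \<xi>)" for \<xi>
      using that integral_translate(2)[of "\<psi> \<xi>" "-\<xi>"] by (intro integrable_mult_unimodular) auto
    then show "AE \<xi> in lborel. integrable lborel (\<lambda>\<theta>. ?F (\<xi>, \<theta>))"
      using lborel_pair.AE_integrable_fst'[OF \<psi>i] by auto
  qed
  have hi: "integrable lborel h"
    using lborel_pair.integrable_snd[OF F[of 0]] by (simp add: h_def[abs_def])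
  have eq: "(\<integral>\<zeta>. \<sigma> \<zeta> * \<Phi> \<zeta> * cis ((x, x) \<bullet> \<zeta>) \<partial>lborel) = ft h (- x)" for x
  proof -
    have "integrable lborel (\<lambda>\<zeta>. \<sigma> \<zeta> * \<Phi> \<zeta> * cis ((x, x) \<bullet> \<zeta>))"
      by (intro integrable_mult_unimodular integrable_\<sigma>\<Phi>) auto
    then have "integrable (lborel \<Otimes>\<^sub>M lborel) (\<lambda>(\<xi>, \<eta>). \<psi> \<xi> \<eta> * cis (x \<bullet> (\<xi> + \<eta>)))"
      by (simp add: \<psi>_def lborel_prod case_prod_unfold inner_add_right inner_prod_def)
    from lborel_pair.integral_fst'[OF this]
    have "(\<integral>\<zeta>. \<sigma> \<zeta> * \<Phi> \<zeta> * cis ((x, x) \<bullet> \<zeta>) \<partial>lborel) = (\<integral>\<xi>. \<integral>\<eta>. \<psi> \<xi> \<eta> * cis (x \<bullet> (\<xi> + \<eta>)) \<partial>lborel \<partial>lborel)"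
      by (simp add: \<psi>_def lborel_prod case_prod_unfold inner_add_right inner_prod_def)
    also have "\<dots> = (\<integral>\<xi>. \<integral>\<theta>. \<psi> \<xi> (\<theta> - \<xi>) * cis (x \<bullet> \<theta>) \<partial>lborel \<partial>lborel)"
    proof (rule Bochner_Integration.integral_cong[OF refl])
      fix \<xi>
      show "(\<integral>\<eta>. \<psi> \<xi> \<eta> * cis (x \<bullet> (\<xi> + \<eta>)) \<partial>lborel) = (\<integral>\<theta>. \<psi> \<xi> (\<theta> - \<xi>) * cis (x \<bullet> \<theta>) \<partial>lborel)"
        using integral_translate(1)[of "\<lambda>\<eta>. \<psi> \<xi> \<eta> * cis (x \<bullet> (\<xi> + \<eta>))" "- \<xi>"] by simp
    qed
    also have "\<dots> = (\<integral>\<theta>. \<integral>\<xi>. \<psi> \<xi> (\<theta> - \<xi>) * cis (x \<bullet> \<theta>) \<partial>lborel \<partial>lborel)"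
      using lborel_pair.Fubini_integral[OF F[of x]] by simp
    also have "\<dots> = ft h (- x)"
      unfolding ft_def h_def by (simp add: inner_commute)
    finally show ?thesis .
  qed
  have [measurable]: "ft h \<in> borel_measurable borel" using integrable_lborelD[OF hi] by measurable
  have "(\<integral>\<^sup>+x. ennreal ((norm (\<integral>\<zeta>. \<sigma> \<zeta> * \<Phi> \<zeta> * cis ((x, x) \<bullet> \<zeta>) \<partial>lborel))\<^sup>2) \<partial>lborel) = (\<integral>\<^sup>+x. ennreal ((norm (ft h x))\<^sup>2) \<partial>lborel)"
    unfolding eq using nn_integral_lborel_affine[of "\<lambda>x. ennreal ((norm (ft h x))\<^sup>2)" "-1" 0] by simp
  also have "\<dots> \<le> ennreal ((2 * pi) ^ DIM('v)) * (\<integral>\<^sup>+y. ennreal ((norm (h y))\<^sup>2) \<partial>lborel)"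
    by (rule plancherel_le[OF hi])
  also have "(\<integral>\<^sup>+\<theta>. ennreal ((norm (h \<theta>))\<^sup>2) \<partial>lborel) \<le>
     (\<integral>\<^sup>+\<theta>. ennreal ((2 * R) ^ DIM('v)) * (\<integral>\<^sup>+\<xi>. ennreal ((norm (\<psi> \<xi> (\<theta> - \<xi>)))\<^sup>2) \<partial>lborel) \<partial>lborel)"
  proof (intro nn_integral_mono)
    fix \<theta>
    have [measurable]: "(\<lambda>\<xi>. \<psi> \<xi> (\<theta> - \<xi>)) \<in> borel_measurable borel" unfolding \<psi>_def by measurable
    have "ennreal (norm (h \<theta>)) \<le> (\<integral>\<^sup>+\<xi>. norm (\<psi> \<xi> (\<theta> - \<xi>)) \<partial>lborel)"
      unfolding h_def by (rule norm_integral_le_nn_integral)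
    also have "\<dots> = (\<integral>\<^sup>+\<xi>. indicator (cube R) \<xi> * ennreal (norm (\<psi> \<xi> (\<theta> - \<xi>))) \<partial>lborel)"
      using \<sigma>_supp by (intro nn_integral_cong) (auto simp: \<psi>_def cube_prod split: split_indicator)
    finally have "(ennreal (norm (h \<theta>)))\<^sup>2 \<le> (\<integral>\<^sup>+\<xi>. indicator (cube R) \<xi> * ennreal (norm (\<psi> \<xi> (\<theta> - \<xi>))) \<partial>lborel)\<^sup>2"
      by (intro power_mono) auto
    also have "\<dots> \<le> emeasure lborel (cube R :: 'v set) * (\<integral>\<^sup>+\<xi>. indicator (cube R) \<xi> * (ennreal (norm (\<psi> \<xi> (\<theta> - \<xi>))))\<^sup>2 \<partial>lborel)"
      by (rule nn_integral_set_CS) auto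
    also have "\<dots> \<le> ennreal ((2 * R) ^ DIM('v)) * (\<integral>\<^sup>+\<xi>. ennreal ((norm (\<psi> \<xi> (\<theta> - \<xi>)))\<^sup>2) \<partial>lborel)"
      unfolding emeasure_cube[OF R]
      by (intro mult_left_mono nn_integral_mono) (auto simp: ennreal_power split: split_indicator)
    finally show "ennreal ((norm (h \<theta>))\<^sup>2) \<le> ennreal ((2 * R) ^ DIM('v)) * (\<integral>\<^sup>+\<xi>. ennreal ((norm (\<psi> \<xi> (\<theta> - \<xi>)))\<^sup>2) \<partial>lborel)"
      by (simp add: ennreal_power)
  qed
  also have "\<dots> = ennreal ((2 * R) ^ DIM('v)) * (\<integral>\<^sup>+\<theta>. \<integral>\<^sup>+\<xi>. ennreal ((norm (\<psi> \<xi> (\<theta> - \<xi>)))\<^sup>2) \<partial>lborel \<partial>lborel)"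
    unfolding \<psi>_def by (rule nn_integral_cmult) measurable
  also have "(\<integral>\<^sup>+\<theta>. \<integral>\<^sup>+\<xi>. ennreal ((norm (\<psi> \<xi> (\<theta> - \<xi>)))\<^sup>2) \<partial>lborel \<partial>lborel) =
      (\<integral>\<^sup>+\<xi>. \<integral>\<^sup>+\<theta>. ennreal ((norm (\<psi> \<xi> (\<theta> - \<xi>)))\<^sup>2) \<partial>lborel \<partial>lborel)"
    unfolding \<psi>_def by (rule lborel_pair.Fubini') measurable
  also have "\<dots> = (\<integral>\<^sup>+\<xi>. \<integral>\<^sup>+\<eta>. ennreal ((norm (\<psi> \<xi> \<eta>))\<^sup>2) \<partial>lborel \<partial>lborel)"
  proof (rule nn_integral_cong)
    fix \<xi>
    show "(\<integral>\<^sup>+\<theta>. ennreal ((norm (\<psi> \<xi> (\<theta> - \<xi>)))\<^sup>2) \<partial>lborel) = (\<integral>\<^sup>+\<eta>. ennreal ((norm (\<psi> \<xi> \<eta>))\<^sup>2) \<partial>lborel)"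
      using nn_integral_lborel_affine[of "\<lambda>\<eta>. ennreal ((norm (\<psi> \<xi> \<eta>))\<^sup>2)" 1 "-\<xi>"] by simp
  qed
  also have "\<dots> \<le> (\<integral>\<^sup>+\<xi>. \<integral>\<^sup>+\<eta>. ennreal (C\<^sup>2) * ((indicator (cube R) \<xi> * ennreal ((norm (\<phi> \<xi>))\<^sup>2)) *
      (indicator (cube R) \<eta> * ennreal ((norm (\<gamma> \<eta>))\<^sup>2))) \<partial>lborel \<partial>lborel)"
  proof (intro nn_integral_mono)
    fix \<xi> \<eta>
    have "(norm (\<psi> \<xi> \<eta>))\<^sup>2 \<le> (C * (norm (\<phi> \<xi>) * norm (\<gamma> \<eta>)))\<^sup>2"
      using \<sigma>_bound[of "(\<xi>, \<eta>)"] by (auto simp: \<psi>_def \<Phi>_def norm_mult intro!: power_mono mult_right_mono)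
    then show "ennreal ((norm (\<psi> \<xi> \<eta>))\<^sup>2) \<le> ennreal (C\<^sup>2) * ((indicator (cube R) \<xi> * ennreal ((norm (\<phi> \<xi>))\<^sup>2)) *
      (indicator (cube R) \<eta> * ennreal ((norm (\<gamma> \<eta>))\<^sup>2)))"
      using \<sigma>_supp[of "(\<xi>, \<eta>)"]
      by (cases "(\<xi>, \<eta>) \<in> cube R") (auto simp: \<psi>_def cube_prod power_mult_distrib ennreal_mult[symmetric] intro!: ennreal_leI)
  qed
  also have "\<dots> = ennreal (C\<^sup>2) * (energy R \<phi> * energy R \<gamma>)"
    unfolding energy_def by (simp add: nn_integral_cmult nn_integral_multc)
  finally have "(\<integral>\<^sup>+x. ennreal ((norm (\<integral>\<zeta>. \<sigma> \<zeta> * \<Phi> \<zeta> * cis ((x, x) \<bullet> \<zeta>) \<partial>lborel))\<^sup>2) \<partial>lborel) \<le>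
    ennreal ((2 * pi) ^ DIM('v)) * (ennreal ((2 * R) ^ DIM('v)) * (ennreal (C\<^sup>2) * (energy R \<phi> * energy R \<gamma>)))"
    by (simp add: mult_left_mono)
  then show ?thesis using R by (simp add: ennreal_mult mult_ac)
qed

end
end

text \<open>Integration by parts on \<open>[0, x]\<close> and \<open>[x, 1]\<close> against the kernel \<open>t\<close>, respectively \<open>t - 1\<close>.\<close>

lemma unit_interval_average:
  fixes \<phi> :: "real \<Rightarrow> complex"
  assumes d: "\<And>t. (\<phi> has_vector_derivative \<phi>' t) (at t)" and c: "continuous_on UNIV \<phi>'" and x: "0 \<le> x" "x \<le> 1"
  shows "(\<integral>t. indicator {0..1} t *\<^sub>R (\<phi> t + (if t \<le> x then t else t - 1) *\<^sub>R \<phi>' t) \<partial>lborel) = \<phi> x"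
proof -
  have c\<phi>: "continuous_on UNIV \<phi>"
    using d by (intro continuous_at_imp_continuous_on ballI has_vector_derivative_continuous)
  note cs = continuous_on_subset[OF c\<phi> subset_UNIV] continuous_on_subset[OF c subset_UNIV]
  have 1: "(\<integral>t. indicator {0..x} t *\<^sub>R (\<phi> t + t *\<^sub>R \<phi>' t) \<partial>lborel) = x *\<^sub>R \<phi> x - 0 *\<^sub>R \<phi> 0"
  proof (rule integral_FTC_atLeastAtMost[OF x(1)])
    show "((\<lambda>t. t *\<^sub>R \<phi> t) has_vector_derivative \<phi> t + t *\<^sub>R \<phi>' t) (at t within {0..x})" for t
      using has_vector_derivative_scaleR[OF DERIV_ident d] by (auto intro: has_vector_derivative_at_within simp: add.commute)
    show "continuous_on {0..x} (\<lambda>t. \<phi> t + t *\<^sub>R \<phi>' t)" by (intro continuous_intros cs)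
  qed
  have 2: "(\<integral>t. indicator {x..1} t *\<^sub>R (\<phi> t + (t - 1) *\<^sub>R \<phi>' t) \<partial>lborel) = (1 - 1) *\<^sub>R \<phi> 1 - (x - 1) *\<^sub>R \<phi> x"
  proof (rule integral_FTC_atLeastAtMost[OF x(2)])
    have "((\<lambda>t. t - 1) has_real_derivative 1) (at t)" for t by (auto intro!: derivative_eq_intros)
    from has_vector_derivative_scaleR[OF this d]
    show "((\<lambda>t. (t - 1) *\<^sub>R \<phi> t) has_vector_derivative \<phi> t + (t - 1) *\<^sub>R \<phi>' t) (at t within {x..1})" for t
      by (auto intro: has_vector_derivative_at_within simp: add.commute)
    show "continuous_on {x..1} (\<lambda>t. \<phi> t + (t - 1) *\<^sub>R \<phi>' t)" by (intro continuous_intros cs)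
  qed
  have i: "integrable lborel (\<lambda>t. indicator {0..x} t *\<^sub>R (\<phi> t + t *\<^sub>R \<phi>' t))"
    "integrable lborel (\<lambda>t. indicator {x..1} t *\<^sub>R (\<phi> t + (t - 1) *\<^sub>R \<phi>' t))"
    by (intro borel_integrable_compact compact_Icc continuous_intros cs)+
  have [measurable]: "\<phi> \<in> borel_measurable borel" "\<phi>' \<in> borel_measurable borel"
    using c\<phi> c by (auto intro: borel_measurable_continuous_onI)
  have "(\<integral>t. indicator {0..1} t *\<^sub>R (\<phi> t + (if t \<le> x then t else t - 1) *\<^sub>R \<phi>' t) \<partial>lborel) =
     (\<integral>t. indicator {0..x} t *\<^sub>R (\<phi> t + t *\<^sub>R \<phi>' t) + indicator {x..1} t *\<^sub>R (\<phi> t + (t - 1) *\<^sub>R \<phi>' t) \<partial>lborel)"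
  proof (rule integral_cong_AE)
    show "AE t in lborel. indicator {0..1} t *\<^sub>R (\<phi> t + (if t \<le> x then t else t - 1) *\<^sub>R \<phi>' t) =
      indicator {0..x} t *\<^sub>R (\<phi> t + t *\<^sub>R \<phi>' t) + indicator {x..1} t *\<^sub>R (\<phi> t + (t - 1) *\<^sub>R \<phi>' t)"
      using AE_lborel_singleton[of x] by eventually_elim (use x in \<open>auto split: split_indicator\<close>)
  qed measurable
  also have "\<dots> = \<phi> x"
    unfolding Bochner_Integration.integral_add[OF i] 1 2 by (simp add: scaleR_left_diff_distrib)
  finally show ?thesis .
qed

section \<open>Removing the dependence of the symbol on \<open>x\<close>\<close>

definition set_coord :: "'v::euclidean_space \<Rightarrow> real \<Rightarrow> 'v \<times> 'w::euclidean_space \<Rightarrow> 'v \<times> 'w" where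
  "set_coord i t z = (fst z + (t - fst z \<bullet> i) *\<^sub>R i, snd z)"

lemma set_coord_continuous: "continuous_on UNIV (set_coord i t)"
  unfolding set_coord_def[abs_def] by (intro continuous_intros)

lemma set_coord_slab:
  assumes "i \<in> Basis" "t \<in> {0..1}" "z \<in> unit_slab"
  shows "set_coord i t z \<in> unit_slab"
proof -
  have "(fst z + (t - fst z \<bullet> i) *\<^sub>R i) \<bullet> b = (if b = i then t else fst z \<bullet> b)" if "b \<in> Basis" for b
    using that assms(1) by (auto simp: inner_add_left inner_Basis)
  then show ?thesis using assms(2,3) by (auto simp: set_coord_def unit_slab_def mem_box)
qed

lemma bnd_set_coord:
  assumes B: "bnd unit_slab N C B" and i: "i \<in> Basis" and t: "t \<in> {0..1}" and C: "0 \<le> C"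
  shows "bnd unit_slab N C (\<lambda>z. B (set_coord i t z))"
proof (rule bnd_affine[OF set_coord_continuous _ C _ _ B, where \<beta>="\<lambda>b. if b = (i, 0) then 0 else b"])
  show "set_coord i t (z + s *\<^sub>R b) = set_coord i t z + s *\<^sub>R (if b = (i, 0) then 0 else b)"
    if "b \<in> Basis" for b z s
  proof -
    consider "b = (i, 0)" | c where "c \<in> Basis" "c \<noteq> i" "b = (c, 0)" | c where "b = (0, c)"
      using \<open>b \<in> Basis\<close> by (auto simp: Basis_prod_def)
    then show ?thesis
      using i by cases (auto simp: set_coord_def inner_add_left inner_not_same_Basis algebra_simps)
  qed
qed (use set_coord_slab[OF i t] in auto)

lemma freq_supp_set_coord: "freq_supp R B \<Longrightarrow> freq_supp R (\<lambda>z. B (set_coord i t z))"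
  by (auto simp: freq_supp_def set_coord_def)

context freq_pair
begin

lemma mult_op_set_coord_measurable:
  assumes "continuous_on UNIV B"
  shows "(\<lambda>q. mult_op (\<lambda>z. B (set_coord i (snd q) z)) \<Phi> (fst q)) \<in> borel_measurable (borel \<Otimes>\<^sub>M borel)"
proof -
  have [measurable]: "B \<in> borel_measurable borel" using assms by (rule borel_measurable_continuous_onI)
  show ?thesis unfolding mult_op_def set_coord_def fst_conv snd_conv by measurable
qed

text \<open>The averaging identity on the unit interval is applied for each \<open>\<zeta>\<close>
  to the symbol as a function of its coordinate \<open>i\<close>, and the integrals are exchanged.
  Only the symbol is frozen; the phase keeps the true \<open>x\<close>. What remains of
  \<open>x \<bullet> i\<close> outside the operators is a real factor of modulus at most 1.\<close>

lemma mult_op_average: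
  assumes B: "bnd unit_slab N C B" "freq_supp R B" and D: "bnd unit_slab N' C D" and i: "i \<in> Basis"
    and d: "\<And>z. ((\<lambda>t. B (z + t *\<^sub>R (i, 0))) has_vector_derivative D z) (at 0)" and x: "x \<in> cbox 0 One"
  shows "mult_op B \<Phi> x = (\<integral>t. indicator {0..1} t *\<^sub>R (mult_op (\<lambda>z. B (set_coord i t z)) \<Phi> x +
    (if t \<le> x \<bullet> i then t else t - 1) *\<^sub>R mult_op (\<lambda>z. D (set_coord i t z)) \<Phi> x) \<partial>lborel)"
proof -
  have sD: "freq_supp R D" using freq_supp_deriv[OF B(2) d] .
  have [measurable]: "B \<in> borel_measurable borel" "D \<in> borel_measurable borel"
    using B D by (auto intro: borel_measurable_continuous_onI bnd_continuous)
  have xi: "0 \<le> x \<bullet> i" "x \<bullet> i \<le> 1" using x i by (auto simp: mem_box)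
  have C: "0 \<le> C" using bnd_bound[OF B(1), of "(x, 0)"] x norm_ge_zero order_trans unfolding unit_slab_def by blast
  let ?k = "\<lambda>t. if t \<le> x \<bullet> i then t else t - 1"
  let ?B = "\<lambda>t \<zeta>. B (set_coord i t (x, \<zeta>))" and ?D = "\<lambda>t \<zeta>. D (set_coord i t (x, \<zeta>))"
  let ?G = "\<lambda>t \<zeta>. (indicator {0..1} t *\<^sub>R (?B t \<zeta> + ?k t *\<^sub>R ?D t \<zeta>)) * (\<Phi> \<zeta> * cis ((x, x) \<bullet> \<zeta>))"
  have bd: "norm (?B t \<zeta>) \<le> C" "norm (?D t \<zeta>) \<le> C" if "t \<in> {0..1}" for t \<zeta>
    using bnd_bound[OF B(1) set_coord_slab[OF i that]] bnd_bound[OF D set_coord_slab[OF i that]] x by (auto simp: unit_slab_def)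
  have sz: "?B t \<zeta> = 0" "?D t \<zeta> = 0" if "\<zeta> \<notin> cube R" for t \<zeta>
    using B(2) sD that unfolding freq_supp_cube set_coord_def fst_conv snd_conv by blast+
  have G: "integrable (lborel \<Otimes>\<^sub>M lborel) (\<lambda>(t, \<zeta>). ?G t \<zeta>)"
  proof (rule Bochner_Integration.integrable_bound)
    have "integrable lborel (\<lambda>t::real. indicator {0..1} t *\<^sub>R (1::complex))"
      by (rule borel_integrable_compact) auto
    moreover have "integrable lborel (\<lambda>\<zeta>::'v \<times> 'v. indicator (cube R) \<zeta> * complex_of_real (2 * C * M\<^sup>2))"
      by (intro integrable_mult_left integrable_indicator_cube)
    ultimately
    show "integrable (lborel \<Otimes>\<^sub>M lborel) (\<lambda>(t, \<zeta>::'v \<times> 'v). indicator {0..1::real} t *\<^sub>R (1::complex) * (indicator (cube R) \<zeta> * complex_of_real (2 * C * M\<^sup>2)))"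
      by (rule integrable_product)
    show "(\<lambda>(t, \<zeta>). ?G t \<zeta>) \<in> borel_measurable (lborel \<Otimes>\<^sub>M lborel)"
      unfolding set_coord_def fst_conv snd_conv by measurable
    have "norm (?G t \<zeta>) \<le> norm (indicator {0..1::real} t *\<^sub>R (1::complex) * (indicator (cube R) \<zeta> * complex_of_real (2 * C * M\<^sup>2)))" for t \<zeta>
    proof (cases "t \<in> {0..1} \<and> \<zeta> \<in> cube R")
      case True
      have "norm (?B t \<zeta> + ?k t *\<^sub>R ?D t \<zeta>) \<le> norm (?B t \<zeta>) + \<bar>?k t\<bar> * norm (?D t \<zeta>)"
        by (rule order_trans[OF norm_triangle_ineq]) simp
      also have "\<dots> \<le> C + 1 * C" using True bd xi by (intro add_mono mult_mono) auto
      finally have "norm (?B t \<zeta> + ?k t *\<^sub>R ?D t \<zeta>) * norm (\<Phi> \<zeta>) \<le> (2 * C) * M\<^sup>2"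
        using C \<Phi>_bound by (intro mult_mono) auto
      then show ?thesis using True C by (simp add: norm_mult norm_power)
    next
      case False
      then show ?thesis using sz[of \<zeta> t] by (cases "\<zeta> \<in> cube R") (auto simp: norm_mult)
    qed
    then show "AE p in lborel \<Otimes>\<^sub>M lborel. norm (case p of (t, \<zeta>) \<Rightarrow> ?G t \<zeta>) \<le>
      norm (case p of (t, \<zeta>) \<Rightarrow> indicator {0..1::real} t *\<^sub>R (1::complex) * (indicator (cube R) \<zeta> * complex_of_real (2 * C * M\<^sup>2)))"
      by (auto intro!: AE_I2)
  qed
  have "mult_op B \<Phi> x = (\<integral>\<zeta>. (\<integral>t. ?G t \<zeta> \<partial>lborel) \<partial>lborel)"
    unfolding mult_op_def
  proof (rule Bochner_Integration.integral_cong[OF refl])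
    fix \<zeta>
    have "(\<integral>t. indicator {0..1} t *\<^sub>R (?B t \<zeta> + ?k t *\<^sub>R ?D t \<zeta>) \<partial>lborel) = ?B (x \<bullet> i) \<zeta>"
    proof (rule unit_interval_average[OF _ _ xi])
      show "((\<lambda>t. ?B t \<zeta>) has_vector_derivative ?D t \<zeta>) (at t)" for t
      proof -
        have e: "set_coord i t (x, \<zeta>) = (x - (x \<bullet> i) *\<^sub>R i, \<zeta>) + t *\<^sub>R (i, 0)" for t
          by (simp add: set_coord_def algebra_simps)
        show ?thesis unfolding e by (rule has_vector_derivative_line_shift) (rule d)
      qed
      show "continuous_on UNIV (\<lambda>t. ?D t \<zeta>)"
        unfolding set_coord_def fst_conv snd_conv
        by (rule continuous_on_compose2[OF bnd_continuous[OF D]]) (auto intro!: continuous_intros)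
    qed
    moreover have "(\<integral>t. ?G t \<zeta> \<partial>lborel) =
        (\<integral>t. indicator {0..1} t *\<^sub>R (?B t \<zeta> + ?k t *\<^sub>R ?D t \<zeta>) \<partial>lborel) * (\<Phi> \<zeta> * cis ((x, x) \<bullet> \<zeta>))"
      by (rule integral_mult_left_zero)
    moreover have "?B (x \<bullet> i) \<zeta> = B (x, \<zeta>)" by (simp add: set_coord_def)
    ultimately show "B (x, \<zeta>) * \<Phi> \<zeta> * cis ((x, x) \<bullet> \<zeta>) = (\<integral>t. ?G t \<zeta> \<partial>lborel)"
      by (simp only: mult.assoc)
  qed
  also have "\<dots> = (\<integral>t. (\<integral>\<zeta>. ?G t \<zeta> \<partial>lborel) \<partial>lborel)"
    by (rule lborel_pair.Fubini_integral[OF G])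
  also have "\<dots> = (\<integral>t. indicator {0..1} t *\<^sub>R (mult_op (\<lambda>z. B (set_coord i t z)) \<Phi> x +
    ?k t *\<^sub>R mult_op (\<lambda>z. D (set_coord i t z)) \<Phi> x) \<partial>lborel)"
  proof (rule Bochner_Integration.integral_cong[OF refl])
    fix t :: real
    show "(\<integral>\<zeta>. ?G t \<zeta> \<partial>lborel) = indicator {0..1} t *\<^sub>R (mult_op (\<lambda>z. B (set_coord i t z)) \<Phi> x +
      ?k t *\<^sub>R mult_op (\<lambda>z. D (set_coord i t z)) \<Phi> x)"
    proof (cases "t \<in> {0..1}")
      case True
      have [measurable]: "?B t \<in> borel_measurable borel" "?D t \<in> borel_measurable borel"
        unfolding set_coord_def fst_conv snd_conv by measurable
      have "integrable lborel (\<lambda>\<zeta>. ?B t \<zeta> * \<Phi> \<zeta> * cis ((x, x) \<bullet> \<zeta>))" "integrable lborel (\<lambda>\<zeta>. ?D t \<zeta> * \<Phi> \<zeta> * cis ((x, x) \<bullet> \<zeta>))"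
        using integrable_\<sigma>\<Phi>[of "?B t" C] integrable_\<sigma>\<Phi>[of "?D t" C] bd[OF True] sz
        by (auto intro!: integrable_mult_unimodular)
      then show ?thesis using True unfolding mult_op_def
        by (simp add: distrib_right distrib_left mult.assoc[symmetric] scaleR_conv_of_real)
          (simp add: mult.assoc)
    qed simp
  qed
  finally show ?thesis .
qed

abbreviation base_bound :: ennreal where
  "base_bound \<equiv> ennreal ((2 * pi) ^ DIM('v) * (2 * R) ^ DIM('v)) * (energy R \<phi> * energy R \<gamma>)"

text \<open>Induction on a set \<open>I\<close> of coordinates outside of which the symbol is
  constant in \<open>x\<close>. Averaging in coordinate \<open>i\<close> replaces \<open>B\<close>
  by frozen copies of \<open>B\<close> and of its \<open>i\<close>-th derivative, both constant in
  one more coordinate. Cauchy-Schwarz on an interval of length 1 and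
  \<open>(u + v)\<^sup>2 \<le> 2 * u\<^sup>2 + 2 * v\<^sup>2\<close> make each coordinate cost a
  factor 4 and one derivative. For empty \<open>I\<close> the symbol is independent of
  \<open>x\<close> and Plancherel's inequality applies.\<close>

lemma mult_op_L2_coords:
  assumes "finite I" "I \<subseteq> Basis"
  shows "bnd unit_slab (card I) C B \<Longrightarrow> freq_supp R B \<Longrightarrow>
    (\<And>x x' \<zeta>. (\<And>b. b \<in> I \<Longrightarrow> x \<bullet> b = x' \<bullet> b) \<Longrightarrow> B (x, \<zeta>) = B (x', \<zeta>)) \<Longrightarrow>
    (\<integral>\<^sup>+x. indicator (cbox 0 One) x * ennreal ((norm (mult_op B \<Phi> x))\<^sup>2) \<partial>lborel) \<le> ennreal (4 ^ card I * C\<^sup>2) * base_bound"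
  using assms
proof (induction I arbitrary: B rule: finite_induct)
  case empty
  have B0: "B (x, \<zeta>) = B (0, \<zeta>)" for x \<zeta> by (rule empty) auto
  have [measurable]: "B \<in> borel_measurable borel"
    using empty(1) by (auto intro: borel_measurable_continuous_onI bnd_continuous)
  have "(\<integral>\<^sup>+x. indicator (cbox 0 One) x * ennreal ((norm (mult_op B \<Phi> x))\<^sup>2) \<partial>lborel) \<le>
     (\<integral>\<^sup>+x. ennreal ((norm (\<integral>\<zeta>. B (0, \<zeta>) * \<Phi> \<zeta> * cis ((x, x) \<bullet> \<zeta>) \<partial>lborel))\<^sup>2) \<partial>lborel)"
  proof (intro nn_integral_mono)
    fix x :: 'v
    have "mult_op B \<Phi> x = (\<integral>\<zeta>. B (0, \<zeta>) * \<Phi> \<zeta> * cis ((x, x) \<bullet> \<zeta>) \<partial>lborel)"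
      unfolding mult_op_def B0[of x] ..
    then show "indicator (cbox 0 One) x * ennreal ((norm (mult_op B \<Phi> x))\<^sup>2) \<le>
        ennreal ((norm (\<integral>\<zeta>. B (0, \<zeta>) * \<Phi> \<zeta> * cis ((x, x) \<bullet> \<zeta>) \<partial>lborel))\<^sup>2)"
      by (auto split: split_indicator)
  qed
  also have "\<dots> \<le> ennreal ((2 * pi) ^ DIM('v) * C\<^sup>2 * (2 * R) ^ DIM('v)) * (energy R \<phi> * energy R \<gamma>)"
  proof (rule frozen_L2)
    show "norm (B (0, \<zeta>)) \<le> C" for \<zeta>
      using bnd_bound[OF empty(1), of "(0, \<zeta>)"] by (auto simp: unit_slab_def mem_box)
  qed (use empty(2) in \<open>auto simp: freq_supp_cube\<close>)
  also have "\<dots> = ennreal (4 ^ card {} * C\<^sup>2) * base_bound"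
    using R by (simp add: ennreal_mult mult_ac)
  finally show ?case .
next
  case (insert i I)
  have i: "i \<in> Basis" "i \<notin> I" "(i, 0) \<in> Basis" using insert by (auto simp: Basis_prod_def)
  have card: "card (insert i I) = Suc (card I)" using insert by simp
  have sB: "freq_supp R B" by (rule insert.prems(2))
  have B: "bnd unit_slab (Suc (card I)) C B" using insert.prems(1) unfolding card .
  then have B': "bnd unit_slab (card I) C B" by (rule bnd_mono) auto
  obtain D where D: "\<And>z. ((\<lambda>t. B (z + t *\<^sub>R (i, 0))) has_vector_derivative D z) (at 0)" "bnd unit_slab (card I) C D"
    using bnd_SucE[OF B] i(3) by metis
  have C: "0 \<le> C"
  proof -
    have "(0, 0) \<in> (unit_slab :: ('v \<times> ('v \<times> 'v)) set)" by (simp add: unit_slab_def mem_box)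
    from bnd_bound[OF B this] show ?thesis using norm_ge_zero order_trans by blast
  qed
  have sD: "freq_supp R D" using freq_supp_deriv[OF sB D(1)] .
  have dB: "B (x, \<zeta>) = B (x', \<zeta>)" if "\<And>b. b \<in> insert i I \<Longrightarrow> x \<bullet> b = x' \<bullet> b" for x x' \<zeta>
    using insert.prems(3) that by blast
  \<comment> \<open>The two lines in direction \<open>i\<close> carry the same values of
    \<open>B\<close>, so the derivatives agree.\<close>
  have dD: "D (x, \<zeta>) = D (x', \<zeta>)" if e: "\<And>b. b \<in> insert i I \<Longrightarrow> x \<bullet> b = x' \<bullet> b" for x x' \<zeta>
  proof -
    have "(\<lambda>t. B ((x, \<zeta>) + t *\<^sub>R (i, 0))) = (\<lambda>t. B ((x', \<zeta>) + t *\<^sub>R (i, 0)))"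
      by (auto simp: fun_eq_iff inner_add_left e intro!: dB)
    then show ?thesis using D(1)[of "(x, \<zeta>)"] D(1)[of "(x', \<zeta>)"] vector_derivative_unique_at by metis
  qed
  \<comment> \<open>After freezing, agreement on \<open>I\<close> becomes agreement on
    \<open>insert i I\<close>; this is the independence that the induction hypothesis asks
    for.\<close>
  have coord: "(x + (t - x \<bullet> i) *\<^sub>R i) \<bullet> b = (x' + (t - x' \<bullet> i) *\<^sub>R i) \<bullet> b"
    if "\<And>b. b \<in> I \<Longrightarrow> x \<bullet> b = x' \<bullet> b" "b \<in> insert i I" for x x' b t
    using that i insert.prems(4) by (auto simp: inner_add_left inner_Basis)
  let ?b = "\<lambda>t x. mult_op (\<lambda>z. B (set_coord i t z)) \<Phi> x" and ?d = "\<lambda>t x. mult_op (\<lambda>z. D (set_coord i t z)) \<Phi> x"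
  let ?E = "ennreal (4 ^ card I * C\<^sup>2) * base_bound"
  have IH: "(\<integral>\<^sup>+x. indicator (cbox 0 One) x * ennreal ((norm (?b t x))\<^sup>2) \<partial>lborel) \<le> ?E"
    "(\<integral>\<^sup>+x. indicator (cbox 0 One) x * ennreal ((norm (?d t x))\<^sup>2) \<partial>lborel) \<le> ?E" if t: "t \<in> {0..1}" for t
  proof -
    show "(\<integral>\<^sup>+x. indicator (cbox 0 One) x * ennreal ((norm (?b t x))\<^sup>2) \<partial>lborel) \<le> ?E"
      using insert.prems(4) by (intro insert.IH bnd_set_coord[OF B' i(1) t C] freq_supp_set_coord sB)
        (auto simp: set_coord_def intro!: dB coord)
    show "(\<integral>\<^sup>+x. indicator (cbox 0 One) x * ennreal ((norm (?d t x))\<^sup>2) \<partial>lborel) \<le> ?E"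
      using insert.prems(4) by (intro insert.IH bnd_set_coord[OF D(2) i(1) t C] freq_supp_set_coord sD)
        (auto simp: set_coord_def intro!: dD coord)
  qed
  have m[measurable]: "(\<lambda>q. ?b (snd q) (fst q)) \<in> borel_measurable (borel \<Otimes>\<^sub>M borel)"
    "(\<lambda>q. ?d (snd q) (fst q)) \<in> borel_measurable (borel \<Otimes>\<^sub>M borel)"
    by (intro mult_op_set_coord_measurable bnd_continuous[OF B] bnd_continuous[OF D(2)])+
  have m1[measurable]: "(\<lambda>t. ?b t x) \<in> borel_measurable borel" "(\<lambda>t. ?d t x) \<in> borel_measurable borel" for x
    using measurable_compose[OF measurable_Pair1' m(1), of x] measurable_compose[OF measurable_Pair1' m(2), of x] by auto
  have m2[measurable]: "(\<lambda>x. ?b t x) \<in> borel_measurable borel" "(\<lambda>x. ?d t x) \<in> borel_measurable borel" for t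
    using measurable_compose[OF measurable_Pair2' m(1), of t] measurable_compose[OF measurable_Pair2' m(2), of t] by auto
  let ?J = "indicator {0..1::real} :: real \<Rightarrow> ennreal" and ?Q = "indicator (cbox 0 One) :: 'v \<Rightarrow> ennreal"
  let ?s = "\<lambda>t x. 2 * ennreal ((norm (?b t x))\<^sup>2) + 2 * ennreal ((norm (?d t x))\<^sup>2)"
  have pt: "?Q x * ennreal ((norm (mult_op B \<Phi> x))\<^sup>2) \<le> (\<integral>\<^sup>+t. ?Q x * (?J t * ?s t x) \<partial>lborel)" for x
  proof (cases "x \<in> cbox 0 One")
    case True
    have "ennreal (norm (mult_op B \<Phi> x)) \<le> (\<integral>\<^sup>+t. norm (indicator {0..1} t *\<^sub>R (?b t x +
        (if t \<le> x \<bullet> i then t else t - 1) *\<^sub>R ?d t x)) \<partial>lborel)"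
      unfolding mult_op_average[OF B sB D(2) i(1) D(1) True] by (rule norm_integral_le_nn_integral)
    also have "\<dots> \<le> (\<integral>\<^sup>+t. ?J t * ennreal (norm (?b t x) + norm (?d t x)) \<partial>lborel)"
    proof (intro nn_integral_mono)
      fix t :: real
      have "norm (?b t x + (if t \<le> x \<bullet> i then t else t - 1) *\<^sub>R ?d t x) \<le> norm (?b t x) + norm (?d t x)" if "t \<in> {0..1}"
      proof -
        have "norm ((if t \<le> x \<bullet> i then t else t - 1) *\<^sub>R ?d t x) \<le> 1 * norm (?d t x)"
          unfolding norm_scaleR using that by (intro mult_right_mono) auto
        then show ?thesis using norm_triangle_ineq[of "?b t x" "(if t \<le> x \<bullet> i then t else t - 1) *\<^sub>R ?d t x"] by linarith
      qed
      then show "ennreal (norm (indicator {0..1} t *\<^sub>R (?b t x + (if t \<le> x \<bullet> i then t else t - 1) *\<^sub>R ?d t x))) \<le>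
         ?J t * ennreal (norm (?b t x) + norm (?d t x))"
        by (cases "t \<in> {0..1}") (simp_all add: ennreal_leI del: ennreal_plus)
    qed
    finally have "(ennreal (norm (mult_op B \<Phi> x)))\<^sup>2 \<le> (\<integral>\<^sup>+t. ?J t * ennreal (norm (?b t x) + norm (?d t x)) \<partial>lborel)\<^sup>2"
      by (intro power_mono) auto
    also have "\<dots> \<le> emeasure lborel {0..1::real} * (\<integral>\<^sup>+t. ?J t * (ennreal (norm (?b t x) + norm (?d t x)))\<^sup>2 \<partial>lborel)"
      by (rule nn_integral_set_CS) auto
    also have "\<dots> \<le> (\<integral>\<^sup>+t. ?J t * ?s t x \<partial>lborel)"
    proof -
      have "(u + v)\<^sup>2 \<le> 2 * u\<^sup>2 + 2 * v\<^sup>2" for u v :: real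
        using sum_squares_bound[of u v] by (simp add: power2_sum)
      then have "(ennreal (norm (?b t x) + norm (?d t x)))\<^sup>2 \<le> ?s t x" for t
        by (simp add: ennreal_power ennreal_plus[symmetric] ennreal_mult[symmetric] ennreal_numeral[symmetric] ennreal_leI del: ennreal_plus ennreal_numeral)
      then show ?thesis by (auto intro!: nn_integral_mono mult_left_mono)
    qed
    finally show ?thesis using True by (simp add: ennreal_power)
  qed simp
  have "(\<integral>\<^sup>+x. ?Q x * ennreal ((norm (mult_op B \<Phi> x))\<^sup>2) \<partial>lborel) \<le> (\<integral>\<^sup>+x. \<integral>\<^sup>+t. ?Q x * (?J t * ?s t x) \<partial>lborel \<partial>lborel)"
    by (intro nn_integral_mono pt)
  also have "\<dots> = (\<integral>\<^sup>+t. \<integral>\<^sup>+x. ?Q x * (?J t * ?s t x) \<partial>lborel \<partial>lborel)"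
    using m by (intro lborel_pair.Fubini'[symmetric]) (simp add: case_prod_unfold)
  also have "\<dots> \<le> (\<integral>\<^sup>+t. ?J t * (2 * ?E + 2 * ?E) \<partial>lborel)"
  proof (intro nn_integral_mono)
    fix t :: real
    have "(\<integral>\<^sup>+x. ?Q x * (?J t * ?s t x) \<partial>lborel) = (\<integral>\<^sup>+x. ?J t * (2 * (?Q x * ennreal ((norm (?b t x))\<^sup>2)) + 2 * (?Q x * ennreal ((norm (?d t x))\<^sup>2))) \<partial>lborel)"
      by (intro nn_integral_cong) (simp add: distrib_left mult_ac)
    also have "\<dots> = ?J t * (2 * (\<integral>\<^sup>+x. ?Q x * ennreal ((norm (?b t x))\<^sup>2) \<partial>lborel) + 2 * (\<integral>\<^sup>+x. ?Q x * ennreal ((norm (?d t x))\<^sup>2) \<partial>lborel))"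
      by (simp add: nn_integral_cmult nn_integral_add)
    also have "\<dots> \<le> ?J t * (2 * ?E + 2 * ?E)"
      using IH[of t] by (cases "t \<in> {0..1}") (auto intro!: mult_left_mono add_mono)
    finally show "(\<integral>\<^sup>+x. ?Q x * (?J t * ?s t x) \<partial>lborel) \<le> ?J t * (2 * ?E + 2 * ?E)" .
  qed
  also have "\<dots> = 2 * ?E + 2 * ?E" by (simp add: nn_integral_multc)
  also have "\<dots> = 4 * ?E" by (simp add: distrib_right[symmetric])
  also have "\<dots> = ennreal (4 ^ card (insert i I) * C\<^sup>2) * base_bound"
    unfolding card by (simp add: ennreal_mult mult.assoc[symmetric])
  finally show ?case .
qed

lemma mult_op_L2:
  assumes B: "bnd unit_slab DIM('v) C B" "freq_supp R B"
  shows "(\<integral>\<^sup>+x. indicator (cbox 0 One) x * ennreal ((norm (mult_op B \<Phi> x))\<^sup>2) \<partial>lborel) \<le> ennreal (4 ^ DIM('v) * C\<^sup>2) * base_bound"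
proof (rule mult_op_L2_coords[OF finite_Basis order_refl B])
  fix x x' :: 'v and \<zeta> assume "\<And>b. b \<in> Basis \<Longrightarrow> x \<bullet> b = x' \<bullet> b"
  then have "x = x'" by (rule euclidean_eqI)
  then show "B (x, \<zeta>) = B (x', \<zeta>)" by simp
qed

text \<open>At a single point \<open>x\<close> the symbol is frozen already, so no
  \<open>x\<close>-derivatives are consumed.\<close>

lemma mult_op_sup:
  assumes B: "bnd unit_slab N C B" "freq_supp R B" and x: "x \<in> cbox 0 One"
  shows "ennreal ((norm (mult_op B \<Phi> x))\<^sup>2) \<le> ennreal (C\<^sup>2 * ((2 * R) ^ DIM('v))\<^sup>2) * (energy R \<phi> * energy R \<gamma>)"
  unfolding mult_op_def
proof (rule frozen_sup)
  have "B \<in> borel_measurable borel"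
    using B(1) by (auto intro: borel_measurable_continuous_onI bnd_continuous)
  then show "(\<lambda>\<zeta>. B (x, \<zeta>)) \<in> borel_measurable borel" by measurable
  show "norm (B (x, \<zeta>)) \<le> C" for \<zeta>
    using bnd_bound[OF B(1), of "(x, \<zeta>)"] x by (auto simp: unit_slab_def)
qed (use B(2) in \<open>auto simp: freq_supp_cube\<close>)

end

section \<open>Frequency energy of weighted functions\<close>

text \<open>The reciprocal of the modulus of the weight \<open>(weight_root y)\<^sup>2\<close>.
  Having finite mass and values at most 1, it serves as the measure of the local norms.\<close>

definition decay :: "'v::euclidean_space \<Rightarrow> real" where
  "decay y = (\<Prod>b\<in>Basis. inverse (1 + (y \<bullet> b)\<^sup>2))"

lemma decay_pos: "0 < decay y"
  unfolding decay_def by (intro prod_pos) (auto simp: add_pos_nonneg)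

lemma decay_le_1: "decay y \<le> 1"
  unfolding decay_def by (intro prod_le_1) (auto simp: inverse_le_1_iff)

lemma decay_measurable [measurable]: "decay \<in> borel_measurable borel"
  unfolding decay_def[abs_def] by measurable

lemma nn_integral_decay: "(\<integral>\<^sup>+y. ennreal (decay (y::'v::euclidean_space)) \<partial>lborel) = ennreal (pi ^ DIM('v))"
proof -
  have i: "integrable lborel (\<lambda>t::real. inverse (1 + t\<^sup>2))" and e: "(\<integral>t. inverse (1 + t\<^sup>2) \<partial>lborel) = pi"
    using integrable_inverse_1_plus_square LBINT_inverse_1_plus_square
    by (simp_all add: set_integrable_def interval_lebesgue_integral_def set_lebesgue_integral_def)
  have "(\<integral>\<^sup>+y. ennreal (decay (y::'v)) \<partial>lborel) = (\<integral>\<^sup>+y. (\<Prod>b\<in>Basis. ennreal (inverse (1 + ((y::'v) \<bullet> b)\<^sup>2))) \<partial>lborel)"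
    unfolding decay_def by (subst prod_ennreal) auto
  also have "\<dots> = (\<Prod>b\<in>(Basis::'v set). \<integral>\<^sup>+t. ennreal (inverse (1 + t\<^sup>2)) \<partial>lborel)"
    by (subst nn_integral_lborel_prod) auto
  also have "(\<integral>\<^sup>+t. ennreal (inverse (1 + t\<^sup>2)) \<partial>lborel) = ennreal pi"
    using nn_integral_eq_integral[OF i] e by simp
  finally show ?thesis by (simp add: ennreal_power)
qed

lemma norm_weight_root: "inverse ((norm (weight_root y))\<^sup>2) = decay y"
proof -
  have "(norm (1 + \<i> * complex_of_real t))\<^sup>2 = 1 + t\<^sup>2" for t by (simp add: cmod_def)
  then show ?thesis
    unfolding weight_root_def decay_def prod_norm[symmetric] prod_power_distrib prod_inversef[symmetric] o_def by simp
qed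

lemma norm_div_weight: "norm (f y / (weight_root y)\<^sup>2) = norm (f y) * decay y"
  unfolding norm_weight_root[symmetric] by (simp add: norm_mult norm_inverse norm_power divide_inverse)

lemma integrable_div_weight:
  assumes "integrable lborel f"
  shows "integrable lborel (\<lambda>y. f y / (weight_root y)\<^sup>2)"
proof (rule Bochner_Integration.integrable_bound[OF assms])
  note [measurable] = integrable_lborelD[OF assms]
  show "(\<lambda>y. f y / (weight_root y)\<^sup>2) \<in> borel_measurable lborel" unfolding weight_root_def by measurable
  show "AE y in lborel. norm (f y / (weight_root y)\<^sup>2) \<le> norm (f y)"
    unfolding norm_div_weight using decay_pos decay_le_1 by (auto intro!: AE_I2 mult_left_le)
qed

text \<open>On a space of finite mass this takes the place of Hoelder's inequality between two
  exponents: a lower power is dominated by a constant plus a higher power. Scaling is restored by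
  normalising \<open>x\<close> beforehand.\<close>

lemma powr_le_one_plus:
  fixes x :: real
  assumes "0 \<le> x" "0 \<le> \<theta>" "\<theta> \<le> 1"
  shows "x powr \<theta> \<le> 1 + x"
proof (cases "x \<le> 1")
  case True
  then have "x powr \<theta> \<le> 1" using assms by (simp add: powr_le1)
  then show ?thesis using assms by simp
next
  case False
  then have "x powr \<theta> \<le> x powr 1" using assms by (intro powr_mono) auto
  then show ?thesis using False by simp
qed

text \<open>Exponents are given by their reciprocals \<open>t = 1/q\<close>, with \<open>t = 0\<close> standing for \<open>L\<^sup>\<infinity>\<close>,
  here and in \<open>Lp_le\<close> below.\<close>

definition weighted_Lp_le :: "real \<Rightarrow> ('v::euclidean_space \<Rightarrow> complex) \<Rightarrow> real \<Rightarrow> bool" where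
  "weighted_Lp_le t f N \<longleftrightarrow> (if t = 0 then AE y in lborel. norm (f y) \<le> N
     else (\<integral>\<^sup>+y. ennreal (norm (f y) powr (1 / t) * decay y) \<partial>lborel) \<le> ennreal (N powr (1 / t)))"

lemma energy_add:
  assumes [measurable]: "\<phi> \<in> borel_measurable borel" "\<psi> \<in> borel_measurable borel"
  shows "energy R (\<lambda>\<xi>. \<phi> \<xi> + \<psi> \<xi>) \<le> 2 * energy R \<phi> + 2 * energy R \<psi>"
proof -
  have "energy R (\<lambda>\<xi>. \<phi> \<xi> + \<psi> \<xi>) \<le> (\<integral>\<^sup>+\<xi>. 2 * (indicator (cube R) \<xi> * ennreal ((norm (\<phi> \<xi>))\<^sup>2)) +
     2 * (indicator (cube R) \<xi> * ennreal ((norm (\<psi> \<xi>))\<^sup>2)) \<partial>lborel)"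
    unfolding energy_def
  proof (intro nn_integral_mono)
    fix \<xi> :: 'a
    have "(norm (\<phi> \<xi> + \<psi> \<xi>))\<^sup>2 \<le> (norm (\<phi> \<xi>) + norm (\<psi> \<xi>))\<^sup>2" by (intro power_mono norm_triangle_ineq) auto
    also have "\<dots> \<le> 2 * (norm (\<phi> \<xi>))\<^sup>2 + 2 * (norm (\<psi> \<xi>))\<^sup>2"
      using sum_squares_bound[of "norm (\<phi> \<xi>)" "norm (\<psi> \<xi>)"] by (simp add: power2_sum)
    finally have "ennreal ((norm (\<phi> \<xi> + \<psi> \<xi>))\<^sup>2) \<le> 2 * ennreal ((norm (\<phi> \<xi>))\<^sup>2) + 2 * ennreal ((norm (\<psi> \<xi>))\<^sup>2)"
      by (simp add: ennreal_plus[symmetric] ennreal_mult[symmetric] ennreal_numeral[symmetric] ennreal_leI del: ennreal_plus ennreal_numeral)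
    then show "indicator (cube R) \<xi> * ennreal ((norm (\<phi> \<xi> + \<psi> \<xi>))\<^sup>2) \<le>
       2 * (indicator (cube R) \<xi> * ennreal ((norm (\<phi> \<xi>))\<^sup>2)) + 2 * (indicator (cube R) \<xi> * ennreal ((norm (\<psi> \<xi>))\<^sup>2))"
      by (auto split: split_indicator)
  qed
  also have "\<dots> = 2 * energy R \<phi> + 2 * energy R \<psi>"
    unfolding energy_def by (simp add: nn_integral_add nn_integral_cmult)
  finally show ?thesis .
qed

lemma energy_ft_le:
  fixes F :: "'v::euclidean_space \<Rightarrow> complex"
  assumes "integrable lborel F"
  shows "energy R (ft F) \<le> ennreal ((2 * pi) ^ DIM('v)) * (\<integral>\<^sup>+y. ennreal ((norm (F y))\<^sup>2) \<partial>lborel)"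
  unfolding energy_def
  by (rule order_trans[OF _ plancherel_le[OF assms]]) (auto intro!: nn_integral_mono split: split_indicator)

lemma energy_bounded_le:
  fixes \<phi> :: "'v::euclidean_space \<Rightarrow> complex"
  assumes "0 \<le> R" "\<And>\<xi>. norm (\<phi> \<xi>) \<le> c"
  shows "energy R \<phi> \<le> ennreal ((2 * R) ^ DIM('v) * c\<^sup>2)"
proof -
  have "energy R \<phi> \<le> (\<integral>\<^sup>+\<xi>. ennreal (c\<^sup>2) * indicator (cube R) (\<xi>::'v) \<partial>lborel)"
    unfolding energy_def using assms(2)
    by (intro nn_integral_mono) (auto intro!: ennreal_leI power_mono split: split_indicator)
  also have "\<dots> = ennreal (c\<^sup>2) * ennreal ((2 * R) ^ DIM('v))"
    using assms(1) by (subst nn_integral_cmult_indicator) (auto simp: emeasure_cube)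
  finally show ?thesis using assms(1) by (simp add: ennreal_mult[symmetric] mult.commute)
qed

text \<open>With \<open>x = (norm (f y) / N) powr (1 / t)\<close>, the normalised square is
  \<open>x powr (2 * t)\<close> with \<open>2 * t \<le> 1\<close>, hence at most
  \<open>1 + x\<close>. Against \<open>decay\<close> the two terms give \<open>pi ^ n\<close> and 1.
  One of the two factors \<open>decay\<close> in the square of \<open>f / W\<close> is kept as the
  measure, the other is bounded by 1. \<open>R\<close> does not enter.\<close>

lemma energy_high_exponent:
  fixes f :: "'v::euclidean_space \<Rightarrow> complex"
  assumes f: "integrable lborel f" and N: "0 < N" and t: "0 \<le> t" "t \<le> 1/2" and b: "weighted_Lp_le t f N"
  shows "energy R (ft (\<lambda>y. f y / (weight_root y)\<^sup>2)) \<le> ennreal ((2 * pi) ^ DIM('v) * (pi ^ DIM('v) + 1) * N\<^sup>2)"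
proof -
  note [measurable] = integrable_lborelD[OF f]
  have sq: "(norm (f y / (weight_root y)\<^sup>2))\<^sup>2 \<le> (norm (f y))\<^sup>2 * decay y" for y
  proof -
    have "(decay y)\<^sup>2 \<le> decay y" using decay_pos[of y] decay_le_1[of y] by (simp add: power2_eq_square mult_left_le)
    then show ?thesis unfolding norm_div_weight power_mult_distrib by (intro mult_left_mono) auto
  qed
  have "(\<integral>\<^sup>+y. ennreal ((norm (f y / (weight_root y)\<^sup>2))\<^sup>2) \<partial>lborel) \<le> ennreal ((pi ^ DIM('v) + 1) * N\<^sup>2)"
  proof (cases "t = 0")
    case True
    have "(\<integral>\<^sup>+y. ennreal ((norm (f y / (weight_root y)\<^sup>2))\<^sup>2) \<partial>lborel) \<le> (\<integral>\<^sup>+y. ennreal (N\<^sup>2) * ennreal (decay (y::'v)) \<partial>lborel)"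
    proof (rule nn_integral_mono_AE)
      have "AE y in lborel. norm (f y) \<le> N" using b True by (simp add: weighted_Lp_le_def)
      then show "AE y in lborel. ennreal ((norm (f y / (weight_root y)\<^sup>2))\<^sup>2) \<le> ennreal (N\<^sup>2) * ennreal (decay y)"
      proof eventually_elim
        case (elim y)
        have "(norm (f y))\<^sup>2 * decay y \<le> N\<^sup>2 * decay y"
          using elim decay_pos[of y] by (intro mult_right_mono power_mono) auto
        from order_trans[OF sq[of y] this] show ?case
          using decay_pos[of y] by (simp add: ennreal_mult[symmetric] ennreal_leI)
      qed
    qed
    also have "\<dots> = ennreal (pi ^ DIM('v) * N\<^sup>2)"
      by (simp add: nn_integral_multc nn_integral_decay ennreal_mult mult.commute)
    also have "\<dots> \<le> ennreal ((pi ^ DIM('v) + 1) * N\<^sup>2)" by (intro ennreal_leI mult_right_mono) auto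
    finally show ?thesis .
  next
    case False
    then have t0: "0 < t" using t by simp
    have "(\<integral>\<^sup>+y. ennreal ((norm (f y / (weight_root y)\<^sup>2))\<^sup>2) \<partial>lborel) \<le>
      (\<integral>\<^sup>+y. ennreal (N\<^sup>2) * ennreal (decay y) + ennreal (N\<^sup>2 / N powr (1 / t)) * ennreal (norm (f y) powr (1 / t) * decay y) \<partial>lborel)"
    proof (intro nn_integral_mono)
      fix y :: 'v
      define x where "x = (norm (f y) / N) powr (1 / t)"
      have "x powr (2 * t) \<le> 1 + x" unfolding x_def using t by (intro powr_le_one_plus) auto
      also have "x powr (2 * t) = (norm (f y) / N)\<^sup>2"
        unfolding x_def powr_powr using t0 N by (cases "f y = 0") (auto simp: powr_numeral)
      finally have "(norm (f y))\<^sup>2 \<le> N\<^sup>2 * (1 + x)" using N by (simp add: power_divide divide_le_eq mult.commute)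
      then have "(norm (f y))\<^sup>2 * decay y \<le> (N\<^sup>2 * (1 + x)) * decay y"
        using decay_pos[of y] by (intro mult_right_mono) auto
      also have "\<dots> = N\<^sup>2 * decay y + N\<^sup>2 / N powr (1 / t) * (norm (f y) powr (1 / t) * decay y)"
        unfolding x_def using N by (simp add: powr_divide field_simps)
      finally show "ennreal ((norm (f y / (weight_root y)\<^sup>2))\<^sup>2) \<le>
          ennreal (N\<^sup>2) * ennreal (decay y) + ennreal (N\<^sup>2 / N powr (1 / t)) * ennreal (norm (f y) powr (1 / t) * decay y)"
        using sq[of y] decay_pos[of y]
        by (simp add: ennreal_mult[symmetric] ennreal_plus[symmetric] ennreal_leI del: ennreal_plus)
    qed
    also have "\<dots> = ennreal (N\<^sup>2) * ennreal (pi ^ DIM('v)) + ennreal (N\<^sup>2 / N powr (1 / t)) * (\<integral>\<^sup>+y. ennreal (norm (f y) powr (1 / t) * decay y) \<partial>lborel)"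
      by (simp add: nn_integral_add nn_integral_cmult nn_integral_decay)
    also have "\<dots> \<le> ennreal (N\<^sup>2) * ennreal (pi ^ DIM('v)) + ennreal (N\<^sup>2 / N powr (1 / t)) * ennreal (N powr (1 / t))"
      using b t0 by (intro add_left_mono mult_left_mono) (auto simp: weighted_Lp_le_def)
    also have "\<dots> = ennreal ((pi ^ DIM('v) + 1) * N\<^sup>2)"
      using N by (simp add: ennreal_mult[symmetric] ennreal_plus[symmetric] algebra_simps del: ennreal_plus)
    finally show ?thesis .
  qed
  then have "energy R (ft (\<lambda>y. f y / (weight_root y)\<^sup>2)) \<le> ennreal ((2 * pi) ^ DIM('v)) * ennreal ((pi ^ DIM('v) + 1) * N\<^sup>2)"
    by (intro order_trans[OF energy_ft_le[OF integrable_div_weight[OF f]]] mult_left_mono) auto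
  then show ?thesis by (simp add: ennreal_mult[symmetric] mult.assoc)
qed

text \<open>Below exponent 2, split \<open>F\<close> at the height \<open>H\<close> where the Plancherel bound of the low part
  balances the trivial bound of the high part.\<close>

lemma energy_low_exponent:
  fixes f :: "'v::euclidean_space \<Rightarrow> complex"
  assumes f: "integrable lborel f" and N: "0 < N" and t: "1/2 < t" "t \<le> 1" and b: "weighted_Lp_le t f N" and R: "0 < R"
  shows "energy R (ft (\<lambda>y. f y / (weight_root y)\<^sup>2)) \<le>
    ennreal ((2 * (2 * pi) ^ DIM('v) + 2 * 2 ^ DIM('v)) * R powr (2 * DIM('v) * (t - 1/2)) * N\<^sup>2)"
proof -
  let ?n = "real DIM('v)"
  note [measurable] = integrable_lborelD[OF f]
  define q where "q = 1 / t"
  have q: "1 \<le> q" "q < 2" "t * q = 1" using t by (auto simp: q_def field_simps)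
  define F where "F y = f y / (weight_root y)\<^sup>2" for y
  have F: "integrable lborel F" unfolding F_def[abs_def] by (rule integrable_div_weight[OF f])
  note [measurable] = integrable_lborelD[OF F]
  \<comment> \<open>With \<open>q = 1 / t\<close> and dimension \<open>n\<close>, the low part
    contributes \<open>H powr (2 - q) * N powr q\<close> and the high part
    \<open>R powr n * (H powr (1 - q) * N powr q)\<^sup>2\<close>, up to constants. At this height
    both equal \<open>R powr (2 * n * (t - 1/2)) * N\<^sup>2\<close>.\<close>
  define H where "H = R powr (?n * t) * N"
  have H: "0 < H" using R N by (simp add: H_def)
  have Fq: "(\<integral>\<^sup>+y. ennreal (norm (F y) powr q) \<partial>lborel) \<le> ennreal (N powr q)"
  proof -
    have "(\<integral>\<^sup>+y. ennreal (norm (F y) powr q) \<partial>lborel) \<le> (\<integral>\<^sup>+y. ennreal (norm (f y) powr q * decay y) \<partial>lborel)"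
    proof (intro nn_integral_mono ennreal_leI)
      fix y :: 'v
      have "norm (F y) powr q = norm (f y) powr q * decay y powr q"
        unfolding F_def norm_div_weight using decay_pos[of y] by (simp add: powr_mult)
      also have "decay y powr q \<le> decay y powr 1"
        using decay_pos[of y] decay_le_1[of y] q by (intro powr_mono') auto
      finally show "norm (F y) powr q \<le> norm (f y) powr q * decay y"
        using decay_pos[of y] by (simp add: mult_left_mono)
    qed
    also have "\<dots> \<le> ennreal (N powr q)" using b t by (simp add: weighted_Lp_le_def q_def)
    finally show ?thesis .
  qed
  define F1 where "F1 y = (if norm (F y) \<le> H then F y else 0)" for y
  define F2 where "F2 y = (if norm (F y) \<le> H then 0 else F y)" for y
  have [measurable]: "F1 \<in> borel_measurable borel" "F2 \<in> borel_measurable borel"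
    unfolding F1_def[abs_def] F2_def[abs_def] by measurable
  have i: "integrable lborel F1" "integrable lborel F2"
    by (rule Bochner_Integration.integrable_bound[OF F]; simp add: F1_def F2_def)+
  have ft: "ft F = (\<lambda>\<xi>. ft F1 \<xi> + ft F2 \<xi>)"
  proof
    fix \<xi>
    have "ft F \<xi> = (\<integral>y. F1 y * cis (- (y \<bullet> \<xi>)) + F2 y * cis (- (y \<bullet> \<xi>)) \<partial>lborel)"
      unfolding ft_def by (intro Bochner_Integration.integral_cong) (auto simp: F1_def F2_def)
    also have "\<dots> = ft F1 \<xi> + ft F2 \<xi>"
      unfolding ft_def using i by (intro Bochner_Integration.integral_add integrable_mult_unimodular) auto
    finally show "ft F \<xi> = ft F1 \<xi> + ft F2 \<xi>" .
  qed
  have e1: "energy R (ft F1) \<le> ennreal ((2 * pi) ^ DIM('v) * (R powr (2 * ?n * (t - 1/2)) * N\<^sup>2))"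
  proof -
    have "(\<integral>\<^sup>+y. ennreal ((norm (F1 y))\<^sup>2) \<partial>lborel) \<le> (\<integral>\<^sup>+y. ennreal (H powr (2 - q)) * ennreal (norm (F y) powr q) \<partial>lborel)"
    proof (intro nn_integral_mono)
      fix y
      have "(norm (F1 y))\<^sup>2 \<le> H powr (2 - q) * norm (F y) powr q"
      proof (cases "norm (F y) \<le> H \<and> F y \<noteq> 0")
        case True
        then have "(norm (F1 y))\<^sup>2 = norm (F y) powr (2 - q) * norm (F y) powr q"
          by (simp add: F1_def powr_add[symmetric] powr_numeral)
        also have "\<dots> \<le> H powr (2 - q) * norm (F y) powr q"
          using True q by (intro mult_right_mono powr_mono2) auto
        finally show ?thesis .
      qed (auto simp: F1_def)
      then show "ennreal ((norm (F1 y))\<^sup>2) \<le> ennreal (H powr (2 - q)) * ennreal (norm (F y) powr q)"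
        by (simp add: ennreal_mult[symmetric] ennreal_leI)
    qed
    also have "\<dots> = ennreal (H powr (2 - q)) * (\<integral>\<^sup>+y. ennreal (norm (F y) powr q) \<partial>lborel)" by (simp add: nn_integral_cmult)
    also have "\<dots> \<le> ennreal (H powr (2 - q)) * ennreal (N powr q)" by (intro mult_left_mono Fq) auto
    also have "\<dots> = ennreal (R powr (2 * ?n * (t - 1/2)) * N\<^sup>2)"
    proof -
      have "?n * t * (2 - q) = 2 * ?n * (t - 1/2)" using q(3) by (simp add: algebra_simps)
      moreover have "H powr (2 - q) = R powr (?n * t * (2 - q)) * N powr (2 - q)"
        unfolding H_def using N R by (simp add: powr_mult powr_powr)
      ultimately have "H powr (2 - q) = R powr (2 * ?n * (t - 1/2)) * N powr (2 - q)" by (simp only:)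
      moreover have "N powr (2 - q) * N powr q = N\<^sup>2" using N by (simp add: powr_add[symmetric] powr_numeral)
      ultimately show ?thesis by (simp add: ennreal_mult[symmetric] mult.assoc)
    qed
    finally have "(\<integral>\<^sup>+y. ennreal ((norm (F1 y))\<^sup>2) \<partial>lborel) \<le> ennreal (R powr (2 * ?n * (t - 1/2)) * N\<^sup>2)" .
    then have "energy R (ft F1) \<le> ennreal ((2 * pi) ^ DIM('v)) * ennreal (R powr (2 * ?n * (t - 1/2)) * N\<^sup>2)"
      by (intro order_trans[OF energy_ft_le[OF i(1)]] mult_left_mono) auto
    then show ?thesis by (simp add: ennreal_mult[symmetric])
  qed
  have e2: "energy R (ft F2) \<le> ennreal (2 ^ DIM('v) * (R powr (2 * ?n * (t - 1/2)) * N\<^sup>2))"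
  proof -
    have b2: "norm (ft F2 \<xi>) \<le> R powr (?n * (t - 1)) * N" for \<xi>
    proof -
      have "ennreal (norm (ft F2 \<xi>)) \<le> (\<integral>\<^sup>+y. norm (F2 y * cis (- (y \<bullet> \<xi>))) \<partial>lborel)"
        unfolding ft_def by (rule norm_integral_le_nn_integral)
      also have "\<dots> \<le> (\<integral>\<^sup>+y. ennreal (H powr (1 - q)) * ennreal (norm (F y) powr q) \<partial>lborel)"
      proof (intro nn_integral_mono)
        fix y
        have "norm (F2 y) \<le> H powr (1 - q) * norm (F y) powr q"
        proof (cases "norm (F y) \<le> H")
          case False
          then have "norm (F2 y) = norm (F y) powr (1 - q) * norm (F y) powr q"
            using H by (simp add: F2_def powr_add[symmetric])
          also have "\<dots> \<le> H powr (1 - q) * norm (F y) powr q"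
            using False q H by (intro mult_right_mono powr_mono2') auto
          finally show ?thesis .
        qed (auto simp: F2_def)
        then show "ennreal (norm (F2 y * cis (- (y \<bullet> \<xi>)))) \<le> ennreal (H powr (1 - q)) * ennreal (norm (F y) powr q)"
          by (simp add: norm_mult ennreal_mult[symmetric] ennreal_leI)
      qed
      also have "\<dots> = ennreal (H powr (1 - q)) * (\<integral>\<^sup>+y. ennreal (norm (F y) powr q) \<partial>lborel)" by (simp add: nn_integral_cmult)
      also have "\<dots> \<le> ennreal (H powr (1 - q)) * ennreal (N powr q)" by (intro mult_left_mono Fq) auto
      also have "\<dots> = ennreal (R powr (?n * (t - 1)) * N)"
      proof -
        have "?n * t * (1 - q) = ?n * (t - 1)" using q(3) by (simp add: algebra_simps)
        moreover have "H powr (1 - q) = R powr (?n * t * (1 - q)) * N powr (1 - q)"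
          unfolding H_def using N R by (simp add: powr_mult powr_powr)
        ultimately have "H powr (1 - q) = R powr (?n * (t - 1)) * N powr (1 - q)" by (simp only:)
        moreover have "N powr (1 - q) * N powr q = N" using N by (simp add: powr_add[symmetric])
        ultimately show ?thesis by (simp add: ennreal_mult[symmetric] mult.assoc)
      qed
      finally show ?thesis using N by simp
    qed
    have "energy R (ft F2) \<le> ennreal ((2 * R) ^ DIM('v) * (R powr (?n * (t - 1)) * N)\<^sup>2)"
      using energy_bounded_le[OF less_imp_le[OF R] b2] .
    also have "(2 * R) ^ DIM('v) * (R powr (?n * (t - 1)) * N)\<^sup>2 = 2 ^ DIM('v) * (R powr (2 * ?n * (t - 1/2)) * N\<^sup>2)"
    proof -
      have "R ^ DIM('v) = R powr ?n" using R by (simp add: powr_realpow)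
      moreover have "(R powr (?n * (t - 1)))\<^sup>2 = R powr (2 * (?n * (t - 1)))"
        using R by (simp add: power2_eq_square powr_add[symmetric] mult.commute)
      moreover have "R powr ?n * R powr (2 * (?n * (t - 1))) = R powr (2 * ?n * (t - 1/2))"
        using R by (simp add: powr_add[symmetric] algebra_simps)
      ultimately show ?thesis by (simp add: power_mult_distrib mult.assoc)
    qed
    finally show ?thesis .
  qed
  have [measurable]: "ft F1 \<in> borel_measurable borel" "ft F2 \<in> borel_measurable borel" by measurable
  have "energy R (ft F) \<le> 2 * energy R (ft F1) + 2 * energy R (ft F2)"
    unfolding ft by (rule energy_add) measurable
  also have "\<dots> \<le> 2 * ennreal ((2 * pi) ^ DIM('v) * (R powr (2 * ?n * (t - 1/2)) * N\<^sup>2)) + 2 * ennreal (2 ^ DIM('v) * (R powr (2 * ?n * (t - 1/2)) * N\<^sup>2))"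
    by (intro add_mono mult_left_mono e1 e2) auto
  also have "\<dots> = ennreal ((2 * (2 * pi) ^ DIM('v) + 2 * 2 ^ DIM('v)) * R powr (2 * ?n * (t - 1/2)) * N\<^sup>2)"
    by (simp add: ennreal_mult[symmetric] ennreal_plus[symmetric] ennreal_numeral[symmetric] algebra_simps del: ennreal_plus ennreal_numeral)
  finally show ?thesis unfolding F_def[abs_def] by simp
qed

lemma energy_weighted_bound:
  assumes t: "0 \<le> t" "t \<le> 1"
  obtains A where "0 < A" "\<And>(f :: 'v::euclidean_space \<Rightarrow> complex) N R. integrable lborel f \<Longrightarrow> 0 < N \<Longrightarrow> 0 < R \<Longrightarrow> weighted_Lp_le t f N \<Longrightarrow>
    energy R (ft (\<lambda>y. f y / (weight_root y)\<^sup>2)) \<le> ennreal (A * R powr (2 * DIM('v) * max 0 (t - 1/2)) * N\<^sup>2)"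
proof (cases "t \<le> 1/2")
  case True
  show ?thesis
  proof (rule that[of "(2 * pi) ^ DIM('v) * (pi ^ DIM('v) + 1)"])
    show "energy R (ft (\<lambda>y. f y / (weight_root y)\<^sup>2)) \<le>
        ennreal ((2 * pi) ^ DIM('v) * (pi ^ DIM('v) + 1) * R powr (2 * DIM('v) * max 0 (t - 1/2)) * N\<^sup>2)"
      if "integrable lborel f" "0 < N" "0 < R" "weighted_Lp_le t f N" for f :: "'v \<Rightarrow> complex" and N R
      proof -
      have "max 0 (t - 1/2) = 0" using True by simp
      then show ?thesis using energy_high_exponent[OF that(1,2) t(1) True that(4), of R] that by simp
    qed
  qed (auto intro!: mult_pos_pos add_pos_pos)
next
  case False
  show ?thesis
  proof (rule that[of "2 * (2 * pi) ^ DIM('v) + 2 * 2 ^ DIM('v)"])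
    show "energy R (ft (\<lambda>y. f y / (weight_root y)\<^sup>2)) \<le>
        ennreal ((2 * (2 * pi) ^ DIM('v) + 2 * 2 ^ DIM('v)) * R powr (2 * DIM('v) * max 0 (t - 1/2)) * N\<^sup>2)"
      if "integrable lborel f" "0 < N" "0 < R" "weighted_Lp_le t f N" for f :: "'v \<Rightarrow> complex" and N R
      using energy_low_exponent[OF that(1,2) _ t(2) that(4) that(3)] False by (simp add: max_def)
  qed (auto intro: add_pos_pos)
qed

section \<open>The single-scale estimate\<close>

text \<open>Interpolation between L2 and the supremum: all but two powers of the modulus are taken
  out at their largest value.\<close>

lemma nn_integral_powr_ge2:
  assumes [measurable]: "T \<in> borel_measurable M" "Q \<in> sets M" and r: "2 \<le> r" and G: "0 < G3"
    and sup: "\<And>x. x \<in> Q \<Longrightarrow> norm (T x :: complex) \<le> G3"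
    and L2: "(\<integral>\<^sup>+x. indicator Q x * ennreal ((norm (T x))\<^sup>2) \<partial>M) \<le> ennreal (G2\<^sup>2)"
  shows "(\<integral>\<^sup>+x. indicator Q x * ennreal (norm (T x) powr r) \<partial>M) \<le> ennreal (G3 powr (r - 2) * G2\<^sup>2)"
proof -
  have "(\<integral>\<^sup>+x. indicator Q x * ennreal (norm (T x) powr r) \<partial>M) \<le>
    (\<integral>\<^sup>+x. ennreal (G3 powr (r - 2)) * (indicator Q x * ennreal ((norm (T x))\<^sup>2)) \<partial>M)"
  proof (intro nn_integral_mono)
    fix x
    have "norm (T x) powr r \<le> G3 powr (r - 2) * (norm (T x))\<^sup>2" if "x \<in> Q"
    proof (cases "T x = 0")
      case False
      have "norm (T x) powr r = norm (T x) powr (r - 2) * norm (T x) powr 2"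
        using powr_add[of "norm (T x)" "r - 2" 2] by simp
      then have "norm (T x) powr r = norm (T x) powr (r - 2) * (norm (T x))\<^sup>2"
        using False by (simp add: powr_numeral)
      also have "\<dots> \<le> G3 powr (r - 2) * (norm (T x))\<^sup>2"
        using sup[OF that] r by (intro mult_right_mono powr_mono2) auto
      finally show ?thesis .
    qed simp
    then show "indicator Q x * ennreal (norm (T x) powr r) \<le> ennreal (G3 powr (r - 2)) * (indicator Q x * ennreal ((norm (T x))\<^sup>2))"
      by (cases "x \<in> Q") (auto simp: ennreal_mult[symmetric] ennreal_leI)
  qed
  also have "\<dots> = ennreal (G3 powr (r - 2)) * (\<integral>\<^sup>+x. indicator Q x * ennreal ((norm (T x))\<^sup>2) \<partial>M)"
    by (rule nn_integral_cmult) measurable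
  also have "\<dots> \<le> ennreal (G3 powr (r - 2)) * ennreal (G2\<^sup>2)" by (intro mult_left_mono L2) auto
  finally show ?thesis by (simp add: ennreal_mult[symmetric])
qed

text \<open>On a set of measure at most 1 the L2 norm controls the lower ones. The factor 2 stems
  from the two terms of \<open>powr_le_one_plus\<close>, applied to the square of the modulus
  normalised by \<open>G2\<close>.\<close>

lemma nn_integral_powr_le2:
  assumes [measurable]: "T \<in> borel_measurable M" "Q \<in> sets M" and r: "1 \<le> r" "r \<le> 2" and G: "0 < G2"
    and Q: "emeasure M Q \<le> 1"
    and L2: "(\<integral>\<^sup>+x. indicator Q x * ennreal ((norm (T x :: complex))\<^sup>2) \<partial>M) \<le> ennreal (G2\<^sup>2)"
  shows "(\<integral>\<^sup>+x. indicator Q x * ennreal (norm (T x) powr r) \<partial>M) \<le> ennreal (2 * G2 powr r)"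
proof -
  have "(\<integral>\<^sup>+x. indicator Q x * ennreal (norm (T x) powr r) \<partial>M) \<le>
    (\<integral>\<^sup>+x. ennreal (G2 powr r) * indicator Q x + ennreal (G2 powr r / G2\<^sup>2) * (indicator Q x * ennreal ((norm (T x))\<^sup>2)) \<partial>M)"
  proof (intro nn_integral_mono)
    fix x
    have "((norm (T x) / G2)\<^sup>2) powr (r / 2) \<le> 1 + (norm (T x) / G2)\<^sup>2"
      using r by (intro powr_le_one_plus) auto
    also have "((norm (T x) / G2)\<^sup>2) powr (r / 2) = (norm (T x) / G2) powr r"
    proof -
      have "(norm (T x) / G2)\<^sup>2 = (norm (T x) / G2) powr 2" using G by (cases "T x = 0") (auto simp: powr_numeral)
      then have "((norm (T x) / G2)\<^sup>2) powr (r / 2) = ((norm (T x) / G2) powr 2) powr (r / 2)" by (simp only:)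
      then show ?thesis by (simp add: powr_powr)
    qed
    also have "\<dots> = norm (T x) powr r / G2 powr r" using G by (simp add: powr_divide)
    finally have "norm (T x) powr r \<le> G2 powr r + G2 powr r / G2\<^sup>2 * (norm (T x))\<^sup>2"
      using G by (simp add: field_simps power_divide)
    then show "indicator Q x * ennreal (norm (T x) powr r) \<le>
      ennreal (G2 powr r) * indicator Q x + ennreal (G2 powr r / G2\<^sup>2) * (indicator Q x * ennreal ((norm (T x))\<^sup>2))"
      by (cases "x \<in> Q") (auto simp: ennreal_mult[symmetric] ennreal_plus[symmetric] ennreal_leI simp del: ennreal_plus)
  qed
  also have "\<dots> = ennreal (G2 powr r) * emeasure M Q + ennreal (G2 powr r / G2\<^sup>2) * (\<integral>\<^sup>+x. indicator Q x * ennreal ((norm (T x))\<^sup>2) \<partial>M)"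
    by (simp add: nn_integral_add nn_integral_cmult)
  also have "\<dots> \<le> ennreal (G2 powr r) * 1 + ennreal (G2 powr r / G2\<^sup>2) * ennreal (G2\<^sup>2)"
    by (intro add_mono mult_left_mono L2 Q) auto
  also have "\<dots> = ennreal (2 * G2 powr r)"
    using G by (simp add: ennreal_mult[symmetric] ennreal_plus[symmetric] del: ennreal_plus)
  finally show ?thesis .
qed

text \<open>The first maximum belongs to the output: 1/2 is the exponent of the L2 bound, and
  \<open>1 - (t + s)\<close> results from interpolating it with the exponent 1 of the sup bound when
  the output exponent is at least 2. The other two terms are the costs of input exponents below
  2.\<close>

definition loss :: "real \<Rightarrow> real \<Rightarrow> real" where
  "loss t s = max (1/2) (1 - (t + s)) + max 0 (t - 1/2) + max 0 (s - 1/2)"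

abbreviation tensor_ft :: "('v::euclidean_space \<Rightarrow> complex) \<Rightarrow> ('v \<Rightarrow> complex) \<Rightarrow> 'v \<times> 'v \<Rightarrow> complex" where
  "tensor_ft f g \<equiv> (\<lambda>\<zeta>. ft f (fst \<zeta>) * ft g (snd \<zeta>))"

lemma mult_op_measurable:
  fixes B :: "'v::euclidean_space \<times> ('v \<times> 'v) \<Rightarrow> complex"
  assumes "continuous_on UNIV B" and [measurable]: "f \<in> borel_measurable borel" "g \<in> borel_measurable borel"
  shows "mult_op B (tensor_ft f g) \<in> borel_measurable borel"
proof -
  have [measurable]: "B \<in> borel_measurable borel" using assms(1) by (rule borel_measurable_continuous_onI)
  have "(\<lambda>\<zeta>. ft f (fst \<zeta>) * ft g (snd \<zeta>)) \<in> borel_measurable (borel \<Otimes>\<^sub>M borel)" by measurable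
  then have [measurable]: "tensor_ft f g \<in> borel_measurable borel" by (simp add: borel_prod)
  show ?thesis unfolding mult_op_def[abs_def] by measurable
qed

lemma emeasure_unit_cube: "emeasure lborel (cbox 0 One :: 'v::euclidean_space set) = 1"
  by (subst emeasure_lborel_cbox) auto

text \<open>Of the 5n derivatives, 4n are spent on passing from the data to \<open>f / W\<close> and
  \<open>g / W\<close>, and n remain for the L2 estimate. The energies of the divided data are
  controlled by the weighted norms and contribute the same power of \<open>R\<close> to both
  bounds.\<close>

lemma mult_op_local_bounds:
  assumes ts: "0 \<le> t" "t \<le> 1" "0 \<le> s" "s \<le> 1"
  obtains A where "0 < A" "\<And>(B :: 'v::euclidean_space \<times> ('v \<times> 'v) \<Rightarrow> complex) C R f g N1 N2.
    0 < C \<Longrightarrow> 0 < R \<Longrightarrow> bnd unit_slab (5 * DIM('v)) C B \<Longrightarrow> freq_supp R B \<Longrightarrow>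
    integrable lborel f \<Longrightarrow> integrable lborel g \<Longrightarrow> 0 < N1 \<Longrightarrow> 0 < N2 \<Longrightarrow> weighted_Lp_le t f N1 \<Longrightarrow> weighted_Lp_le s g N2 \<Longrightarrow>
    (\<integral>\<^sup>+x. indicator (cbox 0 One) x * ennreal ((norm (mult_op B (tensor_ft f g) x))\<^sup>2) \<partial>lborel) \<le>
      ennreal ((A * C * R powr (DIM('v) * (1/2 + (max 0 (t - 1/2) + max 0 (s - 1/2)))) * N1 * N2)\<^sup>2) \<and>
    (\<forall>x\<in>cbox 0 One. norm (mult_op B (tensor_ft f g) x) \<le> A * C * R powr (DIM('v) * (1 + (max 0 (t - 1/2) + max 0 (s - 1/2)))) * N1 * N2)"
proof -
  let ?n = "real DIM('v)" and ?\<theta> = "max 0 (t - 1/2) + max 0 (s - 1/2)"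
  obtain A0 where A0: "0 \<le> A0" "\<And>(B :: 'v \<times> ('v \<times> 'v) \<Rightarrow> complex) C R. 0 \<le> C \<Longrightarrow> bnd unit_slab (DIM('v) + 4 * DIM('v)) C B \<Longrightarrow> freq_supp R B \<Longrightarrow>
    (\<exists>B'. bnd unit_slab DIM('v) (A0 * C) B' \<and> freq_supp R B' \<and>
      (\<forall>f g x. integrable lborel f \<longrightarrow> integrable lborel g \<longrightarrow>
        mult_op B (tensor_ft f g) x =
        mult_op B' (tensor_ft (\<lambda>y. f y / (weight_root y)\<^sup>2) (\<lambda>y. g y / (weight_root y)\<^sup>2)) x))"
    using mult_op_weight[of "DIM('v)"] by blast
  obtain A1 where A1: "0 < A1" "\<And>(f :: 'v \<Rightarrow> complex) N R. integrable lborel f \<Longrightarrow> 0 < N \<Longrightarrow> 0 < R \<Longrightarrow> weighted_Lp_le t f N \<Longrightarrow>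
    energy R (ft (\<lambda>y. f y / (weight_root y)\<^sup>2)) \<le> ennreal (A1 * R powr (2 * ?n * max 0 (t - 1/2)) * N\<^sup>2)"
    using energy_weighted_bound[OF ts(1,2)] by (auto simp: mult.assoc)
  obtain A2 where A2: "0 < A2" "\<And>(f :: 'v \<Rightarrow> complex) N R. integrable lborel f \<Longrightarrow> 0 < N \<Longrightarrow> 0 < R \<Longrightarrow> weighted_Lp_le s f N \<Longrightarrow>
    energy R (ft (\<lambda>y. f y / (weight_root y)\<^sup>2)) \<le> ennreal (A2 * R powr (2 * ?n * max 0 (s - 1/2)) * N\<^sup>2)"
    using energy_weighted_bound[OF ts(3,4)] by (auto simp: mult.assoc)
  \<comment> \<open>\<open>16 * pi\<close> collects, per dimension, 4 from the Sobolev step,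
    \<open>2 * pi\<close> from Plancherel and 2 from the side of the cube. The sup bound brings only
    4 and is covered as well.\<close>
  define a where "a = (16 * pi) ^ DIM('v) * A0\<^sup>2 * A1 * A2"
  have a: "0 \<le> a" using A0 A1 A2 by (simp add: a_def)
  show ?thesis
  \<comment> \<open>Adding 1 keeps the constant positive even if \<open>A0\<close> is 0.\<close>
  proof (rule that[of "sqrt a + 1"])
    show "0 < sqrt a + 1" using a by (simp add: add_nonneg_pos)
    fix B :: "'v \<times> ('v \<times> 'v) \<Rightarrow> complex" and C R and f g :: "'v \<Rightarrow> complex" and N1 N2
    assume h: "0 < C" "0 < R" "bnd unit_slab (5 * DIM('v)) C B" "freq_supp R B"
      "integrable lborel f" "integrable lborel g" "0 < N1" "0 < N2" "weighted_Lp_le t f N1" "weighted_Lp_le s g N2"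
    define F where "F y = f y / (weight_root y)\<^sup>2" for y
    define G where "G y = g y / (weight_root y)\<^sup>2" for y
    have iFG: "integrable lborel F" "integrable lborel G"
      unfolding F_def[abs_def] G_def[abs_def] by (intro integrable_div_weight h)+
    note [measurable] = integrable_lborelD[OF iFG(1)] integrable_lborelD[OF iFG(2)]
    obtain B' where B': "bnd unit_slab DIM('v) (A0 * C) B'" "freq_supp R B'"
      "\<And>x. mult_op B (tensor_ft f g) x = mult_op B' (tensor_ft F G) x"
      using A0(2)[of C B R] h unfolding F_def[abs_def] G_def[abs_def] by auto
    define X where "X = (\<integral>y. norm (F y) \<partial>lborel) + (\<integral>y. norm (G y) \<partial>lborel)"
    interpret fp: freq_pair R "ft F" "ft G" X
    proof
      have "0 \<le> (\<integral>y. norm (F y) \<partial>lborel)" "0 \<le> (\<integral>y. norm (G y) \<partial>lborel)" by simp_all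
      then show "norm (ft F \<xi>) \<le> X" "norm (ft G \<xi>) \<le> X" for \<xi>
        unfolding X_def using norm_ft_le[OF iFG(1), of \<xi>] norm_ft_le[OF iFG(2), of \<xi>] by linarith+
    qed (use h in auto)
    have \<Phi>: "fp.\<Phi> = tensor_ft F G" by (auto simp: fun_eq_iff fp.\<Phi>_def)
    define P where "P = A1 * A2 * R powr (2 * ?n * ?\<theta>) * (N1 * N2)\<^sup>2"
    have P: "0 \<le> P" using A1 A2 by (simp add: P_def)
    have E: "energy R (ft F) * energy R (ft G) \<le> ennreal P"
    proof -
      have "energy R (ft F) * energy R (ft G) \<le> ennreal (A1 * R powr (2 * ?n * max 0 (t - 1/2)) * N1\<^sup>2) * ennreal (A2 * R powr (2 * ?n * max 0 (s - 1/2)) * N2\<^sup>2)"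
        unfolding F_def[abs_def] G_def[abs_def] by (intro mult_mono A1(2) A2(2) h) auto
      also have "\<dots> = ennreal P"
        unfolding P_def distrib_left powr_add using A1 A2 by (simp add: ennreal_mult[symmetric] power_mult_distrib mult_ac)
      finally show ?thesis .
    qed
    have Rsq: "(R powr (?n * (c + ?\<theta>)))\<^sup>2 = R powr (2 * ?n * c) * R powr (2 * ?n * ?\<theta>)" for c
      using h(2) by (simp add: power2_eq_square powr_add[symmetric] algebra_simps)
    have sq: "a * (C * R powr (?n * (c + ?\<theta>)) * N1 * N2)\<^sup>2 \<le> ((sqrt a + 1) * C * R powr (?n * (c + ?\<theta>)) * N1 * N2)\<^sup>2" for c
    proof -
      have "a \<le> (sqrt a + 1)\<^sup>2" using a by (simp add: power2_sum)
      then have "a * (C * R powr (?n * (c + ?\<theta>)) * N1 * N2)\<^sup>2 \<le> (sqrt a + 1)\<^sup>2 * (C * R powr (?n * (c + ?\<theta>)) * N1 * N2)\<^sup>2"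
        by (intro mult_right_mono) auto
      also have "\<dots> = ((sqrt a + 1) * C * R powr (?n * (c + ?\<theta>)) * N1 * N2)\<^sup>2"
        by (simp add: power_mult_distrib)
      finally show ?thesis .
    qed
    have Rn: "R ^ DIM('v) = R powr ?n" using h(2) by (simp add: powr_realpow)
    have 1: "(\<integral>\<^sup>+x. indicator (cbox 0 One) x * ennreal ((norm (mult_op B (tensor_ft f g) x))\<^sup>2) \<partial>lborel) \<le>
      ennreal (((sqrt a + 1) * C * R powr (?n * (1/2 + ?\<theta>)) * N1 * N2)\<^sup>2)"
    proof -
      have "(\<integral>\<^sup>+x. indicator (cbox 0 One) x * ennreal ((norm (mult_op B (tensor_ft f g) x))\<^sup>2) \<partial>lborel) \<le>
        ennreal (4 ^ DIM('v) * (A0 * C)\<^sup>2) * (ennreal ((2 * pi) ^ DIM('v) * (2 * R) ^ DIM('v)) * (energy R (ft F) * energy R (ft G)))"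
        unfolding B'(3) using fp.mult_op_L2[OF B'(1,2)] unfolding \<Phi> .
      also have "\<dots> \<le> ennreal (4 ^ DIM('v) * (A0 * C)\<^sup>2) * (ennreal ((2 * pi) ^ DIM('v) * (2 * R) ^ DIM('v)) * ennreal P)"
        by (intro mult_left_mono E) auto
      also have "\<dots> = ennreal (a * (C * R powr (?n * (1/2 + ?\<theta>)) * N1 * N2)\<^sup>2)"
      proof -
        have "4 ^ DIM('v) * (A0 * C)\<^sup>2 * ((2 * pi) ^ DIM('v) * (2 * R) ^ DIM('v) * P) = a * (C * R powr (?n * (1/2 + ?\<theta>)) * N1 * N2)\<^sup>2"
        proof -
          have "4 ^ DIM('v) * (A0 * C)\<^sup>2 * ((2 * pi) ^ DIM('v) * (2 * R) ^ DIM('v) * P) =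
              (4 ^ DIM('v) * ((2 * pi) ^ DIM('v) * 2 ^ DIM('v))) * ((A0 * C)\<^sup>2 * R ^ DIM('v) * P)"
            unfolding power_mult_distrib[of 2 R] by (simp only: mult_ac)
          also have "4 ^ DIM('v) * ((2 * pi) ^ DIM('v) * 2 ^ DIM('v)) = (16 * pi) ^ DIM('v)"
            unfolding power_mult_distrib[symmetric] by (rule arg_cong[where f="\<lambda>x. x ^ DIM('v)"]) simp
          also have "R ^ DIM('v) = R powr (2 * ?n * (1/2))" unfolding Rn by simp
          finally show ?thesis
            unfolding a_def P_def power_mult_distrib[of _ "N2"] power_mult_distrib[of _ "N1"] power_mult_distrib[of C] power_mult_distrib[of A0] Rsq
            by (simp only: mult_ac power_mult_distrib)
        qed
        then show ?thesis using h(2) P by (simp add: ennreal_mult[symmetric])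
      qed
      finally show ?thesis using sq[of "1/2"] by (rule order_trans[OF _ ennreal_leI])
    qed
    have 2: "norm (mult_op B (tensor_ft f g) x) \<le> (sqrt a + 1) * C * R powr (?n * (1 + ?\<theta>)) * N1 * N2"
      if "x \<in> cbox 0 One" for x
    proof -
      have "ennreal ((norm (mult_op B (tensor_ft f g) x))\<^sup>2) \<le>
        ennreal ((A0 * C)\<^sup>2 * ((2 * R) ^ DIM('v))\<^sup>2) * (energy R (ft F) * energy R (ft G))"
        unfolding B'(3) using fp.mult_op_sup[OF B'(1,2) that] unfolding \<Phi> .
      also have "\<dots> \<le> ennreal ((A0 * C)\<^sup>2 * ((2 * R) ^ DIM('v))\<^sup>2) * ennreal P"
        by (intro mult_left_mono E) auto
      also have "\<dots> = ennreal ((A0 * C)\<^sup>2 * ((2 * R) ^ DIM('v))\<^sup>2 * P)" using P by (simp add: ennreal_mult[symmetric])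
      finally have "(norm (mult_op B (tensor_ft f g) x))\<^sup>2 \<le> (A0 * C)\<^sup>2 * ((2 * R) ^ DIM('v))\<^sup>2 * P"
        using P by (subst (asm) ennreal_le_iff) auto
      also have "\<dots> \<le> a * (C * R powr (?n * (1 + ?\<theta>)) * N1 * N2)\<^sup>2"
      proof -
        have e: "(R ^ DIM('v))\<^sup>2 = R powr (2 * ?n * 1)" unfolding Rn using h(2) by (simp add: power2_eq_square powr_add[symmetric])
        have "((2::real) ^ DIM('v))\<^sup>2 \<le> (16 * pi) ^ DIM('v)"
          unfolding power_mult[symmetric] mult.commute[of _ 2] unfolding power_mult using pi_ge_two
          by (intro power_mono) auto
        then have "(2 ^ DIM('v))\<^sup>2 * (A0\<^sup>2 * C\<^sup>2 * (R powr (2 * ?n * 1) * P)) \<le> (16 * pi) ^ DIM('v) * (A0\<^sup>2 * C\<^sup>2 * (R powr (2 * ?n * 1) * P))"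
          using P by (intro mult_right_mono) auto
        then show ?thesis unfolding a_def P_def power_mult_distrib Rsq e by (simp add: mult_ac)
      qed
      also note sq[of 1]
      finally show ?thesis
        by (rule power2_le_imp_le) (use a h in auto)
    qed
    show "(\<integral>\<^sup>+x. indicator (cbox 0 One) x * ennreal ((norm (mult_op B (tensor_ft f g) x))\<^sup>2) \<partial>lborel) \<le>
        ennreal (((sqrt a + 1) * C * R powr (?n * (1/2 + ?\<theta>)) * N1 * N2)\<^sup>2) \<and>
      (\<forall>x\<in>cbox 0 One. norm (mult_op B (tensor_ft f g) x) \<le> (sqrt a + 1) * C * R powr (?n * (1 + ?\<theta>)) * N1 * N2)"
      using 1 2 by blast
  qed
qed

text \<open>For \<open>t + s \<le> 1/2\<close> the L2 and sup bounds, with powers 1/2 and 1 of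
  \<open>R ^ n\<close>, interpolate to the power \<open>1 - (t + s)\<close>; otherwise the output
  exponent is at most 2 and the L2 bound on a cube of measure 1 suffices. The cost of the input
  exponents is common to both. Doubling \<open>A\<close> absorbs the factor 2 of the second
  case.\<close>

lemma mult_op_local_Lr:
  assumes ts: "0 \<le> t" "0 \<le> s" "t + s \<le> 1"
  obtains A where "0 < A" "\<And>(B :: 'v::euclidean_space \<times> ('v \<times> 'v) \<Rightarrow> complex) C R f g N1 N2.
    0 < C \<Longrightarrow> 0 < R \<Longrightarrow> bnd unit_slab (5 * DIM('v)) C B \<Longrightarrow> freq_supp R B \<Longrightarrow>
    integrable lborel f \<Longrightarrow> integrable lborel g \<Longrightarrow> 0 < N1 \<Longrightarrow> 0 < N2 \<Longrightarrow> weighted_Lp_le t f N1 \<Longrightarrow> weighted_Lp_le s g N2 \<Longrightarrow>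
    (if t + s = 0 then \<forall>x\<in>cbox 0 One. norm (mult_op B (tensor_ft f g) x) \<le> A * C * R powr (DIM('v) * loss t s) * N1 * N2
     else (\<integral>\<^sup>+x. indicator (cbox 0 One) x * ennreal (norm (mult_op B (tensor_ft f g) x) powr (1 / (t + s))) \<partial>lborel) \<le>
      ennreal ((A * C * R powr (DIM('v) * loss t s) * N1 * N2) powr (1 / (t + s))))"
proof -
  let ?n = "real DIM('v)" and ?\<theta> = "max 0 (t - 1/2) + max 0 (s - 1/2)"
  have ts1: "t \<le> 1" "s \<le> 1" using ts by auto
  obtain A where A: "0 < A" "\<And>(B :: 'v::euclidean_space \<times> ('v \<times> 'v) \<Rightarrow> complex) C R f g N1 N2.
    0 < C \<Longrightarrow> 0 < R \<Longrightarrow> bnd unit_slab (5 * DIM('v)) C B \<Longrightarrow> freq_supp R B \<Longrightarrow>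
    integrable lborel f \<Longrightarrow> integrable lborel g \<Longrightarrow> 0 < N1 \<Longrightarrow> 0 < N2 \<Longrightarrow> weighted_Lp_le t f N1 \<Longrightarrow> weighted_Lp_le s g N2 \<Longrightarrow>
    (\<integral>\<^sup>+x. indicator (cbox 0 One) x * ennreal ((norm (mult_op B (tensor_ft f g) x))\<^sup>2) \<partial>lborel) \<le>
      ennreal ((A * C * R powr (?n * (1/2 + ?\<theta>)) * N1 * N2)\<^sup>2) \<and>
    (\<forall>x\<in>cbox 0 One. norm (mult_op B (tensor_ft f g) x) \<le> A * C * R powr (?n * (1 + ?\<theta>)) * N1 * N2)"
    using mult_op_local_bounds[OF ts(1) ts1(1) ts(2) ts1(2)] by blast
  show ?thesis
  proof (rule that[of "2 * A"])
    show "0 < 2 * A" using A by simp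
    fix B :: "'v \<times> ('v \<times> 'v) \<Rightarrow> complex" and C R and f g :: "'v \<Rightarrow> complex" and N1 N2
    assume h: "0 < C" "0 < R" "bnd unit_slab (5 * DIM('v)) C B" "freq_supp R B"
      "integrable lborel f" "integrable lborel g" "0 < N1" "0 < N2" "weighted_Lp_le t f N1" "weighted_Lp_le s g N2"
    let ?T = "mult_op B (tensor_ft f g)"
    note b = A(2)[OF h]
    define K where "K = A * C * N1 * N2"
    have K: "0 < K" using A h by (simp add: K_def)
    define G where "G c = K * R powr (?n * (c + ?\<theta>))" for c
    have G: "0 < G c" for c using K h by (simp add: G_def)
    have L2: "(\<integral>\<^sup>+x. indicator (cbox 0 One) x * ennreal ((norm (?T x))\<^sup>2) \<partial>lborel) \<le> ennreal ((G (1/2))\<^sup>2)"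
      using b by (simp add: G_def K_def mult_ac)
    have sup: "\<And>x. x \<in> cbox 0 One \<Longrightarrow> norm (?T x) \<le> G 1" using b by (simp add: G_def K_def mult_ac)
    have Tm: "?T \<in> borel_measurable lborel"
      using mult_op_measurable[OF bnd_continuous[OF h(3)] integrable_lborelD[OF h(5)] integrable_lborelD[OF h(6)]] by simp
    have goal: "2 * A * C * R powr (?n * loss t s) * N1 * N2 = 2 * G (max (1/2) (1 - (t + s)))"
      unfolding G_def K_def loss_def by (simp add: mult_ac add.assoc)
    show "if t + s = 0 then \<forall>x\<in>cbox 0 One. norm (?T x) \<le> 2 * A * C * R powr (?n * loss t s) * N1 * N2
     else (\<integral>\<^sup>+x. indicator (cbox 0 One) x * ennreal (norm (?T x) powr (1 / (t + s))) \<partial>lborel) \<le>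
      ennreal ((2 * A * C * R powr (?n * loss t s) * N1 * N2) powr (1 / (t + s)))"
      unfolding goal
    proof (cases "t + s = 0")
      case True
      have "norm (?T x) \<le> 2 * G 1" if "x \<in> cbox 0 One" for x using sup[OF that] G[of 1] by linarith
      then show "if t + s = 0 then \<forall>x\<in>cbox 0 One. norm (?T x) \<le> 2 * G (max (1/2) (1 - (t + s)))
       else (\<integral>\<^sup>+x. indicator (cbox 0 One) x * ennreal (norm (?T x) powr (1 / (t + s))) \<partial>lborel) \<le>
        ennreal ((2 * G (max (1/2) (1 - (t + s)))) powr (1 / (t + s)))"
        using True by simp
    next
      case False
      define u where "u = t + s"
      define r where "r = 1 / u"
      have u: "0 < u" "u \<le> 1" using False ts by (auto simp: u_def)
      have r: "1 \<le> r" "u * r = 1" using u by (auto simp: r_def)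
      have "(\<integral>\<^sup>+x. indicator (cbox 0 One) x * ennreal (norm (?T x) powr r) \<partial>lborel) \<le> ennreal ((2 * G (max (1/2) (1 - u))) powr r)"
      proof (cases "u \<le> 1/2")
        case True
        then have r2: "2 \<le> r" using u by (simp add: r_def field_simps)
        have "(\<integral>\<^sup>+x. indicator (cbox 0 One) x * ennreal (norm (?T x) powr r) \<partial>lborel) \<le> ennreal (G 1 powr (r - 2) * (G (1/2))\<^sup>2)"
          by (rule nn_integral_powr_ge2[OF Tm _ r2 G sup L2]) auto
        also have "G 1 powr (r - 2) * (G (1/2))\<^sup>2 = G (1 - u) powr r"
        proof -
          \<comment> \<open>The interpolated power of \<open>R\<close>: the weights of the two
            bounds are \<open>r - 2\<close> and 2, and \<open>u * r = 1\<close> turns their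
            combination into a multiple of \<open>r\<close>.\<close>
          have "?n * (1 + ?\<theta>) * (r - 2) + ?n * (1/2 + ?\<theta>) * 2 = ?n * (1 - u + ?\<theta>) * r"
          proof -
            have "?n * (1 - u + ?\<theta>) * r = ?n * (1 + ?\<theta>) * r - ?n * (u * r)" by (simp add: algebra_simps)
            then show ?thesis unfolding r(2) by (simp add: algebra_simps)
          qed
          moreover have "G 1 powr (r - 2) = K powr (r - 2) * R powr (?n * (1 + ?\<theta>) * (r - 2))"
            unfolding G_def using K h by (simp add: powr_mult powr_powr)
          moreover have "(G (1/2))\<^sup>2 = K powr 2 * R powr (?n * (1/2 + ?\<theta>) * 2)"
            unfolding powr_numeral[OF G[of "1/2", THEN less_imp_le], symmetric] unfolding G_def using K h by (simp add: powr_mult powr_powr)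
          moreover have "G (1 - u) powr r = K powr r * R powr (?n * (1 - u + ?\<theta>) * r)"
            unfolding G_def using K h by (simp add: powr_mult powr_powr)
          moreover have "K powr (r - 2) * R powr x * (K powr 2 * R powr y) = K powr r * R powr (x + y)" for x y
          proof -
            have "K powr (r - 2) * R powr x * (K powr 2 * R powr y) = (K powr (r - 2) * K powr 2) * (R powr x * R powr y)" by (simp only: mult_ac)
            then show ?thesis unfolding powr_add[symmetric] by simp
          qed
          ultimately show ?thesis by (simp only:)
        qed
        also have "\<dots> \<le> (2 * G (1 - u)) powr r" using G[of "1 - u"] r by (intro powr_mono2) auto
        also have "1 - u = max (1/2) (1 - u)" using True by simp
        finally show ?thesis by (simp add: ennreal_leI)
      next
        case False
        then have r2: "r \<le> 2" using u by (simp add: r_def field_simps)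
        have "(\<integral>\<^sup>+x. indicator (cbox 0 One) x * ennreal (norm (?T x) powr r) \<partial>lborel) \<le> ennreal (2 * G (1/2) powr r)"
          by (rule nn_integral_powr_le2[OF Tm _ r(1) r2 G _ L2]) (auto simp: emeasure_unit_cube simp del: emeasure_lborel_cbox)
        also have "2 * G (1/2) powr r \<le> (2 * G (1/2)) powr r"
        proof -
          have "2 powr 1 \<le> (2::real) powr r" using r by (intro powr_mono) auto
          then show ?thesis using G[of "1/2"] by (simp add: powr_mult mult_right_mono)
        qed
        also have "1/2 = max (1/2) (1 - u)" using False by simp
        finally show ?thesis by (simp add: ennreal_leI)
      qed
      then show "if t + s = 0 then \<forall>x\<in>cbox 0 One. norm (?T x) \<le> 2 * G (max (1/2) (1 - (t + s)))
       else (\<integral>\<^sup>+x. indicator (cbox 0 One) x * ennreal (norm (?T x) powr (1 / (t + s))) \<partial>lborel) \<le>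
        ennreal ((2 * G (max (1/2) (1 - (t + s)))) powr (1 / (t + s)))"
        using False by (simp add: u_def r_def)
    qed
  qed
qed

section \<open>From the unit cube to the whole space by translation\<close>

lemma ft_translate:
  fixes f :: "'v::euclidean_space \<Rightarrow> complex"
  assumes [measurable]: "f \<in> borel_measurable borel"
  shows "ft (\<lambda>y. f (y + j)) \<xi> = ft f \<xi> * cis (j \<bullet> \<xi>)"
proof -
  have "ft (\<lambda>y. f (y + j)) \<xi> = (\<integral>y. f (y + j) * cis (- ((y + j - j) \<bullet> \<xi>)) \<partial>lborel)" by (simp add: ft_def)
  also have "\<dots> = (\<integral>y. f y * cis (- ((y - j) \<bullet> \<xi>)) \<partial>lborel)"
    by (rule integral_translate(1)[of "\<lambda>y. f y * cis (- ((y - j) \<bullet> \<xi>))"]) measurable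
  also have "\<dots> = (\<integral>y. f y * cis (- (y \<bullet> \<xi>)) * cis (j \<bullet> \<xi>) \<partial>lborel)"
  proof (rule Bochner_Integration.integral_cong[OF refl])
    fix y
    have "cis (- ((y - j) \<bullet> \<xi>)) = cis (- (y \<bullet> \<xi>)) * cis (j \<bullet> \<xi>)" by (simp add: cis_mult inner_diff_left)
    then show "f y * cis (- ((y - j) \<bullet> \<xi>)) = f y * cis (- (y \<bullet> \<xi>)) * cis (j \<bullet> \<xi>)" by simp
  qed
  finally show ?thesis by (simp add: ft_def)
qed

text \<open>Translating \<open>x\<close> multiplies the phase by a character of
  \<open>\<xi> + \<eta>\<close>, which splits into one factor for each transform. As the symbol
  bounds hold for all \<open>x\<close>, the local estimate is valid with the same constant on every
  translate of the cube.\<close>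

lemma mult_op_translate:
  fixes B :: "'v::euclidean_space \<times> ('v \<times> 'v) \<Rightarrow> complex"
  assumes "f \<in> borel_measurable borel" "g \<in> borel_measurable borel"
  shows "mult_op B (tensor_ft f g) (x + j) = mult_op (\<lambda>z. B (z + (j, 0))) (tensor_ft (\<lambda>y. f (y + j)) (\<lambda>y. g (y + j))) x"
  unfolding mult_op_def
proof (rule Bochner_Integration.integral_cong[OF refl])
  fix \<zeta> :: "'v \<times> 'v"
  have "cis ((x + j, x + j) \<bullet> \<zeta>) = cis (j \<bullet> fst \<zeta>) * cis (j \<bullet> snd \<zeta>) * cis ((x, x) \<bullet> \<zeta>)"
    by (simp add: cis_mult inner_prod_def inner_add_left algebra_simps)
  then show "B (x + j, \<zeta>) * tensor_ft f g \<zeta> * cis ((x + j, x + j) \<bullet> \<zeta>) =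
     B ((x, \<zeta>) + (j, 0)) * tensor_ft (\<lambda>y. f (y + j)) (\<lambda>y. g (y + j)) \<zeta> * cis ((x, x) \<bullet> \<zeta>)"
    by (simp add: ft_translate[OF assms(1)] ft_translate[OF assms(2)])
qed

lemma bnd_translate:
  assumes "bnd UNIV N C B" "0 \<le> C"
  shows "bnd S N C (\<lambda>z. B (z + c))"
  by (rule bnd_affine[where \<beta>="\<lambda>b. b", OF _ _ assms(2) _ _ assms(1)]) (auto intro!: continuous_intros)

definition Lp_le :: "real \<Rightarrow> ('v::euclidean_space \<Rightarrow> complex) \<Rightarrow> real \<Rightarrow> bool" where
  "Lp_le t f a \<longleftrightarrow> (if t = 0 then AE y in lborel. norm (f y) \<le> a
     else (\<integral>\<^sup>+y. ennreal (norm (f y) powr (1 / t)) \<partial>lborel) \<le> ennreal (a powr (1 / t)))"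

lemma nn_integral_translate:
  fixes f :: "'v::euclidean_space \<Rightarrow> ennreal"
  assumes "f \<in> borel_measurable borel"
  shows "(\<integral>\<^sup>+x. f (x + j) \<partial>lborel) = (\<integral>\<^sup>+x. f x \<partial>lborel)"
  using nn_integral_lborel_affine[OF assms, of 1 j] by (simp add: add.commute)

lemma AE_lborel_translate:
  assumes "AE y in lborel. P y"
  shows "AE y in lborel. P (y + (j::'v::euclidean_space))"
proof -
  have "AE y in distr lborel borel ((+) j). P y" using assms unfolding lborel_distr_plus .
  then have "AE y in lborel. P (j + y)" by (rule AE_distrD[rotated]) simp
  then show ?thesis by (simp add: add.commute)
qed

text \<open>The summand \<open>decay\<close> keeps the local norm positive without spoiling its integral over the translations.\<close>

lemma local_norms:
  fixes f :: "'v::euclidean_space \<Rightarrow> complex"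
  assumes fm [measurable]: "f \<in> borel_measurable borel" and t: "0 \<le> t" and a: "0 < a" and b: "Lp_le t f a"
  obtains N :: "'v \<Rightarrow> real" where "N \<in> borel_measurable borel" "\<And>j. 0 < N j" "\<And>j. weighted_Lp_le t (\<lambda>y. f (y + j)) (N j)"
    "if t = 0 then N = (\<lambda>_. a) else (\<integral>\<^sup>+j. ennreal (N j powr (1 / t)) \<partial>lborel) \<le> ennreal (2 * pi ^ DIM('v) * a powr (1 / t))"
proof (cases "t = 0")
  case True
  show ?thesis
  proof (rule that[of "\<lambda>_. a"])
    show "weighted_Lp_le t (\<lambda>y. f (y + j)) a" for j
      using AE_lborel_translate[of "\<lambda>y. norm (f y) \<le> a" j] b True by (simp add: weighted_Lp_le_def Lp_le_def)
  qed (use a True in auto)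
next
  case False
  define q where "q = 1 / t"
  have q: "0 < q" "t * q = 1" using t False by (auto simp: q_def)
  have b': "(\<integral>\<^sup>+y. ennreal (norm (f y) powr q) \<partial>lborel) \<le> ennreal (a powr q)" using b False by (simp add: Lp_le_def q_def)
  define X where "X j = (\<integral>\<^sup>+y. ennreal (norm (f (y + j)) powr q * decay y) \<partial>lborel)" for j
  have Xm [measurable]: "X \<in> borel_measurable borel" unfolding X_def[abs_def] by measurable
  have Xle: "X j \<le> ennreal (a powr q)" for j
  proof -
    have "X j \<le> (\<integral>\<^sup>+y. ennreal (norm (f (y + j)) powr q) \<partial>lborel)"
      unfolding X_def using decay_pos decay_le_1 by (intro nn_integral_mono ennreal_leI mult_left_le) (auto simp: less_imp_le)
    also have "\<dots> = (\<integral>\<^sup>+y. ennreal (norm (f y) powr q) \<partial>lborel)"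
      by (rule nn_integral_translate[of "\<lambda>y. ennreal (norm (f y) powr q)"]) measurable
    finally show ?thesis using b' by simp
  qed
  then have Xfin: "X j < \<top>" for j using ennreal_less_top le_less_trans by blast
  define Y where "Y j = enn2real (X j) + a powr q * decay j" for j
  have Y0: "0 < Y j" for j unfolding Y_def using a decay_pos[of j] by (intro add_nonneg_pos) auto
  have eY: "ennreal (Y j) = X j + ennreal (a powr q) * ennreal (decay j)" for j
    unfolding Y_def using decay_pos[of j] Xfin[of j] by (simp add: ennreal_mult less_imp_le)
  \<comment> \<open>By Fubini, integrating the local norms over all translations returns the full
    norm times the mass \<open>pi ^ n\<close> of \<open>decay\<close>. The added summand
    \<open>a powr q * decay j\<close> contributes at most as much again, whence the factor
    2.\<close>
  have intX: "(\<integral>\<^sup>+j. X j \<partial>lborel) \<le> ennreal (a powr q) * ennreal (pi ^ DIM('v))"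
  proof -
    have "(\<integral>\<^sup>+j. X j \<partial>lborel) = (\<integral>\<^sup>+y. \<integral>\<^sup>+j. ennreal (norm (f (y + j)) powr q * decay y) \<partial>lborel \<partial>lborel)"
      unfolding X_def by (rule lborel_pair.Fubini') measurable
    also have "\<dots> = (\<integral>\<^sup>+y. (\<integral>\<^sup>+j. ennreal (norm (f j) powr q) \<partial>lborel) * ennreal (decay (y::'v)) \<partial>lborel)"
    proof (rule nn_integral_cong)
      fix y :: 'v
      have "(\<integral>\<^sup>+j. ennreal (norm (f (y + j)) powr q * decay y) \<partial>lborel) = (\<integral>\<^sup>+j. ennreal (norm (f (j + y)) powr q) * ennreal (decay y) \<partial>lborel)"
        using decay_pos[of y] by (simp add: ennreal_mult add.commute less_imp_le)
      also have "\<dots> = (\<integral>\<^sup>+j. ennreal (norm (f (j + y)) powr q) \<partial>lborel) * ennreal (decay y)"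
        by (rule nn_integral_multc) measurable
      also have "(\<integral>\<^sup>+j. ennreal (norm (f (j + y)) powr q) \<partial>lborel) = (\<integral>\<^sup>+j. ennreal (norm (f j) powr q) \<partial>lborel)"
        by (rule nn_integral_translate[of "\<lambda>y. ennreal (norm (f y) powr q)"]) measurable
      finally show "(\<integral>\<^sup>+j. ennreal (norm (f (y + j)) powr q * decay y) \<partial>lborel) = (\<integral>\<^sup>+j. ennreal (norm (f j) powr q) \<partial>lborel) * ennreal (decay y)" .
    qed
    also have "\<dots> = (\<integral>\<^sup>+j. ennreal (norm (f j) powr q) \<partial>lborel) * ennreal (pi ^ DIM('v))"
      by (simp add: nn_integral_cmult nn_integral_decay)
    also have "\<dots> \<le> ennreal (a powr q) * ennreal (pi ^ DIM('v))" by (intro mult_right_mono b') auto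
    finally show ?thesis .
  qed
  have YN: "(Y j powr t) powr q = Y j" for j using q Y0[of j] by (simp add: powr_powr)
  show ?thesis
  proof (rule that[of "\<lambda>j. Y j powr t"])
    show "(\<lambda>j. Y j powr t) \<in> borel_measurable borel" unfolding Y_def by measurable
    show "0 < Y j powr t" for j using Y0[of j] by simp
    show "weighted_Lp_le t (\<lambda>y. f (y + j)) (Y j powr t)" for j
      using YN[of j] eY[of j] False by (simp add: weighted_Lp_le_def q_def[symmetric] X_def[symmetric])
    have "(\<integral>\<^sup>+j. ennreal (Y j) \<partial>lborel) = (\<integral>\<^sup>+j. X j \<partial>lborel) + ennreal (a powr q) * ennreal (pi ^ DIM('v))"
      unfolding eY by (simp add: nn_integral_add nn_integral_cmult nn_integral_decay)
    also have "\<dots> \<le> ennreal (a powr q) * ennreal (pi ^ DIM('v)) + ennreal (a powr q) * ennreal (pi ^ DIM('v))"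
      by (intro add_right_mono intX)
    also have "\<dots> = ennreal (2 * pi ^ DIM('v) * a powr q)"
      by (simp add: ennreal_mult[symmetric] ennreal_plus[symmetric] del: ennreal_plus)
    finally show "if t = 0 then (\<lambda>j. Y j powr t) = (\<lambda>_. a)
        else (\<integral>\<^sup>+j. ennreal ((Y j powr t) powr (1 / t)) \<partial>lborel) \<le> ennreal (2 * pi ^ DIM('v) * a powr (1 / t))"
      using False YN by (simp add: q_def[symmetric])
  qed
qed

text \<open>Hoelder's inequality in the translation parameter, obtained from Young's inequality with
  weights \<open>t * r\<close> and \<open>s * r\<close>, of sum 1, after normalising by
  \<open>a\<close> and \<open>b\<close>. The weights are bounded by 1, which accounts for
  \<open>2 * K\<close>. If one exponent is infinite, its local norm is constant and factors
  out.\<close>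

lemma nn_integral_product_norms:
  fixes N1 N2 :: "'v::euclidean_space \<Rightarrow> real"
  assumes ts: "0 \<le> t" "0 \<le> s" "0 < t + s" and ab: "0 < a" "0 < b" and K: "1 \<le> K"
    and [measurable]: "N1 \<in> borel_measurable borel" "N2 \<in> borel_measurable borel"
    and pos: "\<And>j. 0 < N1 j" "\<And>j. 0 < N2 j"
    and h1: "if t = 0 then N1 = (\<lambda>_. a) else (\<integral>\<^sup>+j. ennreal (N1 j powr (1 / t)) \<partial>lborel) \<le> ennreal (K * a powr (1 / t))"
    and h2: "if s = 0 then N2 = (\<lambda>_. b) else (\<integral>\<^sup>+j. ennreal (N2 j powr (1 / s)) \<partial>lborel) \<le> ennreal (K * b powr (1 / s))"
  shows "(\<integral>\<^sup>+j. ennreal ((N1 j * N2 j) powr (1 / (t + s))) \<partial>lborel) \<le> ennreal (2 * K * (a * b) powr (1 / (t + s)))"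
proof -
  define r where "r = 1 / (t + s)"
  have K2: "ennreal (K * (a * b) powr r) \<le> ennreal (2 * K * (a * b) powr r)"
    using K by (intro ennreal_leI mult_right_mono) auto
  consider "t = 0" "0 < s" | "s = 0" "0 < t" | "0 < t" "0 < s" using ts by fastforce
  then have "(\<integral>\<^sup>+j. ennreal ((N1 j * N2 j) powr r) \<partial>lborel) \<le> ennreal (2 * K * (a * b) powr r)"
  proof cases
    case 1
    have "(\<integral>\<^sup>+j. ennreal ((N1 j * N2 j) powr r) \<partial>lborel) = (\<integral>\<^sup>+j. ennreal (a powr r) * ennreal (N2 j powr r) \<partial>lborel)"
      using 1 h1 ab pos by (simp add: powr_mult ennreal_mult less_imp_le)
    also have "\<dots> = ennreal (a powr r) * (\<integral>\<^sup>+j. ennreal (N2 j powr r) \<partial>lborel)" by (simp add: nn_integral_cmult)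
    also have "\<dots> \<le> ennreal (a powr r) * ennreal (K * b powr r)"
      using 1 h2 by (intro mult_left_mono) (auto simp: r_def)
    also have "\<dots> = ennreal (K * (a * b) powr r)" using ab K by (simp add: ennreal_mult[symmetric] powr_mult mult_ac)
    finally show ?thesis using K2 by (rule order_trans)
  next
    case 2
    have "(\<integral>\<^sup>+j. ennreal ((N1 j * N2 j) powr r) \<partial>lborel) = (\<integral>\<^sup>+j. ennreal (b powr r) * ennreal (N1 j powr r) \<partial>lborel)"
      using 2 h2 ab pos by (simp add: powr_mult ennreal_mult less_imp_le mult.commute)
    also have "\<dots> = ennreal (b powr r) * (\<integral>\<^sup>+j. ennreal (N1 j powr r) \<partial>lborel)" by (simp add: nn_integral_cmult)
    also have "\<dots> \<le> ennreal (b powr r) * ennreal (K * a powr r)"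
      using 2 h1 by (intro mult_left_mono) (auto simp: r_def)
    also have "\<dots> = ennreal (K * (a * b) powr r)" using ab K by (simp add: ennreal_mult[symmetric] powr_mult mult_ac)
    finally show ?thesis using K2 by (rule order_trans)
  next
    case 3
    have i1: "(\<integral>\<^sup>+j. ennreal (N1 j powr (1 / t)) \<partial>lborel) \<le> ennreal (K * a powr (1 / t))"
      and i2: "(\<integral>\<^sup>+j. ennreal (N2 j powr (1 / s)) \<partial>lborel) \<le> ennreal (K * b powr (1 / s))"
      using 3 h1 h2 by auto
    have "(\<integral>\<^sup>+j. ennreal ((N1 j * N2 j) powr r) \<partial>lborel) \<le>
      (\<integral>\<^sup>+j. ennreal ((a * b) powr r / a powr (1 / t)) * ennreal (N1 j powr (1 / t)) + ennreal ((a * b) powr r / b powr (1 / s)) * ennreal (N2 j powr (1 / s)) \<partial>lborel)"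
    proof (intro nn_integral_mono)
      fix j
      define x where "x = (N1 j / a) powr (1 / t)"
      define y where "y = (N2 j / b) powr (1 / s)"
      have xy: "0 < x" "0 < y" using pos[of j] ab by (auto simp: x_def y_def)
      have rt: "0 \<le> t * r" "0 \<le> s * r" "t * r + s * r = 1" "t * r \<le> 1" "s * r \<le> 1"
        using 3 by (auto simp: r_def distrib_right[symmetric] add_divide_distrib[symmetric])
      have "x powr (t * r) * y powr (s * r) \<le> (t * r) * x + (s * r) * y"
        by (rule Youngs_inequality_0) (use rt xy in auto)
      also have "\<dots> \<le> 1 * x + 1 * y" using rt xy by (intro add_mono mult_right_mono) auto
      also have "x powr (t * r) = (N1 j / a) powr r" using 3 by (simp add: x_def powr_powr)
      also have "y powr (s * r) = (N2 j / b) powr r" using 3 by (simp add: y_def powr_powr)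
      also have "(N1 j / a) powr r * (N2 j / b) powr r = (N1 j * N2 j) powr r / (a * b) powr r"
        using pos[of j] ab by (simp add: powr_divide powr_mult)
      finally have "(N1 j * N2 j) powr r \<le> (a * b) powr r * (x + y)"
        using ab by (simp add: divide_le_eq mult.commute)
      also have "\<dots> = (a * b) powr r / a powr (1 / t) * N1 j powr (1 / t) + (a * b) powr r / b powr (1 / s) * N2 j powr (1 / s)"
        unfolding x_def y_def using pos[of j] ab by (simp add: powr_divide distrib_left)
      finally show "ennreal ((N1 j * N2 j) powr r) \<le> ennreal ((a * b) powr r / a powr (1 / t)) * ennreal (N1 j powr (1 / t)) + ennreal ((a * b) powr r / b powr (1 / s)) * ennreal (N2 j powr (1 / s))"
        by (simp add: ennreal_mult[symmetric] ennreal_plus[symmetric] ennreal_leI del: ennreal_plus)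
    qed
    also have "\<dots> = ennreal ((a * b) powr r / a powr (1 / t)) * (\<integral>\<^sup>+j. ennreal (N1 j powr (1 / t)) \<partial>lborel) + ennreal ((a * b) powr r / b powr (1 / s)) * (\<integral>\<^sup>+j. ennreal (N2 j powr (1 / s)) \<partial>lborel)"
      by (simp add: nn_integral_add nn_integral_cmult)
    also have "\<dots> \<le> ennreal ((a * b) powr r / a powr (1 / t)) * ennreal (K * a powr (1 / t)) + ennreal ((a * b) powr r / b powr (1 / s)) * ennreal (K * b powr (1 / s))"
      by (intro add_mono mult_left_mono i1 i2) auto
    also have "\<dots> = ennreal (2 * K * (a * b) powr r)"
      using ab K by (simp add: ennreal_mult[symmetric] ennreal_plus[symmetric] del: ennreal_plus)
    finally show ?thesis .
  qed
  then show ?thesis by (simp add: r_def)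
qed

text \<open>As the cube has measure 1, averaging over all its translates, with a continuous
  parameter instead of a lattice, reproduces the global integral exactly. Each translate is bounded
  by the product of two local norms, and Hoelder's inequality in the translation recombines
  these.\<close>

theorem mult_op_single_scale:
  assumes ts: "0 \<le> t" "0 \<le> s" "t + s \<le> 1"
  obtains A where "0 < A" "\<And>(B :: 'v::euclidean_space \<times> ('v \<times> 'v) \<Rightarrow> complex) C R f g a b.
    0 < C \<Longrightarrow> 0 < R \<Longrightarrow> bnd UNIV (5 * DIM('v)) C B \<Longrightarrow> freq_supp R B \<Longrightarrow>
    integrable lborel f \<Longrightarrow> integrable lborel g \<Longrightarrow> 0 < a \<Longrightarrow> 0 < b \<Longrightarrow> Lp_le t f a \<Longrightarrow> Lp_le s g b \<Longrightarrow>
    Lp_le (t + s) (mult_op B (tensor_ft f g)) (A * C * R powr (DIM('v) * loss t s) * a * b)"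
proof -
  let ?n = "real DIM('v)"
  obtain A where A: "0 < A" "\<And>(B :: 'v::euclidean_space \<times> ('v \<times> 'v) \<Rightarrow> complex) C R f g N1 N2.
    0 < C \<Longrightarrow> 0 < R \<Longrightarrow> bnd unit_slab (5 * DIM('v)) C B \<Longrightarrow> freq_supp R B \<Longrightarrow>
    integrable lborel f \<Longrightarrow> integrable lborel g \<Longrightarrow> 0 < N1 \<Longrightarrow> 0 < N2 \<Longrightarrow> weighted_Lp_le t f N1 \<Longrightarrow> weighted_Lp_le s g N2 \<Longrightarrow>
    (if t + s = 0 then \<forall>x\<in>cbox 0 One. norm (mult_op B (tensor_ft f g) x) \<le> A * C * R powr (?n * loss t s) * N1 * N2
     else (\<integral>\<^sup>+x. indicator (cbox 0 One) x * ennreal (norm (mult_op B (tensor_ft f g) x) powr (1 / (t + s))) \<partial>lborel) \<le>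
      ennreal ((A * C * R powr (?n * loss t s) * N1 * N2) powr (1 / (t + s))))"
    using mult_op_local_Lr[OF ts] by blast
  define K where "K = 2 * pi ^ DIM('v)"
  have K: "1 \<le> K"
  proof -
    have "1 \<le> pi ^ DIM('v)" using pi_ge_two by (intro one_le_power) auto
    then show ?thesis by (simp add: K_def)
  qed
  show ?thesis
  proof (rule that[of "A * (2 * K)"])
    show "0 < A * (2 * K)" using A K by simp
    fix B :: "'v \<times> ('v \<times> 'v) \<Rightarrow> complex" and C R and f g :: "'v \<Rightarrow> complex" and a b
    assume h: "0 < C" "0 < R" "bnd UNIV (5 * DIM('v)) C B" "freq_supp R B"
      "integrable lborel f" "integrable lborel g" "0 < a" "0 < b" "Lp_le t f a" "Lp_le s g b"
    note [measurable] = integrable_lborelD[OF h(5)] integrable_lborelD[OF h(6)]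
    define T where "T = mult_op B (tensor_ft f g)"
    have Tm [measurable]: "T \<in> borel_measurable borel"
      unfolding T_def by (rule mult_op_measurable[OF bnd_continuous[OF h(3)]]) measurable
    let ?f = "\<lambda>j y. f (y + j)" and ?g = "\<lambda>j y. g (y + j)" and ?B = "\<lambda>j z. B (z + (j, 0))"
    obtain N1 where N1: "N1 \<in> borel_measurable borel" "\<And>j. 0 < N1 j" "\<And>j. weighted_Lp_le t (?f j) (N1 j)"
      "if t = 0 then N1 = (\<lambda>_. a) else (\<integral>\<^sup>+j. ennreal (N1 j powr (1 / t)) \<partial>lborel) \<le> ennreal (K * a powr (1 / t))"
      unfolding K_def using local_norms[OF _ ts(1) h(7,9)] by auto
    obtain N2 where N2: "N2 \<in> borel_measurable borel" "\<And>j. 0 < N2 j" "\<And>j. weighted_Lp_le s (?g j) (N2 j)"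
      "if s = 0 then N2 = (\<lambda>_. b) else (\<integral>\<^sup>+j. ennreal (N2 j powr (1 / s)) \<partial>lborel) \<le> ennreal (K * b powr (1 / s))"
      unfolding K_def using local_norms[OF _ ts(2) h(8,10)] by auto
    define c where "c = A * C * R powr (?n * loss t s)"
    have c: "0 < c" using A h by (simp add: c_def)
    have tr: "T (x + j) = mult_op (?B j) (tensor_ft (?f j) (?g j)) x" for x j
      unfolding T_def by (rule mult_op_translate) measurable
    have loc: "if t + s = 0 then \<forall>x\<in>cbox 0 One. norm (T (x + j)) \<le> c * (N1 j * N2 j)
     else (\<integral>\<^sup>+x. indicator (cbox 0 One) x * ennreal (norm (T (x + j)) powr (1 / (t + s))) \<partial>lborel) \<le>
      ennreal ((c * (N1 j * N2 j)) powr (1 / (t + s)))" for j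
    proof -
      have h1: "bnd unit_slab (5 * DIM('v)) C (?B j)" using h by (intro bnd_translate) auto
      have h2: "freq_supp R (?B j)" using h(4) by (auto simp: freq_supp_def)
      have h3: "integrable lborel (?f j)" "integrable lborel (?g j)"
        using h integral_translate(2)[of f j] integral_translate(2)[of g j] by auto
      have e: "A * C * R powr (?n * loss t s) * N1 j * N2 j = c * (N1 j * N2 j)" by (simp add: c_def)
      show ?thesis
        using A(2)[OF h(1,2) h1 h2 h3 N1(2) N2(2) N1(3) N2(3)] unfolding tr e .
    qed
    have goal: "A * (2 * K) * C * R powr (?n * loss t s) * a * b = 2 * K * (c * (a * b))" by (simp add: c_def mult_ac)
    have pos: "0 < c * (a * b)" using c h by simp
    show "Lp_le (t + s) (mult_op B (tensor_ft f g)) (A * (2 * K) * C * R powr (?n * loss t s) * a * b)"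
      unfolding goal T_def[symmetric]
    proof (cases "t + s = 0")
      case True
      then have z: "t = 0" "s = 0" using ts by auto
      have "norm (T x) \<le> 2 * K * (c * (a * b))" for x
      proof -
        have "(0::'v) \<in> cbox 0 One" by (simp add: mem_box)
        then have "norm (T (0 + x)) \<le> c * (N1 x * N2 x)" using loc[of x] unfolding if_P[OF True] by blast
        also have "\<dots> = 1 * (c * (a * b))" using N1(4) N2(4) z by simp
        also have "\<dots> \<le> 2 * K * (c * (a * b))" using K pos by (intro mult_right_mono) auto
        finally show ?thesis by simp
      qed
      then show "Lp_le (t + s) T (2 * K * (c * (a * b)))" using True by (simp add: Lp_le_def)
    next
      case False
      define r where "r = 1 / (t + s)"
      have u: "0 < t + s" using False ts by simp
      have r: "1 \<le> r" using u ts by (simp add: r_def)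
      have [measurable]: "N1 \<in> borel_measurable borel" "N2 \<in> borel_measurable borel" using N1 N2 by auto
      have "(\<integral>\<^sup>+x. ennreal (norm (T x) powr r) \<partial>lborel) = (\<integral>\<^sup>+x. indicator (cbox 0 One) (x::'v) * (\<integral>\<^sup>+x. ennreal (norm (T x) powr r) \<partial>lborel) \<partial>lborel)"
        by (simp add: nn_integral_multc emeasure_unit_cube del: emeasure_lborel_cbox)
      also have "\<dots> = (\<integral>\<^sup>+x. \<integral>\<^sup>+j. indicator (cbox 0 One) x * ennreal (norm (T (x + j)) powr r) \<partial>lborel \<partial>lborel)"
      proof (rule nn_integral_cong)
        fix x :: 'v
        have "(\<integral>\<^sup>+j. ennreal (norm (T (x + j)) powr r) \<partial>lborel) = (\<integral>\<^sup>+j. ennreal (norm (T j) powr r) \<partial>lborel)"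
          using nn_integral_translate[of "\<lambda>y. ennreal (norm (T y) powr r)" x] by (simp add: add.commute)
        then show "indicator (cbox 0 One) x * (\<integral>\<^sup>+x. ennreal (norm (T x) powr r) \<partial>lborel) = (\<integral>\<^sup>+j. indicator (cbox 0 One) x * ennreal (norm (T (x + j)) powr r) \<partial>lborel)"
          by (simp add: nn_integral_cmult)
      qed
      also have "\<dots> = (\<integral>\<^sup>+j. \<integral>\<^sup>+x. indicator (cbox 0 One) x * ennreal (norm (T (x + j)) powr r) \<partial>lborel \<partial>lborel)"
        by (rule lborel_pair.Fubini'[symmetric]) measurable
      also have "\<dots> \<le> (\<integral>\<^sup>+j. ennreal (c powr r) * ennreal ((N1 j * N2 j) powr r) \<partial>lborel)"
      proof (rule nn_integral_mono)
        fix j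
        have "(\<integral>\<^sup>+x. indicator (cbox 0 One) x * ennreal (norm (T (x + j)) powr r) \<partial>lborel) \<le> ennreal ((c * (N1 j * N2 j)) powr r)"
          using loc[of j] False by (simp add: r_def)
        also have "(c * (N1 j * N2 j)) powr r = c powr r * (N1 j * N2 j) powr r"
          by (rule powr_mult)
        finally show "(\<integral>\<^sup>+x. indicator (cbox 0 One) x * ennreal (norm (T (x + j)) powr r) \<partial>lborel) \<le> ennreal (c powr r) * ennreal ((N1 j * N2 j) powr r)"
          by (simp add: ennreal_mult)
      qed
      also have "\<dots> = ennreal (c powr r) * (\<integral>\<^sup>+j. ennreal ((N1 j * N2 j) powr r) \<partial>lborel)"
        by (rule nn_integral_cmult) measurable
      also have "\<dots> \<le> ennreal (c powr r) * ennreal (2 * K * (a * b) powr r)"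
        unfolding r_def by (intro mult_left_mono nn_integral_product_norms ts u h K N1 N2 zero_le)
      also have "\<dots> = ennreal (2 * K * (c * (a * b)) powr r)"
        using c h K by (simp add: ennreal_mult[symmetric] powr_mult mult_ac)
      also have "\<dots> \<le> ennreal ((2 * K * (c * (a * b))) powr r)"
      proof (rule ennreal_leI)
        have "(2 * K) powr 1 \<le> (2 * K) powr r" using r K by (intro powr_mono) auto
        then show "2 * K * (c * (a * b)) powr r \<le> (2 * K * (c * (a * b))) powr r"
          using K pos by (simp add: powr_mult mult_right_mono)
      qed
      finally show "Lp_le (t + s) T (2 * K * (c * (a * b)))" using False by (simp add: Lp_le_def r_def)
    qed
  qed
qed

section \<open>Dyadic pieces of the symbol\<close>

text \<open>The two blocks are dilated inversely, so that the phase
  \<open>(x, x) \<bullet> \<zeta>\<close> is unchanged when the evaluation point is dilated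
  along.\<close>

definition scale_symbol :: "real \<Rightarrow> 'v::euclidean_space \<times> 'w::euclidean_space \<Rightarrow> 'v \<times> 'w" where
  "scale_symbol l z = ((1 / l) *\<^sub>R fst z, l *\<^sub>R snd z)"

definition scale_factor :: "real \<Rightarrow> 'v::euclidean_space \<times> 'w::euclidean_space \<Rightarrow> real" where
  "scale_factor l v = (if fst v \<noteq> 0 then 1 / l else l)"

lemma scale_symbol_shift:
  assumes "b \<in> Basis"
  shows "scale_symbol l (z + t *\<^sub>R b) = scale_symbol l z + (t * scale_factor l b) *\<^sub>R b"
  using assms by (auto simp: scale_symbol_def scale_factor_def Basis_prod_def algebra_simps)

lemma abs_prod_list: "\<bar>prod_list (map f xs)\<bar> = (\<Prod>x\<leftarrow>xs. \<bar>f x\<bar> :: real)"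
  by (induction xs) (auto simp: abs_mult)

text \<open>\<open>vs\<close> accumulates the derivatives already taken, together with their chain
  rule factors. The hypothesis speaks about all extensions \<open>ws @ vs\<close> of length at most
  \<open>N\<close> beyond \<open>vs\<close>, which is what the induction reduces to when a further
  derivative is put in front.\<close>

lemma bnd_iter_dderiv_scaled:
  fixes A :: "'v::euclidean_space \<times> 'w::euclidean_space \<Rightarrow> complex"
  assumes A: "smooth_fun A"
  shows "set vs \<subseteq> Basis \<Longrightarrow>
    (\<And>ws z. set ws \<subseteq> Basis \<Longrightarrow> length ws \<le> N \<Longrightarrow> z \<in> S \<Longrightarrow>
      (\<Prod>v\<leftarrow>ws @ vs. \<bar>scale_factor l v\<bar>) * norm (iter_dderiv (ws @ vs) A (scale_symbol l z)) \<le> C) \<Longrightarrow>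
    bnd S N C (\<lambda>z. complex_of_real (\<Prod>v\<leftarrow>vs. scale_factor l v) * iter_dderiv vs A (scale_symbol l z))"
proof (induction N arbitrary: vs)
  case (0 vs)
  have "continuous_on UNIV (iter_dderiv vs A)"
    using A 0(1) unfolding smooth_fun_def
    by (intro continuous_at_imp_continuous_on ballI differentiable_imp_continuous_within) auto
  then have "continuous_on UNIV (\<lambda>z. iter_dderiv vs A (scale_symbol l z))"
    by (rule continuous_on_compose2) (auto simp: scale_symbol_def[abs_def] intro!: continuous_intros)
  then show ?case using 0(2)[of "[]"]
    by (auto simp: norm_mult abs_prod_list o_def intro!: continuous_intros)
next
  case (Suc N vs)
  have d: "iter_dderiv vs A differentiable (at y)" for y
    using A Suc.prems(1) unfolding smooth_fun_def by blast
  then have "continuous_on UNIV (iter_dderiv vs A)"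
    by (intro continuous_at_imp_continuous_on ballI differentiable_imp_continuous_within) auto
  then have c: "continuous_on UNIV (\<lambda>z. iter_dderiv vs A (scale_symbol l z))"
    by (rule continuous_on_compose2) (auto simp: scale_symbol_def[abs_def] intro!: continuous_intros)
  show ?case
  proof (rule bnd_SucI[where D="\<lambda>b z. complex_of_real (\<Prod>v\<leftarrow>b # vs. scale_factor l v) * iter_dderiv (b # vs) A (scale_symbol l z)"])
    show "continuous_on UNIV (\<lambda>z. complex_of_real (\<Prod>v\<leftarrow>vs. scale_factor l v) * iter_dderiv vs A (scale_symbol l z))"
      by (intro continuous_intros c)
    show "norm (complex_of_real (\<Prod>v\<leftarrow>vs. scale_factor l v) * iter_dderiv vs A (scale_symbol l z)) \<le> C" if "z \<in> S" for z
      using Suc.prems(2)[of "[]" z] that by (simp add: norm_mult abs_prod_list o_def)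
    fix b :: "'v \<times> 'w" assume b: "b \<in> Basis"
    show "bnd S N C (\<lambda>z. complex_of_real (\<Prod>v\<leftarrow>b # vs. scale_factor l v) * iter_dderiv (b # vs) A (scale_symbol l z))"
    proof (rule Suc.IH)
      show "set (b # vs) \<subseteq> Basis" using b Suc.prems(1) by simp
      show "(\<Prod>v\<leftarrow>ws @ b # vs. \<bar>scale_factor l v\<bar>) * norm (iter_dderiv (ws @ b # vs) A (scale_symbol l z)) \<le> C"
        if "set ws \<subseteq> Basis" "length ws \<le> N" "z \<in> S" for ws z
        using Suc.prems(2)[of "ws @ [b]" z] that b by simp
    qed
    fix z :: "'v \<times> 'w"
    define y where "y = scale_symbol l z"
    have "(\<lambda>t. iter_dderiv vs A (y + t *\<^sub>R b)) differentiable (at 0)"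
      using differentiable_chain_at[of "\<lambda>t. y + t *\<^sub>R b" 0 "iter_dderiv vs A"] d[of "y + 0 *\<^sub>R b"]
      by (auto simp: o_def)
    then have v: "((\<lambda>t. iter_dderiv vs A (y + t *\<^sub>R b)) has_vector_derivative iter_dderiv (b # vs) A y) (at 0)"
      unfolding iter_dderiv.simps by (rule vector_derivative_works[THEN iffD1])
    have "((\<lambda>t. t * scale_factor l b) has_vector_derivative scale_factor l b) (at 0)"
      unfolding has_real_derivative_iff_has_vector_derivative[symmetric] by (auto intro!: derivative_eq_intros)
    from vector_diff_chain_at[OF this, of "\<lambda>t. iter_dderiv vs A (y + t *\<^sub>R b)" "iter_dderiv (b # vs) A y"] v
    have "((\<lambda>t. iter_dderiv vs A (scale_symbol l (z + t *\<^sub>R b))) has_vector_derivative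
       scale_factor l b *\<^sub>R iter_dderiv (b # vs) A y) (at 0)"
      by (simp add: o_def scale_symbol_shift[OF b] y_def)
    from has_vector_derivative_mult_right[OF this, of "complex_of_real (\<Prod>v\<leftarrow>vs. scale_factor l v)"]
    show "((\<lambda>t. complex_of_real (\<Prod>v\<leftarrow>vs. scale_factor l v) * iter_dderiv vs A (scale_symbol l (z + t *\<^sub>R b)))
       has_vector_derivative complex_of_real (\<Prod>v\<leftarrow>b # vs. scale_factor l v) * iter_dderiv (b # vs) A (scale_symbol l z)) (at 0)"
      by (simp add: scaleR_conv_of_real y_def mult_ac)
  qed
qed

section \<open>Symbol bounds on frequency shells\<close>

definition bracket :: "'w::euclidean_space \<Rightarrow> real" where
  "bracket \<zeta> = 1 + (norm \<zeta>)\<^sup>2"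

lemma bracket_ge_1: "1 \<le> bracket \<zeta>" by (simp add: bracket_def)

lemma powr_comparable:
  fixes x y e K :: real
  assumes "0 < y" "y / 4 \<le> x" "x \<le> 4 * y" "\<bar>e\<bar> \<le> K"
  shows "x powr e \<le> 4 powr K * y powr e"
proof (cases "0 \<le> e")
  case True
  have "x powr e \<le> (4 * y) powr e" using assms True by (intro powr_mono2) auto
  also have "\<dots> = 4 powr e * y powr e" using assms by (simp add: powr_mult)
  also have "\<dots> \<le> 4 powr K * y powr e" using assms True by (intro mult_right_mono powr_mono) auto
  finally show ?thesis .
next
  case False
  have "x powr e \<le> (y / 4) powr e" using assms False by (intro powr_mono2') auto
  also have "\<dots> = 4 powr (- e) * y powr e" using assms by (simp add: powr_divide powr_minus_divide)
  also have "\<dots> \<le> 4 powr K * y powr e" using assms False by (intro mult_right_mono powr_mono) auto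
  finally show ?thesis .
qed

text \<open>The symbol class offers one constant for each list of directions; there are finitely
  many lists of length at most \<open>N\<close>, and the sum of their constants serves all. A
  frequency direction lies in exactly one of the two blocks, so the two frequency orders add up to
  the number of \<open>v\<close> with \<open>fst v = 0\<close>. Exponents are halved because
  \<open>bracket\<close> is the square of the usual Japanese bracket.\<close>

lemma bisymbol_uniform:
  fixes a :: "real^'n \<Rightarrow> real^'n \<Rightarrow> real^'n \<Rightarrow> complex"
  assumes "bisymbol m \<rho> \<delta> a"
  obtains C where "0 < C" "\<And>vs z. set vs \<subseteq> Basis \<Longrightarrow> length vs \<le> N \<Longrightarrow>
    norm (iter_dderiv vs (\<lambda>(x, \<xi>, \<eta>). a x \<xi> \<eta>) z) \<le> C * bracket (snd z) powr
      ((m - \<rho> * real (length (filter (\<lambda>v. fst v = 0) vs)) + \<delta> * real (length (filter (\<lambda>v. fst v \<noteq> 0) vs))) / 2)"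
proof -
  let ?A = "\<lambda>(x, \<xi>, \<eta>). a x \<xi> \<eta>"
  let ?e = "\<lambda>vs :: ((real^'n) \<times> (real^'n) \<times> (real^'n)) list. (m - \<rho> * real (length (filter (\<lambda>v. fst v = 0) vs)) + \<delta> * real (length (filter (\<lambda>v. fst v \<noteq> 0) vs))) / 2"
  have br: "1 + (norm \<xi>)\<^sup>2 + (norm \<eta>)\<^sup>2 = bracket (\<xi>, \<eta>)" for \<xi> \<eta> :: "real^'n"
    by (simp add: bracket_def norm_Pair)
  have len: "length (filter (\<lambda>v. fst (snd v) \<noteq> 0) vs) + length (filter (\<lambda>v. snd (snd v) \<noteq> 0) vs) = length (filter (\<lambda>v. fst v = 0) vs)"
    if "set vs \<subseteq> Basis" for vs :: "((real^'n) \<times> (real^'n) \<times> (real^'n)) list"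
    using that by (induction vs) (auto simp: Basis_prod_def)
  have "\<exists>C. \<forall>z. norm (iter_dderiv vs ?A z) \<le> C * bracket (snd z) powr ?e vs" if vsB: "set vs \<subseteq> Basis" for vs
  proof -
    have "\<exists>C. \<forall>x \<xi> \<eta>. norm (iter_dderiv vs ?A (x, \<xi>, \<eta>)) \<le> C * (1 + (norm \<xi>)\<^sup>2 + (norm \<eta>)\<^sup>2) powr
      ((m - \<rho> * real (length (filter (\<lambda>v. fst (snd v) \<noteq> 0) vs) + length (filter (\<lambda>v. snd (snd v) \<noteq> 0) vs)) +
        \<delta> * real (length (filter (\<lambda>v. fst v \<noteq> 0) vs))) / 2)"
      using assms vsB unfolding bisymbol_def Let_def by blast
    then obtain C where C: "\<And>x \<xi> \<eta>. norm (iter_dderiv vs ?A (x, \<xi>, \<eta>)) \<le> C * bracket (\<xi>, \<eta>) powr ?e vs"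
      unfolding len[OF vsB] br by blast
    have "norm (iter_dderiv vs ?A z) \<le> C * bracket (snd z) powr ?e vs" for z
      using C[of "fst z" "fst (snd z)" "snd (snd z)"] by (simp only: prod.collapse)
    then show ?thesis by blast
  qed
  then obtain c where c: "\<And>vs z. set vs \<subseteq> Basis \<Longrightarrow> norm (iter_dderiv vs ?A z) \<le> c vs * bracket (snd z) powr ?e vs"
    by metis
  let ?L = "{vs :: ((real^'n) \<times> (real^'n) \<times> (real^'n)) list. set vs \<subseteq> Basis \<and> length vs \<le> N}"
  have fin: "finite ?L" by (rule finite_lists_length_le) simp
  show ?thesis
  proof (rule that[of "1 + (\<Sum>vs\<in>?L. \<bar>c vs\<bar>)"])
    show "0 < 1 + (\<Sum>vs\<in>?L. \<bar>c vs\<bar>)" by (intro add_pos_nonneg sum_nonneg) auto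
    show "norm (iter_dderiv vs ?A z) \<le> (1 + (\<Sum>vs\<in>?L. \<bar>c vs\<bar>)) * bracket (snd z) powr ?e vs"
      if "set vs \<subseteq> Basis" "length vs \<le> N" for vs z
    proof -
      have "\<bar>c vs\<bar> \<le> (\<Sum>vs\<in>?L. \<bar>c vs\<bar>)" using fin that by (intro member_le_sum) auto
      then have "c vs \<le> 1 + (\<Sum>vs\<in>?L. \<bar>c vs\<bar>)" by linarith
      then have "c vs * bracket (snd z) powr ?e vs \<le> (1 + (\<Sum>vs\<in>?L. \<bar>c vs\<bar>)) * bracket (snd z) powr ?e vs"
        by (intro mult_right_mono) auto
      then show ?thesis using c[OF that(1), of z] by linarith
    qed
  qed
qed

text \<open>Wider than the zone between \<open>s / 2\<close> and \<open>2 * s\<close> that carries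
  the dyadic piece, so that it and the open set on which the piece vanishes cover the space.\<close>

definition shell :: "real \<Rightarrow> real \<Rightarrow> ('v::euclidean_space \<times> 'w::euclidean_space) set" where
  "shell l s = {z. s / 4 \<le> bracket (l *\<^sub>R snd z) \<and> bracket (l *\<^sub>R snd z) \<le> 4 * s}"

text \<open>The scaling by \<open>s powr (\<rho>/2)\<close> balances the gain of a frequency derivative; since \<open>\<delta> \<le> \<rho>\<close>
  it also absorbs the loss of an \<open>x\<close>-derivative.\<close>

lemma bnd_rescaled_symbol:
  fixes a :: "real^'n \<Rightarrow> real^'n \<Rightarrow> real^'n \<Rightarrow> complex"
  assumes a: "bisymbol m \<rho> \<delta> a" and d: "0 \<le> \<delta>" "\<delta> \<le> \<rho>" "\<rho> \<le> 1"
  obtains C where "0 < C" "\<And>s. 1 \<le> s \<Longrightarrow> bnd (shell (s powr (\<rho> / 2)) s) N (C * s powr (m / 2))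
    (\<lambda>z. (\<lambda>(x, \<xi>, \<eta>). a x \<xi> \<eta>) (scale_symbol (s powr (\<rho> / 2)) z))"
proof -
  let ?A = "\<lambda>(x, \<xi>, \<eta>). a x \<xi> \<eta>"
  let ?kx = "\<lambda>vs :: ((real^'n) \<times> (real^'n) \<times> (real^'n)) list. length (filter (\<lambda>v. fst v \<noteq> 0) vs)"
  let ?kf = "\<lambda>vs :: ((real^'n) \<times> (real^'n) \<times> (real^'n)) list. length (filter (\<lambda>v. fst v = 0) vs)"
  let ?e = "\<lambda>vs. (m - \<rho> * real (?kf vs) + \<delta> * real (?kx vs)) / 2"
  have sm: "smooth_fun ?A" using a by (simp add: bisymbol_def Let_def)
  obtain C where C: "0 < C" "\<And>vs z. set vs \<subseteq> Basis \<Longrightarrow> length vs \<le> N \<Longrightarrow>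
    norm (iter_dderiv vs ?A z) \<le> C * bracket (snd z) powr ?e vs"
    using bisymbol_uniform[OF a, of N] by metis
  \<comment> \<open>A bound for all exponents that occur, since \<open>\<rho>\<close> and
    \<open>\<delta>\<close> are at most 1; it controls the cost of replacing the bracket by
    \<open>s\<close> on the shell.\<close>
  define K where "K = \<bar>m\<bar> + real N + real N"
  show ?thesis
  proof (rule that[of "C * 4 powr K"])
    show "0 < C * 4 powr K" using C by simp
    fix s :: real assume s: "1 \<le> s"
    define l where "l = s powr (\<rho> / 2)"
    have l: "0 < l" using s by (simp add: l_def)
    have fac: "(\<Prod>v\<leftarrow>vs. \<bar>scale_factor l v\<bar>) = s powr (\<rho> / 2 * real (?kf vs) - \<rho> / 2 * real (?kx vs))"
      for vs :: "((real^'n) \<times> (real^'n) \<times> (real^'n)) list"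
    proof (induction vs)
      case (Cons v vs)
      have "\<bar>scale_factor l v\<bar> = s powr (if fst v \<noteq> 0 then - (\<rho> / 2) else \<rho> / 2)"
        using s by (simp add: scale_factor_def l_def powr_minus_divide)
      then have "(\<Prod>v\<leftarrow>v # vs. \<bar>scale_factor l v\<bar>) = s powr ((if fst v \<noteq> 0 then - (\<rho> / 2) else \<rho> / 2) + (\<rho> / 2 * real (?kf vs) - \<rho> / 2 * real (?kx vs)))"
        by (simp only: list.map prod_list.Cons Cons.IH powr_add)
      then show ?case by (cases "fst v = 0") (simp_all add: algebra_simps add_divide_distrib)
    qed (use s in simp)
    have "bnd (shell l s) N (C * 4 powr K * s powr (m / 2))
      (\<lambda>z. complex_of_real (\<Prod>v\<leftarrow>([] :: ((real^'n) \<times> (real^'n) \<times> (real^'n)) list). scale_factor l v) * iter_dderiv [] ?A (scale_symbol l z))"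
    proof (rule bnd_iter_dderiv_scaled[OF sm, where vs="[]" and l=l])
      fix ws :: "((real^'n) \<times> (real^'n) \<times> (real^'n)) list" and z :: "(real^'n) \<times> (real^'n) \<times> (real^'n)"
      assume ws: "set ws \<subseteq> Basis" "length ws \<le> N" and z: "z \<in> shell l s"
      have k: "?kx ws \<le> N" "?kf ws \<le> N" using ws(2) length_filter_le le_trans by blast+
      have br: "bracket (snd (scale_symbol l z)) = bracket (l *\<^sub>R snd z)" by (simp add: scale_symbol_def)
      have "\<bar>?e ws\<bar> \<le> K"
      proof -
        have "0 \<le> \<rho> * real (?kf ws)" "0 \<le> \<delta> * real (?kx ws)" using d by auto
        moreover have "\<rho> * real (?kf ws) \<le> 1 * real N" "\<delta> * real (?kx ws) \<le> 1 * real N"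
          using k d by (intro mult_mono; simp)+
        ultimately have "\<bar>m - \<rho> * real (?kf ws) + \<delta> * real (?kx ws)\<bar> \<le> \<bar>m\<bar> + real N + real N" by linarith
        then show ?thesis unfolding K_def abs_divide by simp
      qed
      then have "bracket (l *\<^sub>R snd z) powr ?e ws \<le> 4 powr K * s powr ?e ws"
        using z s by (intro powr_comparable) (auto simp: shell_def)
      then have "norm (iter_dderiv ws ?A (scale_symbol l z)) \<le> C * (4 powr K * s powr ?e ws)"
        using C(2)[OF ws, of "scale_symbol l z"] C(1) unfolding br
        by (meson mult_left_mono less_imp_le order_trans)
      then have "(\<Prod>v\<leftarrow>ws. \<bar>scale_factor l v\<bar>) * norm (iter_dderiv ws ?A (scale_symbol l z)) \<le>
         s powr (\<rho> / 2 * real (?kf ws) - \<rho> / 2 * real (?kx ws)) * (C * (4 powr K * s powr ?e ws))"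
        unfolding fac by (intro mult_left_mono) auto
      also have "\<dots> = C * 4 powr K * s powr (\<rho> / 2 * real (?kf ws) - \<rho> / 2 * real (?kx ws) + ?e ws)"
        by (simp add: powr_add)
      also have "\<dots> \<le> C * 4 powr K * s powr (m / 2)"
      proof -
        \<comment> \<open>In the total exponent the frequency orders cancel exactly, and an
          \<open>x\<close>-order \<open>kx\<close> leaves
          \<open>- (\<rho> - \<delta>) * kx / 2\<close>, which is not positive.\<close>
        have "\<delta> * real (?kx ws) \<le> \<rho> * real (?kx ws)" using d by (intro mult_right_mono) auto
        then have "\<rho> / 2 * real (?kf ws) - \<rho> / 2 * real (?kx ws) + ?e ws \<le> m / 2" by (simp add: field_simps)
        then show ?thesis using C s by (intro mult_left_mono powr_mono) auto
      qed
      finally show "(\<Prod>v\<leftarrow>ws @ []. \<bar>scale_factor l v\<bar>) * norm (iter_dderiv (ws @ []) ?A (scale_symbol l z)) \<le> C * 4 powr K * s powr (m / 2)"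
        by simp
    qed simp
    then show "bnd (shell (s powr (\<rho> / 2)) s) N (C * 4 powr K * s powr (m / 2)) (\<lambda>z. ?A (scale_symbol (s powr (\<rho> / 2)) z))"
      by (simp add: l_def)
  qed
qed

text \<open>An explicit cutoff of class \<open>C\<close> to the \<open>k - 1\<close>, from 1 on the negative axis to 0 beyond 1;
  finitely many derivatives suffice, so no smooth bump function is needed.\<close>

definition cutoff :: "nat \<Rightarrow> real \<Rightarrow> real" where
  "cutoff k u = (max 0 (1 - (max 0 u) ^ k)) ^ k"

lemma cutoff_eq_1: "0 < k \<Longrightarrow> u \<le> 0 \<Longrightarrow> cutoff k u = 1"
  by (simp add: cutoff_def max_def zero_power)

lemma cutoff_eq_0: "0 < k \<Longrightarrow> 1 \<le> u \<Longrightarrow> cutoff k u = 0"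
proof -
  assume k: "0 < k" "1 \<le> u"
  have "max 0 (1 - u ^ k) = 0" using one_le_power[of u k] k by (simp del: one_le_power)
  then show ?thesis using k by (simp add: cutoff_def max_absorb2 zero_power)
qed

lemma cutoff_bounds: "0 \<le> cutoff k u" "cutoff k u \<le> 1"
  by (auto simp: cutoff_def intro!: power_le_one)

lemma cutoff_continuous: "continuous_on UNIV (cutoff k)"
  unfolding cutoff_def[abs_def] by (intro continuous_intros)

text \<open>The function is quadratic in \<open>\<zeta>\<close>. On this set
  \<open>l * norm \<zeta>\<close> is at most the square root of \<open>8 * s\<close>, and
  \<open>l\<close> at most that of \<open>2 * s\<close>, so the first derivatives are at most
  \<open>2 * (4 * s) / s = 8\<close>; second derivatives are at most
  \<open>2 * l\<^sup>2 / s \<le> 4\<close> and later ones vanish. The condition on \<open>l\<close>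
  expresses \<open>\<rho> \<le> 1\<close>, with a factor 2 to cover both scales \<open>2 ^ j\<close>
  and \<open>2 ^ j / 2\<close> of a dyadic piece.\<close>

lemma bnd_bracket:
  fixes l s :: real
  assumes s: "0 < s" and l: "0 \<le> l" "l\<^sup>2 \<le> 2 * s"
  shows "bnd {z :: 'v::euclidean_space \<times> 'w::euclidean_space. bracket (l *\<^sub>R snd z) \<le> 8 * s} N 8
    (\<lambda>z. complex_of_real (bracket (l *\<^sub>R snd z) / s - 1))"
proof -
  let ?S = "{z :: 'v \<times> 'w. bracket (l *\<^sub>R snd z) \<le> 8 * s}"
  have "bnd ?S (Suc N) 8 (\<lambda>z. complex_of_real (bracket (l *\<^sub>R snd z) / s - 1))"
  proof (rule bnd_SucI[where D="\<lambda>b z. complex_of_real (z \<bullet> (0, (2 * l\<^sup>2 / s) *\<^sub>R snd b))"])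
    show "continuous_on UNIV (\<lambda>z :: 'v \<times> 'w. complex_of_real (bracket (l *\<^sub>R snd z) / s - 1))"
      unfolding bracket_def using s by (intro continuous_intros) auto
    show "norm (complex_of_real (bracket (l *\<^sub>R snd z) / s - 1)) \<le> 8" if "z \<in> ?S" for z
    proof -
      have "0 \<le> bracket (l *\<^sub>R snd z) / s" "bracket (l *\<^sub>R snd z) / s \<le> 8"
        using that s bracket_ge_1[of "l *\<^sub>R snd z"] by (auto simp: divide_le_eq)
      then show ?thesis unfolding norm_of_real by linarith
    qed
    fix b :: "'v \<times> 'w" assume b: "b \<in> Basis"
    have nb: "norm (snd b) \<le> 1" using b by (auto simp: Basis_prod_def)
    show "bnd ?S N 8 (\<lambda>z. complex_of_real (z \<bullet> (0, (2 * l\<^sup>2 / s) *\<^sub>R snd b)))"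
    proof (rule bnd_inner)
      show "\<bar>z \<bullet> (0, (2 * l\<^sup>2 / s) *\<^sub>R snd b)\<bar> \<le> 8" if "z \<in> ?S" for z
      proof -
        have "(l * norm (snd z))\<^sup>2 \<le> 8 * s" using that l by (simp add: bracket_def power_mult_distrib)
        then have "(l * (l * norm (snd z)))\<^sup>2 \<le> (2 * s) * (8 * s)"
          unfolding power_mult_distrib[of l "l * _"] using l s by (intro mult_mono) auto
        then have "(l * (l * norm (snd z)))\<^sup>2 \<le> (4 * s)\<^sup>2" by (simp add: power2_eq_square)
        then have ll: "l * (l * norm (snd z)) \<le> 4 * s" by (rule power2_le_imp_le) (use s in simp)
        have "\<bar>z \<bullet> (0, (2 * l\<^sup>2 / s) *\<^sub>R snd b)\<bar> = 2 * l\<^sup>2 / s * \<bar>snd z \<bullet> snd b\<bar>"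
          using s by (simp add: inner_prod_def abs_mult)
        also have "\<dots> \<le> 2 * l\<^sup>2 / s * (norm (snd z) * 1)"
          using s nb by (intro mult_left_mono order_trans[OF Cauchy_Schwarz_ineq2]) auto
        also have "\<dots> \<le> 8" using ll s by (simp add: power2_eq_square divide_le_eq mult_ac)
        finally show ?thesis .
      qed
      show "\<bar>e \<bullet> (0, (2 * l\<^sup>2 / s) *\<^sub>R snd b)\<bar> \<le> 8" if "e \<in> Basis" for e :: "'v \<times> 'w"
      proof -
        have ne: "norm (snd e) \<le> 1" using that by (auto simp: Basis_prod_def)
        have "\<bar>e \<bullet> (0, (2 * l\<^sup>2 / s) *\<^sub>R snd b)\<bar> = 2 * l\<^sup>2 / s * \<bar>snd e \<bullet> snd b\<bar>"
          using s by (simp add: inner_prod_def abs_mult)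
        also have "\<dots> \<le> 4 * (1 * 1)"
        proof (intro mult_mono)
          show "2 * l\<^sup>2 / s \<le> 4" using l s by (simp add: divide_le_eq)
          show "\<bar>snd e \<bullet> snd b\<bar> \<le> 1 * 1"
            using ne nb by (intro order_trans[OF Cauchy_Schwarz_ineq2] mult_mono) auto
        qed auto
        finally show ?thesis by simp
      qed
    qed
    fix z :: "'v \<times> 'w"
    have "(\<lambda>t. bracket (l *\<^sub>R snd (z + t *\<^sub>R b)) / s - 1) =
      (\<lambda>t. (1 + l\<^sup>2 * (snd z \<bullet> snd z + 2 * t * (snd z \<bullet> snd b) + t\<^sup>2 * (snd b \<bullet> snd b))) / s - 1)"
      unfolding bracket_def power2_norm_eq_inner
      by (simp add: inner_add_left inner_add_right inner_commute power2_eq_square algebra_simps)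
    moreover have "((\<lambda>t. (1 + l\<^sup>2 * (snd z \<bullet> snd z + 2 * t * (snd z \<bullet> snd b) + t\<^sup>2 * (snd b \<bullet> snd b))) / s - 1)
      has_real_derivative z \<bullet> (0, (2 * l\<^sup>2 / s) *\<^sub>R snd b)) (at 0)"
      using s by (auto intro!: derivative_eq_intros simp: inner_prod_def)
    ultimately show "((\<lambda>t. complex_of_real (bracket (l *\<^sub>R snd (z + t *\<^sub>R b)) / s - 1)) has_vector_derivative
        complex_of_real (z \<bullet> (0, (2 * l\<^sup>2 / s) *\<^sub>R snd b))) (at 0)"
      by (intro has_vector_derivative_of_real) simp
  qed
  then show ?thesis by (rule bnd_mono) auto
qed

text \<open>The cutoff is a truncated power of 1 minus a truncated power, so
  \<open>bnd_plus_power\<close> is applied twice. The constant 8 is the one of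
  \<open>bnd_bracket\<close>.\<close>

lemma bnd_cutoff:
  assumes "N < k"
  obtains K where "0 \<le> K" "\<And>(S :: 'v::euclidean_space set) v. bnd S N 8 (\<lambda>z. complex_of_real (v z)) \<Longrightarrow>
    bnd S N K (\<lambda>z. complex_of_real (cutoff k (v z)))"
proof -
  obtain K1 where K1: "0 \<le> K1" "\<And>(S :: 'v set) v. bnd S N 8 (\<lambda>z. complex_of_real (v z)) \<Longrightarrow>
    bnd S N K1 (\<lambda>z. complex_of_real ((max 0 (v z)) ^ k))"
    using bnd_plus_power[OF assms, of 8] by auto
  obtain K where K: "0 \<le> K" "\<And>(S :: 'v set) v. bnd S N (1 + K1) (\<lambda>z. complex_of_real (v z)) \<Longrightarrow>
    bnd S N K (\<lambda>z. complex_of_real ((max 0 (v z)) ^ k))"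
    using bnd_plus_power[OF assms, of "1 + K1"] K1 by auto
  have "bnd S N K (\<lambda>z. complex_of_real (cutoff k (v z)))" if "bnd S N 8 (\<lambda>z. complex_of_real (v z))" for S :: "'v set" and v
  proof -
    have "bnd S N (1 + norm (-1 :: complex) * K1) (\<lambda>z. 1 + (-1) * complex_of_real ((max 0 (v z)) ^ k))"
      by (intro bnd_add bnd_const bnd_scale K1(2) that) simp
    then have "bnd S N (1 + K1) (\<lambda>z. complex_of_real (1 - (max 0 (v z)) ^ k))" by simp
    from K(2)[OF this] show ?thesis by (simp add: cutoff_def)
  qed
  then show ?thesis using that K(1) by blast
qed

text \<open>Telescoping differences of dilated cutoffs. The scale is that of
  \<open>bracket \<zeta>\<close>, hence piece \<open>j\<close> sits at \<open>norm \<zeta>\<close>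
  of order \<open>2 powr (j / 2)\<close>. Nothing is subtracted for \<open>j = 0\<close>, so that
  piece retains the low frequencies; \<open>2 ^ j / 2\<close> stands for the preceding scale without
  subtraction in the natural numbers.\<close>

definition dyadic :: "nat \<Rightarrow> nat \<Rightarrow> 'w::euclidean_space \<Rightarrow> real" where
  "dyadic k j \<zeta> = cutoff k (bracket \<zeta> / 2 ^ j - 1) - (if j = 0 then 0 else cutoff k (bracket \<zeta> / (2 ^ j / 2) - 1))"

lemma sum_dyadic: "(\<Sum>j\<le>J. dyadic k j \<zeta>) = cutoff k (bracket \<zeta> / 2 ^ J - 1)"
  by (induction J) (auto simp: dyadic_def)

lemma dyadic_continuous: "continuous_on UNIV (dyadic k j)"
  unfolding dyadic_def[abs_def] bracket_def
  by (cases "j = 0") (auto intro!: continuous_intros continuous_on_compose2[OF cutoff_continuous])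

lemma dyadic_bound: "\<bar>dyadic k j \<zeta>\<bar> \<le> 1"
  using cutoff_bounds[of k "bracket \<zeta> / 2 ^ j - 1"] cutoff_bounds[of k "bracket \<zeta> / (2 ^ j / 2) - 1"]
  by (auto simp: dyadic_def)

lemma dyadic_eq_0:
  assumes "0 < k" "bracket \<zeta> < 2 ^ j / 2 \<or> 2 * 2 ^ j < bracket \<zeta>"
  shows "dyadic k j \<zeta> = 0"
proof (cases "bracket \<zeta> < 2 ^ j / 2")
  case True
  have "j \<noteq> 0" using True bracket_ge_1[of \<zeta>] by (auto intro: ccontr)
  moreover have "bracket \<zeta> / 2 ^ j - 1 \<le> 0" "bracket \<zeta> / (2 ^ j / 2) - 1 \<le> 0"
    using True bracket_ge_1[of \<zeta>] by (auto simp: divide_le_eq)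
  ultimately show ?thesis using cutoff_eq_1[OF assms(1)] by (simp add: dyadic_def)
next
  case False
  then have "1 \<le> bracket \<zeta> / 2 ^ j - 1" "1 \<le> bracket \<zeta> / (2 ^ j / 2) - 1"
    using assms(2) by (auto simp: field_simps)
  then show ?thesis using cutoff_eq_0[OF assms(1)] by (simp add: dyadic_def)
qed

lemma bnd_dyadic:
  assumes "N < k"
  obtains K where "0 \<le> K" "\<And>j l. 0 \<le> l \<Longrightarrow> l\<^sup>2 \<le> 2 ^ j \<Longrightarrow>
    bnd (shell l (2 ^ j) :: ('v::euclidean_space \<times> 'w::euclidean_space) set) N K (\<lambda>z. complex_of_real (dyadic k j (l *\<^sub>R snd z)))"
proof -
  obtain K where K: "0 \<le> K" "\<And>(S :: ('v \<times> 'w) set) v. bnd S N 8 (\<lambda>z. complex_of_real (v z)) \<Longrightarrow>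
    bnd S N K (\<lambda>z. complex_of_real (cutoff k (v z)))"
    using bnd_cutoff[OF assms] by metis
  have "bnd (shell l (2 ^ j) :: ('v \<times> 'w) set) N (K + norm (-1 :: complex) * K) (\<lambda>z. complex_of_real (dyadic k j (l *\<^sub>R snd z)))"
    if l: "0 \<le> l" "l\<^sup>2 \<le> 2 ^ j" for j l
  proof -
    have c: "bnd (shell l (2 ^ j) :: ('v \<times> 'w) set) N K (\<lambda>z. complex_of_real (cutoff k (bracket (l *\<^sub>R snd z) / s - 1)))"
      if "s = 2 ^ j \<or> s = 2 ^ j / 2" for s
    proof (rule K(2), rule bnd_mono[OF bnd_bracket[where s=s and l=l]])
      have "(0::real) \<le> 2 ^ j" by simp
      then show "l\<^sup>2 \<le> 2 * s" using l(2) that by linarith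
      show "shell l (2 ^ j) \<subseteq> {z :: 'v \<times> 'w. bracket (l *\<^sub>R snd z) \<le> 8 * s}" using that by (auto simp: shell_def)
      have "(0::real) < 2 ^ j" by simp
      then show "0 < s" using that by linarith
    qed (use l in auto)
    show ?thesis
    proof (cases "j = 0")
      case True
      then show ?thesis using bnd_mono[OF c[of "2 ^ j"], of N "K + norm (-1 :: complex) * K"] K(1) by (simp add: dyadic_def)
    next
      case False
      then show ?thesis using bnd_add[OF c[of "2 ^ j"] bnd_scale[OF c[of "2 ^ j / 2"], of "-1"]] by (simp add: dyadic_def)
    qed
  qed
  then show ?thesis using that[of "K + norm (-1 :: complex) * K"] K(1) by simp
qed

text \<open>On the support of the piece the original frequency is at most the square root of
  \<open>2 * 2 ^ j\<close>. Dividing by the dilation factor \<open>(2 ^ j) powr (\<rho> / 2)\<close>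
  leaves the stated radius.\<close>

lemma bnd_dyadic_piece:
  fixes a :: "real^'n \<Rightarrow> real^'n \<Rightarrow> real^'n \<Rightarrow> complex"
  assumes a: "bisymbol m \<rho> \<delta> a" and d: "0 \<le> \<delta>" "\<delta> \<le> \<rho>" "\<rho> \<le> 1" and k: "N < k"
  obtains C where "0 < C"
    "\<And>j. bnd UNIV N (C * (2 ^ j) powr (m / 2)) (\<lambda>z. (\<lambda>(x, \<xi>, \<eta>). a x \<xi> \<eta>) (scale_symbol ((2 ^ j) powr (\<rho> / 2)) z) *
       complex_of_real (dyadic k j ((2 ^ j) powr (\<rho> / 2) *\<^sub>R snd z)))"
    "\<And>j. freq_supp (sqrt 2 * (2 ^ j) powr ((1 - \<rho>) / 2)) (\<lambda>z. (\<lambda>(x, \<xi>, \<eta>). a x \<xi> \<eta>) (scale_symbol ((2 ^ j) powr (\<rho> / 2)) z) *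
       complex_of_real (dyadic k j ((2 ^ j) powr (\<rho> / 2) *\<^sub>R snd z)))"
proof -
  let ?A = "\<lambda>(x, \<xi>, \<eta>). a x \<xi> \<eta>"
  let ?B = "\<lambda>j z. ?A (scale_symbol ((2 ^ j) powr (\<rho> / 2)) z) * complex_of_real (dyadic k j ((2 ^ j) powr (\<rho> / 2) *\<^sub>R snd z))"
  obtain C where C: "0 < C" "\<And>s. 1 \<le> s \<Longrightarrow> bnd (shell (s powr (\<rho> / 2)) s) N (C * s powr (m / 2)) (\<lambda>z. ?A (scale_symbol (s powr (\<rho> / 2)) z))"
    using bnd_rescaled_symbol[OF a d, of N] by metis
  obtain K where K: "0 \<le> K" "\<And>j l. 0 \<le> l \<Longrightarrow> l\<^sup>2 \<le> 2 ^ j \<Longrightarrow>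
    bnd (shell l (2 ^ j) :: ((real^'n) \<times> ((real^'n) \<times> (real^'n))) set) N K (\<lambda>z. complex_of_real (dyadic k j (l *\<^sub>R snd z)))"
    using bnd_dyadic[OF k] by metis
  show ?thesis
  proof (rule that[of "2 ^ N * C * (K + 1)"])
    show "0 < 2 ^ N * C * (K + 1)" using C K by (intro mult_pos_pos) auto
    fix j :: nat
    define s :: real where "s = 2 ^ j"
    define l where "l = s powr (\<rho> / 2)"
    have s: "1 \<le> s" by (simp add: s_def)
    have l0: "0 < l" using s by (simp add: l_def)
    have l2: "l\<^sup>2 = s powr \<rho>" using s by (simp add: l_def power2_eq_square powr_add[symmetric])
    have ls: "l\<^sup>2 \<le> s" unfolding l2 using powr_mono[of \<rho> 1 s] d s by simp
    \<comment> \<open>The open set where the cutoff vanishes identically; the strict inequalities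
      make it open, as the extension by zero requires.\<close>
    let ?U = "{z :: (real^'n) \<times> ((real^'n) \<times> (real^'n)). bracket (l *\<^sub>R snd z) < s / 2} \<union> {z. 2 * s < bracket (l *\<^sub>R snd z)}"
    have z: "?B j z = 0" if "z \<in> ?U" for z
      using dyadic_eq_0[of k "l *\<^sub>R snd z" j] k that by (auto simp: l_def s_def)
    have f1: "bnd (shell l s) N (C * s powr (m / 2)) (\<lambda>z. ?A (scale_symbol l z))"
      unfolding l_def by (rule C(2)[OF s])
    have f2: "bnd (shell l s :: ((real^'n) \<times> ((real^'n) \<times> (real^'n))) set) N K (\<lambda>z. complex_of_real (dyadic k j (l *\<^sub>R snd z)))"
      unfolding s_def by (rule K(2)) (use l0 ls in \<open>auto simp: s_def\<close>)
    have "0 \<le> C * s powr (m / 2)" using C(1) by simp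
    from bnd_mult[OF this K(1) f1 f2] have "bnd (shell l s) N (2 ^ N * (C * s powr (m / 2)) * K) (?B j)"
      unfolding l_def s_def .
    moreover have "2 ^ N * (C * s powr (m / 2)) * K \<le> 2 ^ N * C * (K + 1) * s powr (m / 2)"
    proof -
      have "2 ^ N * (C * s powr (m / 2)) * K \<le> 2 ^ N * (C * s powr (m / 2)) * (K + 1)"
        using C by (intro mult_left_mono) auto
      then show ?thesis by (simp add: mult_ac)
    qed
    ultimately have "bnd (shell l s) N (2 ^ N * C * (K + 1) * s powr (m / 2)) (?B j)"
      by (auto elim: bnd_mono)
    moreover have "open ?U"
      unfolding bracket_def by (intro open_Un open_Collect_less continuous_intros)
    moreover have "shell l s \<union> ?U = UNIV" using s by (auto simp: shell_def)
    ultimately have "bnd UNIV N (2 ^ N * C * (K + 1) * s powr (m / 2)) (?B j)"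
      using z C K by (intro bnd_zero_ext[of ?U _ "shell l s"]) auto
    then show "bnd UNIV N (2 ^ N * C * (K + 1) * (2 ^ j) powr (m / 2)) (?B j)" by (simp add: s_def)
    show "freq_supp (sqrt 2 * (2 ^ j) powr ((1 - \<rho>) / 2)) (?B j)"
      unfolding freq_supp_cube
    proof (intro allI impI)
      fix x :: "real^'n" and \<zeta> :: "(real^'n) \<times> (real^'n)"
      assume "\<zeta> \<notin> cube (sqrt 2 * (2 ^ j) powr ((1 - \<rho>) / 2))"
      then obtain b where b: "b \<in> Basis" "sqrt 2 * s powr ((1 - \<rho>) / 2) < \<bar>\<zeta> \<bullet> b\<bar>"
        by (auto simp: mem_cube s_def not_le)
      have "\<bar>\<zeta> \<bullet> b\<bar> \<le> norm \<zeta>" using b(1) by (rule Basis_le_norm)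
      then have "l * (sqrt 2 * s powr ((1 - \<rho>) / 2)) < l * norm \<zeta>" using b(2) l0 by (intro mult_strict_left_mono) auto
      also have "l * (sqrt 2 * s powr ((1 - \<rho>) / 2)) = sqrt 2 * s powr (1 / 2)"
        using s by (simp add: l_def powr_add[symmetric] add_divide_distrib[symmetric])
      finally have "(sqrt 2 * s powr (1 / 2))\<^sup>2 < (l * norm \<zeta>)\<^sup>2" by (intro power_strict_mono) auto
      then have "2 * s < bracket (l *\<^sub>R \<zeta>)"
        using s l0 by (simp add: bracket_def power_mult_distrib powr_half_sqrt)
      then show "?B j (x, \<zeta>) = 0" by (intro z) simp
    qed
  qed
qed

section \<open>Summation over the scales\<close>

lemma Lp_le_dilate:
  fixes f :: "'v::euclidean_space \<Rightarrow> complex"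
  assumes fm [measurable]: "f \<in> borel_measurable borel" and c: "0 < c" and t: "0 \<le> t" and a: "0 \<le> a" and f: "Lp_le t f a"
  shows "Lp_le t (\<lambda>y. f (c *\<^sub>R y)) (c powr (- (real DIM('v) * t)) * a)"
proof (cases "t = 0")
  case True
  \<comment> \<open>For the supremum, nullity of the exceptional set is expressed by the integral of
    its indicator, which the change of variables carries over to the dilated function.\<close>
  have P: "{y. a < norm (f y)} \<in> sets borel" by measurable
  have "AE y in lborel. norm (f y) \<le> a" using f True by (simp add: Lp_le_def)
  then have "(\<integral>\<^sup>+y. indicator {y. a < norm (f y)} y \<partial>lborel) = 0"
    by (subst nn_integral_0_iff_AE) (use P in \<open>auto elim!: eventually_mono split: split_indicator\<close>)
  then have "(\<integral>\<^sup>+y. indicator {y. a < norm (f y)} (0 + c *\<^sub>R y) \<partial>lborel) = 0"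
    using nn_integral_lborel_affine[of "indicator {y. a < norm (f y)}" c 0] P c by auto
  then have "AE y in lborel. indicator {y. a < norm (f y)} (0 + c *\<^sub>R y) = (0::ennreal)"
    by (subst (asm) nn_integral_0_iff_AE) (use P in auto)
  then have "AE y in lborel. norm (f (c *\<^sub>R y)) \<le> a" by eventually_elim (auto split: split_indicator_asm)
  then show ?thesis using True c by (simp add: Lp_le_def)
next
  case False
  define q where "q = 1 / t"
  have q: "t * q = 1" using False by (simp add: q_def)
  let ?n = "real DIM('v)"
  have b: "(\<integral>\<^sup>+y. ennreal (norm (f y) powr q) \<partial>lborel) \<le> ennreal (a powr q)" using f False by (simp add: Lp_le_def q_def)
  let ?I = "\<integral>\<^sup>+y. ennreal (norm (f (c *\<^sub>R y)) powr q) \<partial>lborel"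
  have "ennreal (c ^ DIM('v)) * ?I = (\<integral>\<^sup>+y. ennreal (norm (f y) powr q) \<partial>lborel)"
    using nn_integral_lborel_affine[of "\<lambda>y. ennreal (norm (f y) powr q)" c 0] c by (simp add: ennreal_power)
  then have "ennreal (c powr (- ?n)) * (ennreal (c ^ DIM('v)) * ?I) \<le> ennreal (c powr (- ?n)) * ennreal (a powr q)"
    using b by (intro mult_left_mono) auto
  moreover have "ennreal (c powr (- ?n)) * (ennreal (c ^ DIM('v)) * ?I) = ?I"
  proof -
    have "c powr (- ?n) * c ^ DIM('v) = 1" using c by (simp add: powr_realpow[symmetric] powr_add[symmetric])
    then have "ennreal (c powr (- ?n)) * ennreal (c ^ DIM('v)) = 1" using c by (simp add: ennreal_mult[symmetric])
    then show ?thesis by (simp add: mult.assoc[symmetric])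
  qed
  moreover have "(c powr (- (?n * t)) * a) powr q = c powr (- ?n) * a powr q"
  proof -
    have "- (?n * t) * q = - ?n" using q by simp
    then show ?thesis using c a by (simp only: powr_mult powr_powr)
  qed
  ultimately have "?I \<le> ennreal ((c powr (- (?n * t)) * a) powr q)" by (simp add: ennreal_mult[symmetric])
  then show ?thesis using False by (simp add: Lp_le_def q_def)
qed

lemma ft_dilate:
  fixes f :: "'v::euclidean_space \<Rightarrow> complex"
  assumes [measurable]: "f \<in> borel_measurable borel" and l: "0 < l"
  shows "ft f (l *\<^sub>R \<xi>) = complex_of_real ((1 / l) ^ DIM('v)) * ft (\<lambda>y. f ((1 / l) *\<^sub>R y)) \<xi>"
proof -
  have "(\<lambda>y. f y * cis (- (y \<bullet> (l *\<^sub>R \<xi>)))) \<in> borel_measurable borel" by measurable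
  from integral_lborel_affine[OF this, of "1 / l" 0] show ?thesis using l by (simp add: ft_def)
qed

text \<open>The substitution in the doubled frequency space has Jacobian \<open>l ^ (2 * n)\<close>,
  which cancels the factors \<open>(1 / l) ^ n\<close> from the transforms of the two dilated
  functions.\<close>

lemma mult_op_dilate:
  fixes A :: "'v::euclidean_space \<times> ('v \<times> 'v) \<Rightarrow> complex"
  assumes A: "continuous_on UNIV A" and [measurable]: "f \<in> borel_measurable borel" "g \<in> borel_measurable borel" and l: "0 < l"
  shows "mult_op A (tensor_ft f g) x =
    mult_op (\<lambda>z. A (scale_symbol l z)) (tensor_ft (\<lambda>y. f ((1 / l) *\<^sub>R y)) (\<lambda>y. g ((1 / l) *\<^sub>R y))) (l *\<^sub>R x)"
proof -
  have [measurable]: "A \<in> borel_measurable borel" using A by (rule borel_measurable_continuous_onI)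
  have "(\<lambda>\<zeta>. ft f (fst \<zeta>) * ft g (snd \<zeta>)) \<in> borel_measurable (borel \<Otimes>\<^sub>M borel)" by measurable
  then have [measurable]: "tensor_ft f g \<in> borel_measurable borel" by (simp add: borel_prod)
  let ?h = "\<lambda>\<zeta>. A (x, \<zeta>) * tensor_ft f g \<zeta> * cis ((x, x) \<bullet> \<zeta>)"
  let ?k = "\<lambda>\<zeta>. A (scale_symbol l (l *\<^sub>R x, \<zeta>)) * tensor_ft (\<lambda>y. f ((1 / l) *\<^sub>R y)) (\<lambda>y. g ((1 / l) *\<^sub>R y)) \<zeta> * cis ((l *\<^sub>R x, l *\<^sub>R x) \<bullet> \<zeta>)"
  let ?c = "complex_of_real ((1 / l) ^ DIM('v))"
  have "?h (0 + l *\<^sub>R \<zeta>) = (?c * ?c) * ?k \<zeta>" for \<zeta> :: "'v \<times> 'v"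
  proof -
    have "scale_symbol l (l *\<^sub>R x, \<zeta>) = (x, l *\<^sub>R \<zeta>)" using l by (simp add: scale_symbol_def)
    moreover have "(l *\<^sub>R x, l *\<^sub>R x) \<bullet> \<zeta> = (x, x) \<bullet> (0 + l *\<^sub>R \<zeta>)" by (simp add: inner_prod_def)
    moreover have "tensor_ft f g (0 + l *\<^sub>R \<zeta>) = ?c * ?c * tensor_ft (\<lambda>y. f ((1 / l) *\<^sub>R y)) (\<lambda>y. g ((1 / l) *\<^sub>R y)) \<zeta>"
      using ft_dilate[of f l "fst \<zeta>"] ft_dilate[of g l "snd \<zeta>"] l by simp
    ultimately show ?thesis by (simp only: mult_ac add_0)
  qed
  moreover have "(\<lambda>\<zeta>. ?h \<zeta>) \<in> borel_measurable borel" by measurable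
  from integral_lborel_affine[OF this, of l 0]
  have "(\<integral>\<zeta>. ?h \<zeta> \<partial>lborel) = complex_of_real (\<bar>l\<bar> ^ DIM('v \<times> 'v)) * (\<integral>\<zeta>. ?h (0 + l *\<^sub>R \<zeta>) \<partial>lborel)" using l by blast
  ultimately have "(\<integral>\<zeta>. ?h \<zeta> \<partial>lborel) = complex_of_real (\<bar>l\<bar> ^ DIM('v \<times> 'v)) * (\<integral>\<zeta>. (?c * ?c) * ?k \<zeta> \<partial>lborel)" by (simp only:)
  also have "(\<integral>\<zeta>. (?c * ?c) * ?k \<zeta> \<partial>lborel) = (?c * ?c) * (\<integral>\<zeta>. ?k \<zeta> \<partial>lborel)" by (rule integral_mult_right_zero)
  also have "complex_of_real (\<bar>l\<bar> ^ DIM('v \<times> 'v)) * ((?c * ?c) * (\<integral>\<zeta>. ?k \<zeta> \<partial>lborel)) = (\<integral>\<zeta>. ?k \<zeta> \<partial>lborel)"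
    using l by (simp add: power_add power_divide)
  finally show ?thesis by (simp only: mult_op_def)
qed

lemma suminf_le_of_power:
  fixes c :: "nat \<Rightarrow> real"
  assumes c: "\<And>j. 0 \<le> c j" "\<And>j. c j \<le> k ^ j * D" and k: "0 \<le> k" "k < 1"
  shows "(\<Sum>j. ennreal (c j)) \<le> ennreal (D / (1 - k))"
proof -
  have s: "summable (\<lambda>j. k ^ j * D)" using k by (intro summable_mult2 summable_geometric) auto
  have D: "0 \<le> D" using c[of 0] by simp
  have "(\<Sum>j. ennreal (c j)) \<le> (\<Sum>j. ennreal (k ^ j * D))" by (intro suminf_le ennreal_leI c) auto
  also have "\<dots> = ennreal (\<Sum>j. k ^ j * D)" using s k D by (intro suminf_ennreal2) auto
  also have "(\<Sum>j. k ^ j * D) = D / (1 - k)" using k suminf_mult2[OF summable_geometric[of k], of D] suminf_geometric[of k] by simp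
  finally show ?thesis .
qed

text \<open>A substitute for Minkowski's inequality for series. The decay \<open>(k * k) ^ j\<close>
  is split in two: one factor \<open>k ^ j\<close> sums the terms pointwise after their normalised
  powers \<open>w j\<close> have been bounded by the sum \<open>D\<close>, the other makes the
  integral of \<open>D\<close> converge. Each geometric series contributes one factor
  \<open>1 / (1 - k)\<close>.\<close>

lemma Lp_le_geometric_sum:
  fixes T :: "'v::euclidean_space \<Rightarrow> complex" and c :: "nat \<Rightarrow> 'v \<Rightarrow> complex"
  assumes u: "0 \<le> u" "u \<le> 1" and k: "0 < k" "k < 1" and K: "0 < K"
    and cm [measurable]: "\<And>j. c j \<in> borel_measurable borel"
    and c: "\<And>j. Lp_le u (c j) (K * (k * k) ^ j)"
    and T: "\<And>x. ennreal (norm (T x)) \<le> (\<Sum>j. ennreal (norm (c j x)))"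
  shows "Lp_le u T (K / (1 - k)\<^sup>2)"
proof (cases "u = 0")
  case True
  have "AE x in lborel. \<forall>j. norm (c j x) \<le> K * (k * k) ^ j"
    using c True by (subst AE_all_countable) (simp add: Lp_le_def)
  then have "AE x in lborel. norm (T x) \<le> K / (1 - k)\<^sup>2"
  proof eventually_elim
    case (elim x)
    have "norm (c j x) \<le> k ^ j * K" for j
    proof -
      have "(k * k) ^ j \<le> k ^ j" using k by (intro power_mono) (auto simp: mult_left_le)
      then have "K * (k * k) ^ j \<le> k ^ j * K" using K by (simp add: mult.commute)
      with elim[rule_format, of j] show ?thesis by (rule order_trans)
    qed
    then have "(\<Sum>j. ennreal (norm (c j x))) \<le> ennreal (K / (1 - k))" using k by (intro suminf_le_of_power) auto
    with T[of x] have "ennreal (norm (T x)) \<le> ennreal (K / (1 - k))" by (rule order_trans)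
    then have "norm (T x) \<le> K / (1 - k)" using K k by simp
    also have "\<dots> \<le> K / (1 - k)\<^sup>2" using K k by (intro divide_left_mono) (auto simp: power2_eq_square mult_left_le)
    finally show ?case .
  qed
  then show ?thesis using True by (simp add: Lp_le_def)
next
  case False
  define r where "r = 1 / u"
  have r: "1 \<le> r" using False u by (simp add: r_def)
  define w where "w j x = (norm (c j x) / k ^ j) powr r" for j x
  define D where "D x = (\<Sum>j. ennreal (w j x))" for x
  have wm [measurable]: "w j \<in> borel_measurable borel" for j unfolding w_def[abs_def] by measurable
  have Dm [measurable]: "D \<in> borel_measurable borel" unfolding D_def[abs_def] by measurable
  have T_D: "ennreal (norm (T x) powr r) \<le> ennreal ((1 / (1 - k)) powr r) * D x" for x
  proof (cases "D x = \<top>")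
    case True
    then show ?thesis using k by (simp add: ennreal_mult_top)
  next
    case False
    define d where "d = enn2real (D x)"
    have d: "D x = ennreal d" "0 \<le> d" using False by (auto simp: d_def less_top)
    have "norm (c j x) \<le> k ^ j * d powr (1 / r)" for j
    proof -
      have "ennreal (w j x) \<le> D x"
        unfolding D_def using sum_le_suminf[of "\<lambda>j. ennreal (w j x)" "{j}"] by simp
      then have "w j x \<le> d" using d by simp
      then have "(w j x) powr (1 / r) \<le> d powr (1 / r)" using r by (intro powr_mono2) (auto simp: w_def)
      also have "(w j x) powr (1 / r) = norm (c j x) / k ^ j" using r k unfolding w_def by (simp add: powr_powr)
      finally show ?thesis using k by (simp add: divide_le_eq mult.commute)
    qed
    then have "(\<Sum>j. ennreal (norm (c j x))) \<le> ennreal (d powr (1 / r) / (1 - k))" using k by (intro suminf_le_of_power) auto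
    with T[of x] have "ennreal (norm (T x)) \<le> ennreal (d powr (1 / r) / (1 - k))" by (rule order_trans)
    then have "norm (T x) \<le> d powr (1 / r) / (1 - k)" using k by simp
    then have "norm (T x) powr r \<le> (d powr (1 / r) / (1 - k)) powr r" using r by (intro powr_mono2) auto
    also have "\<dots> = (1 / (1 - k)) powr r * d" using r k d by (simp add: powr_divide powr_powr)
    finally show ?thesis using d by (simp add: ennreal_mult[symmetric] ennreal_leI)
  qed
  have "(\<integral>\<^sup>+x. ennreal (norm (T x) powr r) \<partial>lborel) \<le> (\<integral>\<^sup>+x. ennreal ((1 / (1 - k)) powr r) * D x \<partial>lborel)"
    by (intro nn_integral_mono T_D)
  also have "\<dots> = ennreal ((1 / (1 - k)) powr r) * (\<Sum>j. \<integral>\<^sup>+x. ennreal (w j x) \<partial>lborel)"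
    unfolding D_def by (subst nn_integral_cmult) (auto simp: nn_integral_suminf)
  also have "(\<Sum>j. \<integral>\<^sup>+x. ennreal (w j x) \<partial>lborel) \<le> (\<Sum>j. ennreal (k ^ j * K powr r))"
  proof (intro suminf_le)
    fix j
    have "(\<integral>\<^sup>+x. ennreal (w j x) \<partial>lborel) = (\<integral>\<^sup>+x. ennreal ((1 / k ^ j) powr r) * ennreal (norm (c j x) powr r) \<partial>lborel)"
      using k by (intro nn_integral_cong) (simp add: w_def powr_divide ennreal_mult[symmetric])
    also have "\<dots> = ennreal ((1 / k ^ j) powr r) * (\<integral>\<^sup>+x. ennreal (norm (c j x) powr r) \<partial>lborel)"
      by (rule nn_integral_cmult) measurable
    also have "\<dots> \<le> ennreal ((1 / k ^ j) powr r) * ennreal ((K * (k * k) ^ j) powr r)"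
      using c[of j] False by (intro mult_left_mono) (auto simp: Lp_le_def r_def)
    also have "\<dots> = ennreal (K powr r * (k ^ j) powr r)"
    proof -
      have "(1 / k ^ j) powr r * (K * (k * k) ^ j) powr r = ((1 / k ^ j) * (K * (k * k) ^ j)) powr r"
        by (rule powr_mult[symmetric])
      also have "(1 / k ^ j) * (K * (k * k) ^ j) = K * k ^ j" using k by (simp add: power_mult_distrib)
      finally show ?thesis by (simp add: ennreal_mult[symmetric] powr_mult)
    qed
    also have "\<dots> \<le> ennreal (k ^ j * K powr r)"
    proof (rule ennreal_leI)
      have "(k ^ j) powr r \<le> (k ^ j) powr 1" using k r by (intro powr_mono') (auto intro: power_le_one)
      then have "(k ^ j) powr r \<le> k ^ j" using k by simp
      then show "K powr r * (k ^ j) powr r \<le> k ^ j * K powr r"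
        using mult_left_mono[of "(k ^ j) powr r" "k ^ j" "K powr r"] by (simp add: mult.commute)
    qed
    finally show "(\<integral>\<^sup>+x. ennreal (w j x) \<partial>lborel) \<le> ennreal (k ^ j * K powr r)" .
  qed auto
  also have "\<dots> \<le> ennreal (K powr r / (1 - k))" using k by (intro suminf_le_of_power) auto
  finally have "(\<integral>\<^sup>+x. ennreal (norm (T x) powr r) \<partial>lborel) \<le> ennreal ((1 / (1 - k)) powr r) * ennreal (K powr r / (1 - k))"
    by (simp add: mult_left_mono)
  also have "\<dots> \<le> ennreal ((K / (1 - k)\<^sup>2) powr r)"
  proof -
    have "(1 / (1 - k)) powr 1 \<le> (1 / (1 - k)) powr r" using r k by (intro powr_mono) auto
    then have "(1 / (1 - k)) powr r * (K powr r * (1 / (1 - k))) \<le> (1 / (1 - k)) powr r * (K powr r * (1 / (1 - k)) powr r)"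
      using k by (intro mult_left_mono) auto
    also have "\<dots> = ((1 / (1 - k)) * (K * (1 / (1 - k)))) powr r" by (simp only: powr_mult)
    also have "(1 / (1 - k)) * (K * (1 / (1 - k))) = K / (1 - k)\<^sup>2" by (simp add: power2_eq_square)
    finally show ?thesis using k by (simp add: ennreal_mult[symmetric] ennreal_leI)
  qed
  finally show ?thesis using False by (simp add: Lp_le_def r_def)
qed

text \<open>If the integral defining the operator diverges its value is 0, so no integrability is needed.\<close>

lemma mult_op_le_dyadic_sum:
  fixes A :: "'v::euclidean_space \<times> ('v \<times> 'v) \<Rightarrow> complex"
  assumes k: "0 < k"
  shows "ennreal (norm (mult_op A \<Phi> x)) \<le> (\<Sum>j. ennreal (norm (mult_op (\<lambda>z. A z * complex_of_real (dyadic k j (snd z))) \<Phi> x)))"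
proof -
  let ?h = "\<lambda>\<zeta>. A (x, \<zeta>) * \<Phi> \<zeta> * cis ((x, x) \<bullet> \<zeta>)"
  let ?T = "\<lambda>j. mult_op (\<lambda>z. A z * complex_of_real (dyadic k j (snd z))) \<Phi> x"
  show ?thesis
  proof (cases "integrable lborel ?h")
    case False
    then show ?thesis by (simp add: mult_op_def not_integrable_integral_eq)
  next
    case True
    note [measurable] = integrable_lborelD[OF True]
    have dm [measurable]: "(\<lambda>\<zeta>::'v \<times> 'v. dyadic k j \<zeta>) \<in> borel_measurable borel" for j
      by (rule borel_measurable_continuous_onI[OF dyadic_continuous])
    have eq: "?T j = (\<integral>\<zeta>. ?h \<zeta> * complex_of_real (dyadic k j \<zeta>) \<partial>lborel)" for j
      unfolding mult_op_def by (intro Bochner_Integration.integral_cong) auto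
    have int: "integrable lborel (\<lambda>\<zeta>. ?h \<zeta> * complex_of_real (dyadic k j \<zeta>))" for j
    proof (rule Bochner_Integration.integrable_bound[OF True])
      show "(\<lambda>\<zeta>. ?h \<zeta> * complex_of_real (dyadic k j \<zeta>)) \<in> borel_measurable lborel" by measurable
      have "norm (?h \<zeta> * complex_of_real (dyadic k j \<zeta>)) \<le> norm (?h \<zeta>) * 1" for \<zeta>
        unfolding norm_mult[of "?h \<zeta>"] norm_of_real by (intro mult_left_mono dyadic_bound) auto
      then show "AE \<zeta> in lborel. norm (?h \<zeta> * complex_of_real (dyadic k j \<zeta>)) \<le> norm (?h \<zeta>)" by simp
    qed
    have sum: "(\<Sum>j\<le>J. ?T j) = (\<integral>\<zeta>. ?h \<zeta> * complex_of_real (cutoff k (bracket \<zeta> / 2 ^ J - 1)) \<partial>lborel)" for J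
    proof -
      have "(\<Sum>j\<le>J. ?T j) = (\<integral>\<zeta>. (\<Sum>j\<le>J. ?h \<zeta> * complex_of_real (dyadic k j \<zeta>)) \<partial>lborel)"
        unfolding eq by (rule Bochner_Integration.integral_sum[symmetric]) (rule int)
      then show ?thesis unfolding sum_distrib_left[symmetric] of_real_sum[symmetric] sum_dyadic .
    qed
    have lim: "(\<lambda>J. \<Sum>j\<le>J. ?T j) \<longlonglongrightarrow> mult_op A \<Phi> x"
      unfolding sum unfolding mult_op_def
    proof (rule integral_dominated_convergence[where w="\<lambda>\<zeta>. norm (?h \<zeta>)"])
      have "cutoff k \<in> borel_measurable borel" by (rule borel_measurable_continuous_onI[OF cutoff_continuous])
      then show "(\<lambda>\<zeta>. ?h \<zeta> * complex_of_real (cutoff k (bracket \<zeta> / 2 ^ J - 1))) \<in> borel_measurable lborel" for J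
        unfolding bracket_def by measurable
      show "integrable lborel (\<lambda>\<zeta>. norm (?h \<zeta>))" using True by (rule integrable_norm)
      show "AE \<zeta> in lborel. (\<lambda>J. ?h \<zeta> * complex_of_real (cutoff k (bracket \<zeta> / 2 ^ J - 1))) \<longlonglongrightarrow> ?h \<zeta>"
      proof (intro AE_I2 tendsto_eventually)
        fix \<zeta> :: "'v \<times> 'v"
        \<comment> \<open>For fixed \<open>\<zeta>\<close> the telescoped cutoff is equal to 1 from
          this index on, so pointwise convergence is eventual equality.\<close>
        obtain n where n: "bracket \<zeta> < 2 ^ n" using real_arch_pow[of 2 "bracket \<zeta>"] by auto
        have "?h \<zeta> * complex_of_real (cutoff k (bracket \<zeta> / 2 ^ J - 1)) = ?h \<zeta>" if "J \<ge> n" for J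
        proof -
          have "(2::real) ^ n \<le> 2 ^ J" using that by (intro power_increasing) auto
          then have "bracket \<zeta> \<le> 2 ^ J" using n by linarith
          then have "bracket \<zeta> / 2 ^ J - 1 \<le> 0" by (simp add: divide_le_eq)
          then show ?thesis using cutoff_eq_1[OF k] by simp
        qed
        then show "\<forall>\<^sub>F J in sequentially. ?h \<zeta> * complex_of_real (cutoff k (bracket \<zeta> / 2 ^ J - 1)) = ?h \<zeta>"
          unfolding eventually_sequentially by blast
      qed
      show "AE \<zeta> in lborel. norm (?h \<zeta> * complex_of_real (cutoff k (bracket \<zeta> / 2 ^ J - 1))) \<le> norm (?h \<zeta>)" for J
      proof (rule AE_I2)
        fix \<zeta>
        have "norm (?h \<zeta> * complex_of_real (cutoff k (bracket \<zeta> / 2 ^ J - 1))) \<le> norm (?h \<zeta>) * 1"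
          unfolding norm_mult[of "?h \<zeta>"] norm_of_real using cutoff_bounds[of k "bracket \<zeta> / 2 ^ J - 1"]
          by (intro mult_left_mono) auto
        then show "norm (?h \<zeta> * complex_of_real (cutoff k (bracket \<zeta> / 2 ^ J - 1))) \<le> norm (?h \<zeta>)" by simp
      qed
    qed measurable
    show ?thesis
    proof (rule LIMSEQ_le_const2)
      show "(\<lambda>J. ennreal (norm (\<Sum>j\<le>J. ?T j))) \<longlonglongrightarrow> ennreal (norm (mult_op A \<Phi> x))"
        by (intro tendsto_ennrealI tendsto_norm lim)
      have "ennreal (norm (\<Sum>j\<le>J. ?T j)) \<le> (\<Sum>j. ennreal (norm (?T j)))" for J
      proof -
        have "ennreal (norm (\<Sum>j\<le>J. ?T j)) \<le> ennreal (\<Sum>j\<le>J. norm (?T j))" by (intro ennreal_leI norm_sum)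
        also have "\<dots> = (\<Sum>j\<le>J. ennreal (norm (?T j)))" by (simp add: sum_ennreal)
        also have "\<dots> \<le> (\<Sum>j. ennreal (norm (?T j)))" by (intro sum_le_suminf) auto
        finally show ?thesis .
      qed
      then show "\<exists>N. \<forall>J\<ge>N. ennreal (norm (\<Sum>j\<le>J. ?T j)) \<le> (\<Sum>j. ennreal (norm (?T j)))" by blast
    qed
  qed
qed

section \<open>Exponents, norms and Schwartz functions as they occur in the statement\<close>

lemma ennreal_exponent_cases:
  assumes "1 \<le> p"
  obtains "p = \<infinity>" "enn2real (inverse p) = 0" | p' where "1 \<le> p'" "p = ennreal p'" "enn2real (inverse p) = 1 / p'"
proof (cases "p = \<infinity>")
  case True
  then show ?thesis using that(1) by simp
next
  case False
  define p' where "p' = enn2real p"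
  have p: "p = ennreal p'" using False by (simp add: p'_def less_top)
  then have "1 \<le> p'" using assms by (metis ennreal_1 ennreal_le_iff2 not_one_le_zero)
  then show ?thesis using that(2)[of p'] p by (simp add: inverse_ennreal inverse_eq_divide)
qed

lemma Lp_le_of_Lp_norm:
  assumes p: "1 \<le> p" and n: "Lp_norm p f = ennreal a" and a: "0 \<le> a"
  shows "Lp_le (enn2real (inverse p)) f a"
  using p
proof (cases rule: ennreal_exponent_cases)
  case 1
  then have "esssup lborel (\<lambda>x. ennreal (norm (f x))) = ennreal a" using n by (simp add: Lp_norm_def)
  then have "AE x in lborel. ennreal (norm (f x)) \<le> ennreal a" using esssup_AE[of "\<lambda>x. ennreal (norm (f x))" lborel] by simp
  then show ?thesis using a 1 by (simp add: Lp_le_def)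
next
  case (2 p')
  let ?I = "\<integral>\<^sup>+x. ennreal (norm (f x) powr p') \<partial>lborel"
  have fin: "?I \<noteq> \<infinity>" and e: "enn2real ?I powr (1 / p') = a"
    using n 2 a by (auto simp: Lp_norm_def Let_def split: if_splits)
  have "enn2real ?I = a powr p'" using e[symmetric] 2(1) by (simp add: powr_powr)
  then have "?I = ennreal (a powr p')" using fin by (metis ennreal_enn2real infinity_ennreal_def less_top)
  then show ?thesis using 2 by (simp add: Lp_le_def)
qed

lemma Lp_norm_le_of_Lp_le:
  assumes p: "1 \<le> p" and fm: "f \<in> borel_measurable borel" and n: "Lp_le (enn2real (inverse p)) f a" and a: "0 \<le> a"
  shows "Lp_norm p f \<le> ennreal a"
  using p
proof (cases rule: ennreal_exponent_cases)
  case 1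
  then have "AE x in lborel. norm (f x) \<le> a" using n by (simp add: Lp_le_def)
  then have "AE x in lborel. ennreal (norm (f x)) \<le> ennreal a" by eventually_elim (rule ennreal_leI)
  then have "esssup lborel (\<lambda>x. ennreal (norm (f x))) \<le> ennreal a" using fm by (intro esssup_I) auto
  then show ?thesis using 1 by (simp add: Lp_norm_def)
next
  case (2 p')
  let ?I = "\<integral>\<^sup>+x. ennreal (norm (f x) powr p') \<partial>lborel"
  have I: "?I \<le> ennreal (a powr p')" using n 2 by (simp add: Lp_le_def)
  then have fin: "?I < \<top>" using ennreal_less_top le_less_trans by blast
  have "enn2real ?I \<le> a powr p'" using I by (simp add: enn2real_leI)
  then have "enn2real ?I powr (1 / p') \<le> (a powr p') powr (1 / p')" using 2 by (intro powr_mono2) auto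
  also have "\<dots> = a" using 2 a by (simp add: powr_powr)
  finally show ?thesis using fin 2 by (auto simp: Lp_norm_def Let_def intro: ennreal_leI)
qed

text \<open>The estimates above divide by the norms of the data and assume them positive; this
  serves the degenerate case.\<close>

lemma Lp_norm_zero_AE:
  assumes "f \<in> borel_measurable borel" "1 \<le> p" "Lp_norm p f = 0"
  shows "AE x in lborel. f x = 0"
proof -
  have l: "Lp_le (enn2real (inverse p)) f 0" using Lp_le_of_Lp_norm[of p f 0] assms by simp
  show ?thesis
  proof (cases "enn2real (inverse p) = 0")
    case True
    then show ?thesis using l by (simp add: Lp_le_def)
  next
    case False
    then have "(\<integral>\<^sup>+y. ennreal (norm (f y) powr (1 / enn2real (inverse p))) \<partial>lborel) = 0" using l by (simp add: Lp_le_def)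
    then have "AE y in lborel. ennreal (norm (f y) powr (1 / enn2real (inverse p))) = 0"
      using assms(1) by (subst (asm) nn_integral_0_iff_AE) auto
    then show ?thesis by eventually_elim (simp add: ennreal_eq_0_iff)
  qed
qed

lemma ft_AE_zero:
  assumes "AE x in lborel. f x = 0"
  shows "ft f \<xi> = 0"
proof -
  have "AE y in lborel. f y * cis (- (y \<bullet> \<xi>)) = 0" using assms by eventually_elim simp
  then show ?thesis unfolding ft_def by (rule integral_eq_zero_AE)
qed

lemma inverse_decay_le: "inverse (decay x) \<le> (1 + norm x) ^ (2 * DIM('v))" for x :: "'v::euclidean_space"
proof -
  have "inverse (decay x) = (\<Prod>b\<in>Basis. 1 + (x \<bullet> b)\<^sup>2)"
    by (simp add: decay_def prod_inversef[symmetric] o_def)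
  also have "\<dots> \<le> (\<Prod>b\<in>(Basis::'v set). (1 + norm x)\<^sup>2)"
  proof (intro prod_mono conjI)
    fix b :: 'v assume "b \<in> Basis"
    then have "\<bar>x \<bullet> b\<bar> \<le> norm x" by (rule Basis_le_norm)
    then have "(x \<bullet> b)\<^sup>2 \<le> (norm x)\<^sup>2" by (simp add: abs_le_square_iff[symmetric])
    moreover have "(1 + norm x)\<^sup>2 = 1 + 2 * norm x + (norm x)\<^sup>2" by (simp add: power2_sum)
    ultimately show "1 + (x \<bullet> b)\<^sup>2 \<le> (1 + norm x)\<^sup>2" using norm_ge_zero[of x] by linarith
  qed simp
  finally show ?thesis by (simp add: power_mult)
qed

text \<open>The seminorm without derivatives and with power \<open>2 * n\<close> bounds
  \<open>f\<close> by a multiple of the integrable function \<open>decay\<close>.\<close>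

lemma schwartz_integrable:
  assumes "schwartz f"
  shows "integrable lborel f"
proof -
  have "f differentiable (at x)" for x
    using assms unfolding schwartz_def smooth_fun_def by (metis iter_dderiv.simps(1) empty_subsetI list.set(1))
  then have "continuous_on UNIV f"
    by (intro continuous_at_imp_continuous_on ballI differentiable_imp_continuous_within) auto
  then have fm [measurable]: "f \<in> borel_measurable borel" by (rule borel_measurable_continuous_onI)
  obtain C where C: "\<And>x. (1 + norm x) ^ (2 * CARD('a)) * norm (f x) \<le> C"
    using assms unfolding schwartz_def by (metis iter_dderiv.simps(1) empty_subsetI list.set(1))
  have b: "norm (f x) \<le> C * decay x" for x
  proof -
    have "inverse (decay x) * norm (f x) \<le> (1 + norm x) ^ (2 * CARD('a)) * norm (f x)"
      using inverse_decay_le[of x] by (intro mult_right_mono) auto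
    then have "inverse (decay x) * norm (f x) \<le> C" using C[of x] by linarith
    then show ?thesis using decay_pos[of x] by (simp add: field_simps)
  qed
  have "integrable lborel (\<lambda>x::real^'a. decay x)"
    using nn_integral_decay[where 'v="real^'a"]
    by (intro integrableI_nonneg) (auto intro!: AE_I2 less_imp_le[OF decay_pos])
  then have "integrable lborel (\<lambda>x::real^'a. C * decay x)" by simp
  then show ?thesis
    by (rule Bochner_Integration.integrable_bound) (use b in \<open>auto intro!: AE_I2 order_trans[OF b]\<close>)
qed

text \<open>At most one of \<open>t\<close> and \<open>s\<close> exceeds 1/2, and on each of four
  regions \<open>loss\<close> is one of \<open>1 - (t + s)\<close>, \<open>t\<close>,
  \<open>s\<close> and 1/2. The first three are dominated by an entry of twice the slope that takes
  the value 1/2 at the same place, where \<open>t + s\<close>, \<open>t\<close> or \<open>s\<close>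
  equals 1/2.\<close>

lemma loss_le_Max:
  assumes "0 \<le> t" "0 \<le> s" "t + s \<le> 1"
  shows "loss t s \<le> Max {1/2, 2 * s - 1/2, 2 * t - 1/2, 3/2 - 2 * (t + s)}"
proof -
  let ?M = "Max {1/2, 2 * s - 1/2, 2 * t - 1/2, 3/2 - 2 * (t + s)}"
  have "1/2 \<le> ?M" "2 * s - 1/2 \<le> ?M" "2 * t - 1/2 \<le> ?M" "3/2 - 2 * (t + s) \<le> ?M"
    by (intro Max_ge; simp)+
  moreover have "loss t s \<le> M" if "1/2 \<le> M" "2 * s - 1/2 \<le> M" "2 * t - 1/2 \<le> M" "3/2 - 2 * (t + s) \<le> M" for M
  proof -
    consider "t + s \<le> 1/2" | "1/2 \<le> t" "s \<le> 1/2" | "1/2 \<le> s" "t \<le> 1/2" | "1/2 \<le> t + s" "t \<le> 1/2" "s \<le> 1/2"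
      using assms by linarith
    then show ?thesis
    proof cases
      case 1
      then have "loss t s = 1 - (t + s)" using assms by (simp add: loss_def max_def)
      also have "\<dots> \<le> 3/2 - 2 * (t + s)" using 1 by simp
      finally show ?thesis using that(4) by (rule order_trans)
    next
      case 2
      then have "loss t s = t" using assms by (simp add: loss_def max_def)
      also have "\<dots> \<le> 2 * t - 1/2" using 2 by simp
      finally show ?thesis using that(3) by (rule order_trans)
    next
      case 3
      then have "loss t s = s" using assms by (simp add: loss_def max_def)
      also have "\<dots> \<le> 2 * s - 1/2" using 3 by simp
      finally show ?thesis using that(2) by (rule order_trans)
    next
      case 4
      then have "loss t s = 1/2" by (simp add: loss_def max_def)
      then show ?thesis using that(1) by simp
    qed
  qed
  ultimately show ?thesis by blast
qed

text \<open>Piece \<open>j\<close> is dilated to the normalised situation, estimated there and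
  dilated back. Its norm is \<open>S powr (m / 2)\<close> times the power
  \<open>n * loss t s\<close> of the support radius, where \<open>S = 2 ^ j\<close>; the order
  condition makes the combined exponent negative, and the pieces sum geometrically.\<close>

lemma mult_op_Lp_bound:
  fixes a :: "real^'n \<Rightarrow> real^'n \<Rightarrow> real^'n \<Rightarrow> complex"
  assumes a: "bisymbol m \<rho> \<delta> a" and d: "0 \<le> \<delta>" "\<delta> \<le> \<rho>" "\<rho> \<le> 1"
    and ts: "0 \<le> t" "0 \<le> s" "t + s \<le> 1" and m: "m < real CARD('n) * (\<rho> - 1) * loss t s"
  obtains C where "0 < C" "\<And>f g \<alpha> \<beta>. integrable lborel f \<Longrightarrow> integrable lborel g \<Longrightarrow> 0 < \<alpha> \<Longrightarrow> 0 < \<beta> \<Longrightarrow>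
    Lp_le t f \<alpha> \<Longrightarrow> Lp_le s g \<beta> \<Longrightarrow> Lp_le (t + s) (mult_op (\<lambda>(x, \<xi>, \<eta>). a x \<xi> \<eta>) (tensor_ft f g)) (C * \<alpha> * \<beta>)"
proof -
  let ?A = "\<lambda>(x, \<xi>, \<eta>). a x \<xi> \<eta>" and ?n = "real CARD('n)"
  \<comment> \<open>The cutoff is of class C to the \<open>k - 1\<close>, so this \<open>k\<close>
    yields the 5n derivatives that the single-scale estimate consumes.\<close>
  define k :: nat where "k = Suc (5 * DIM(real^'n))"
  have "?A differentiable (at z)" for z
    using a unfolding bisymbol_def Let_def smooth_fun_def by (metis iter_dderiv.simps(1) empty_subsetI list.set(1))
  then have cA: "continuous_on UNIV ?A"
    by (intro continuous_at_imp_continuous_on ballI differentiable_imp_continuous_within) auto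
  obtain C1 where C1: "0 < C1"
    "\<And>j. bnd UNIV (5 * DIM(real^'n)) (C1 * (2 ^ j) powr (m / 2)) (\<lambda>z. ?A (scale_symbol ((2 ^ j) powr (\<rho> / 2)) z) *
       complex_of_real (dyadic k j ((2 ^ j) powr (\<rho> / 2) *\<^sub>R snd z)))"
    "\<And>j. freq_supp (sqrt 2 * (2 ^ j) powr ((1 - \<rho>) / 2)) (\<lambda>z. ?A (scale_symbol ((2 ^ j) powr (\<rho> / 2)) z) *
       complex_of_real (dyadic k j ((2 ^ j) powr (\<rho> / 2) *\<^sub>R snd z)))"
    using bnd_dyadic_piece[OF a d, of "5 * DIM(real^'n)" k] unfolding k_def by blast
  obtain C2 where C2: "0 < C2" "\<And>(B :: (real^'n) \<times> ((real^'n) \<times> (real^'n)) \<Rightarrow> complex) C R f g \<alpha> \<beta>.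
    0 < C \<Longrightarrow> 0 < R \<Longrightarrow> bnd UNIV (5 * DIM(real^'n)) C B \<Longrightarrow> freq_supp R B \<Longrightarrow>
    integrable lborel f \<Longrightarrow> integrable lborel g \<Longrightarrow> 0 < \<alpha> \<Longrightarrow> 0 < \<beta> \<Longrightarrow> Lp_le t f \<alpha> \<Longrightarrow> Lp_le s g \<beta> \<Longrightarrow>
    Lp_le (t + s) (mult_op B (tensor_ft f g)) (C2 * C * R powr (real DIM(real^'n) * loss t s) * \<alpha> * \<beta>)"
    using mult_op_single_scale[OF ts, where 'v="real^'n"] by blast
  define C3 where "C3 = C2 * C1 * sqrt 2 powr (?n * loss t s)"
  have C3: "0 < C3" using C1 C2 by (simp add: C3_def)
  \<comment> \<open>Half the sum of the order and of the loss: the support radius is of size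
    \<open>(2 ^ j) powr ((1 - \<rho>) / 2)\<close> and enters with the power
    \<open>n * loss t s\<close>.\<close>
  define e where "e = (m + ?n * (1 - \<rho>) * loss t s) / 2"
  have e: "e < 0"
  proof -
    have "?n * (\<rho> - 1) * loss t s = - (?n * (1 - \<rho>) * loss t s)" by (simp add: algebra_simps)
    then show ?thesis using m by (simp add: e_def)
  qed
  \<comment> \<open>The square root of the ratio \<open>2 powr e\<close>, since the summation lemma
    splits the decay into two equal factors.\<close>
  define q where "q = 2 powr (e / 2)"
  have q: "0 < q" "q < 1" using e by (auto simp: q_def powr_less_one)
  have qq: "(q * q) ^ j = (2 ^ j) powr e" for j
  proof -
    have "q * q = 2 powr e" by (simp add: q_def powr_add[symmetric])
    then show ?thesis by (simp add: powr_realpow[symmetric] powr_powr mult.commute)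
  qed
  show ?thesis
  proof (rule that[of "C3 / (1 - q)\<^sup>2"])
    show "0 < C3 / (1 - q)\<^sup>2" using C3 q by simp
    fix f g :: "real^'n \<Rightarrow> complex" and \<alpha> \<beta> :: real
    assume h: "integrable lborel f" "integrable lborel g" "0 < \<alpha>" "0 < \<beta>" "Lp_le t f \<alpha>" "Lp_le s g \<beta>"
    note [measurable] = integrable_lborelD[OF h(1)] integrable_lborelD[OF h(2)]
    let ?a = "\<lambda>j z. ?A z * complex_of_real (dyadic k j (snd z))"
    have ca: "continuous_on UNIV (?a j)" for j
      by (intro continuous_intros cA continuous_on_compose2[OF dyadic_continuous]) auto
    have piece: "Lp_le (t + s) (mult_op (?a j) (tensor_ft f g)) (C3 * \<alpha> * \<beta> * (q * q) ^ j)" for j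
    proof -
      define S :: real where "S = 2 ^ j"
      have S: "1 \<le> S" by (simp add: S_def)
      define l where "l = S powr (\<rho> / 2)"
      have l: "0 < l" using S by (simp add: l_def)
      let ?f = "\<lambda>y. f ((1 / l) *\<^sub>R y)" and ?g = "\<lambda>y. g ((1 / l) *\<^sub>R y)"
      let ?B = "\<lambda>z. ?a j (scale_symbol l z)" and ?R = "sqrt 2 * S powr ((1 - \<rho>) / 2)"
      have dil: "integrable lborel (\<lambda>y. F ((1 / l) *\<^sub>R y))" if "integrable lborel F" for F :: "real^'n \<Rightarrow> complex"
      proof (rule integrableI_bounded)
        note [measurable] = integrable_lborelD[OF that]
        show "(\<lambda>y. F ((1 / l) *\<^sub>R y)) \<in> borel_measurable lborel" by measurable
        have "Lp_le 1 F (\<integral>y. norm (F y) \<partial>lborel)"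
          using that by (simp add: Lp_le_def nn_integral_eq_integral)
        from Lp_le_dilate[OF _ _ _ _ this, of "1 / l"] show "(\<integral>\<^sup>+y. ennreal (norm (F ((1 / l) *\<^sub>R y))) \<partial>lborel) < \<infinity>"
          using l by (auto simp: Lp_le_def intro: le_less_trans)
      qed
      have "Lp_le (t + s) (mult_op ?B (tensor_ft ?f ?g)) (C2 * (C1 * S powr (m / 2)) * ?R powr (real DIM(real^'n) * loss t s) *
          ((1 / l) powr (- (real DIM(real^'n) * t)) * \<alpha>) * ((1 / l) powr (- (real DIM(real^'n) * s)) * \<beta>))"
      proof (rule C2(2))
        show "bnd UNIV (5 * DIM(real^'n)) (C1 * S powr (m / 2)) ?B"
          using C1(2)[of j] by (simp add: S_def l_def scale_symbol_def)
        show "freq_supp ?R ?B"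
          using C1(3)[of j] by (simp add: S_def l_def scale_symbol_def)
        show "Lp_le t ?f ((1 / l) powr (- (real DIM(real^'n) * t)) * \<alpha>)"
          by (rule Lp_le_dilate) (use l ts h in auto)
        show "Lp_le s ?g ((1 / l) powr (- (real DIM(real^'n) * s)) * \<beta>)"
          by (rule Lp_le_dilate) (use l ts h in auto)
      qed (use C1 S h l dil in auto)
      then have "Lp_le (t + s) (\<lambda>x. mult_op ?B (tensor_ft ?f ?g) (l *\<^sub>R x)) (l powr (- (real DIM(real^'n) * (t + s))) * (C2 * (C1 * S powr (m / 2)) * ?R powr (real DIM(real^'n) * loss t s) *
          ((1 / l) powr (- (real DIM(real^'n) * t)) * \<alpha>) * ((1 / l) powr (- (real DIM(real^'n) * s)) * \<beta>)))"
      proof (rule Lp_le_dilate[rotated 4])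
        have "continuous_on UNIV (scale_symbol l :: (real^'n) \<times> ((real^'n) \<times> (real^'n)) \<Rightarrow> _)"
          unfolding scale_symbol_def[abs_def] by (intro continuous_intros)
        then have "continuous_on UNIV ?B" by (intro continuous_on_compose2[OF ca]) auto
        then show "mult_op ?B (tensor_ft ?f ?g) \<in> borel_measurable borel"
          by (rule mult_op_measurable) measurable
      qed (use C1 C2 S h l ts in auto)
      also have "(\<lambda>x. mult_op ?B (tensor_ft ?f ?g) (l *\<^sub>R x)) = mult_op (?a j) (tensor_ft f g)"
        using mult_op_dilate[OF ca _ _ l, of f g j] by (intro ext) simp
      also have "l powr (- (real DIM(real^'n) * (t + s))) * (C2 * (C1 * S powr (m / 2)) * ?R powr (real DIM(real^'n) * loss t s) *
          ((1 / l) powr (- (real DIM(real^'n) * t)) * \<alpha>) * ((1 / l) powr (- (real DIM(real^'n) * s)) * \<beta>)) = C3 * \<alpha> * \<beta> * (q * q) ^ j"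
      proof -
        \<comment> \<open>Dilating the output and the two inputs cancels because the reciprocal
          exponents satisfy the Hoelder relation.\<close>
        have "l powr (- (?n * (t + s))) * ((1 / l) powr (- (?n * t)) * (1 / l) powr (- (?n * s))) = 1"
          using l by (simp add: powr_divide powr_minus_divide powr_add[symmetric] algebra_simps)
        moreover have "S powr (m / 2) * ?R powr (?n * loss t s) = sqrt 2 powr (?n * loss t s) * (q * q) ^ j"
        proof -
          have "?R powr (?n * loss t s) = sqrt 2 powr (?n * loss t s) * S powr ((1 - \<rho>) / 2 * (?n * loss t s))"
            by (simp add: powr_mult powr_powr)
          moreover have "S powr (m / 2) * S powr ((1 - \<rho>) / 2 * (?n * loss t s)) = S powr e"
            unfolding powr_add[symmetric] e_def by (simp add: field_simps)
          ultimately show ?thesis unfolding qq S_def[symmetric] by (simp add: mult_ac)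
        qed
        moreover have "l powr (- (?n * (t + s))) * (C2 * (C1 * S powr (m / 2)) * ?R powr (?n * loss t s) *
          ((1 / l) powr (- (?n * t)) * \<alpha>) * ((1 / l) powr (- (?n * s)) * \<beta>)) =
          (l powr (- (?n * (t + s))) * ((1 / l) powr (- (?n * t)) * (1 / l) powr (- (?n * s)))) * (C2 * C1 * (S powr (m / 2) * ?R powr (?n * loss t s)) * \<alpha> * \<beta>)"
          by (simp only: mult_ac)
        ultimately show ?thesis by (simp add: C3_def mult_ac)
      qed
      finally show ?thesis .
    qed
    have "Lp_le (t + s) (mult_op ?A (tensor_ft f g)) (C3 * \<alpha> * \<beta> / (1 - q)\<^sup>2)"
    proof (rule Lp_le_geometric_sum[where c="\<lambda>j. mult_op (?a j) (tensor_ft f g)"])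
      show "mult_op (?a j) (tensor_ft f g) \<in> borel_measurable borel" for j
        by (rule mult_op_measurable[OF ca]) measurable
      show "ennreal (norm (mult_op ?A (tensor_ft f g) x)) \<le> (\<Sum>j. ennreal (norm (mult_op (?a j) (tensor_ft f g) x)))" for x
        by (rule mult_op_le_dyadic_sum) (simp add: k_def)
    qed (use ts q C3 h piece in auto)
    then show "Lp_le (t + s) (mult_op ?A (tensor_ft f g)) (C3 / (1 - q)\<^sup>2 * \<alpha> * \<beta>)" by simp
  qed
qed

lemma bilinear_op_eq_mult_op:
  "bilinear_op a f g = mult_op (\<lambda>(x, \<xi>, \<eta>). a x \<xi> \<eta>) (tensor_ft f g)"
proof -
  have "fourier h = ft h" for h :: "real^'a \<Rightarrow> complex" by (simp add: fun_eq_iff fourier_def ft_def)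
  then show ?thesis
    unfolding fun_eq_iff bilinear_op_def mult_op_def
    by (intro allI Bochner_Integration.integral_cong) (auto simp: inner_prod_def inner_add_right mult_ac)
qed

theorem theorem5p5:
  fixes a :: "real^'n \<Rightarrow> real^'n \<Rightarrow> real^'n \<Rightarrow> complex"
    and m \<rho> \<delta> :: real and p q r :: ennreal
  assumes "bisymbol m \<rho> \<delta> a"
    and "0 \<le> \<delta>" and "\<delta> \<le> \<rho>" and "\<rho> \<le> 1" and "\<delta> < 1"
    and "1 \<le> p" and "1 \<le> q" and "1 \<le> r"
    and "inverse r = inverse q + inverse p"
    and "m < real CARD('n) * (\<rho> - 1) *
           Max {1/2, 2 * enn2real (inverse p) - 1/2, 2 * enn2real (inverse q) - 1/2,
                3/2 - 2 * enn2real (inverse r)}"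
  shows "\<exists>C::real. \<forall>f g. schwartz f \<longrightarrow> schwartz g \<longrightarrow>
           Lp_norm r (bilinear_op a f g) \<le> ennreal C * Lp_norm q f * Lp_norm p g"
proof -
  let ?A = "\<lambda>(x, \<xi>, \<eta>). a x \<xi> \<eta>"
  \<comment> \<open>The reciprocal exponents: \<open>t\<close> belongs to \<open>f\<close>, measured
    with \<open>q\<close>, and \<open>s\<close> to \<open>g\<close>, measured with
    \<open>p\<close>.\<close>
  define s where "s = enn2real (inverse p)"
  define t where "t = enn2real (inverse q)"
  have inv1: "inverse x \<le> 1" if "1 \<le> x" for x :: ennreal
    using that by (cases rule: ennreal_exponent_cases) (auto simp: inverse_ennreal inverse_eq_divide)
  have fin: "inverse p < \<top>" "inverse q < \<top>"
    using inv1[OF assms(6)] inv1[OF assms(7)] by (auto intro: le_less_trans)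
  have u: "enn2real (inverse r) = t + s"
    unfolding assms(9) t_def s_def using fin by (intro enn2real_plus)
  have "enn2real (inverse r) \<le> 1" using inv1[OF assms(8)] by (intro enn2real_leI) auto
  then have ts: "0 \<le> t" "0 \<le> s" "t + s \<le> 1" unfolding u by (auto simp: t_def s_def)
  have m: "m < real CARD('n) * (\<rho> - 1) * loss t s"
  proof -
    \<comment> \<open>The factor \<open>\<rho> - 1\<close> is not positive, so an upper bound for
      \<open>loss\<close> yields a lower bound for the product.\<close>
    have "real CARD('n) * (\<rho> - 1) * Max {1/2, 2 * s - 1/2, 2 * t - 1/2, 3/2 - 2 * (t + s)} \<le> real CARD('n) * (\<rho> - 1) * loss t s"
      using assms(4) by (intro mult_left_mono_neg loss_le_Max ts) (auto simp: mult_nonneg_nonpos)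
    then show ?thesis using assms(10) unfolding u s_def[symmetric] t_def[symmetric] by linarith
  qed
  obtain C where C: "0 < C" "\<And>f g \<alpha> \<beta>. integrable lborel f \<Longrightarrow> integrable lborel g \<Longrightarrow> 0 < \<alpha> \<Longrightarrow> 0 < \<beta> \<Longrightarrow>
    Lp_le t f \<alpha> \<Longrightarrow> Lp_le s g \<beta> \<Longrightarrow> Lp_le (t + s) (mult_op ?A (tensor_ft f g)) (C * \<alpha> * \<beta>)"
    using mult_op_Lp_bound[OF assms(1-4) ts m] by blast
  have "?A differentiable (at z)" for z
    using assms(1) unfolding bisymbol_def Let_def smooth_fun_def by (metis iter_dderiv.simps(1) empty_subsetI list.set(1))
  then have cA: "continuous_on UNIV ?A"
    by (intro continuous_at_imp_continuous_on ballI differentiable_imp_continuous_within) auto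
  have "Lp_norm r (bilinear_op a f g) \<le> ennreal C * Lp_norm q f * Lp_norm p g" if sch: "schwartz f" "schwartz g" for f g
  proof -
    have i: "integrable lborel f" "integrable lborel g" using sch by (auto intro: schwartz_integrable)
    note fm = integrable_lborelD[OF i(1)] integrable_lborelD[OF i(2)]
    have Tm: "mult_op ?A (tensor_ft f g) \<in> borel_measurable borel" by (rule mult_op_measurable[OF cA fm])
    \<comment> \<open>The estimate applies to positive finite norms. If a norm is 0, that function
      vanishes almost everywhere and so does the operator; if one is infinite and the other
      positive, the right-hand side is infinite.\<close>
    consider "Lp_norm q f = 0 \<or> Lp_norm p g = 0" | "Lp_norm q f \<noteq> 0" "Lp_norm p g \<noteq> 0" "Lp_norm q f = \<top> \<or> Lp_norm p g = \<top>"
      | "Lp_norm q f \<noteq> 0" "Lp_norm p g \<noteq> 0" "Lp_norm q f < \<top>" "Lp_norm p g < \<top>"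
      using less_top[of "Lp_norm q f"] less_top[of "Lp_norm p g"] by blast
    then show ?thesis
    proof cases
      case 1
      then have "(\<forall>\<xi>. ft f \<xi> = 0) \<or> (\<forall>\<xi>. ft g \<xi> = 0)"
        using Lp_norm_zero_AE[OF fm(1) assms(7)] Lp_norm_zero_AE[OF fm(2) assms(6)] ft_AE_zero by blast
      then have "mult_op ?A (tensor_ft f g) x = 0" for x by (auto simp: mult_op_def)
      then have "Lp_le (enn2real (inverse r)) (mult_op ?A (tensor_ft f g)) 0" by (simp add: Lp_le_def)
      from Lp_norm_le_of_Lp_le[OF assms(8) Tm this] show ?thesis by (simp add: bilinear_op_eq_mult_op)
    next
      case 2
      then have "ennreal C * Lp_norm q f * Lp_norm p g = \<top>" using C(1) by (auto simp: ennreal_mult_eq_top_iff ennreal_eq_0_iff)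
      then show ?thesis by simp
    next
      case 3
      define \<alpha> where "\<alpha> = enn2real (Lp_norm q f)"
      define \<beta> where "\<beta> = enn2real (Lp_norm p g)"
      have n: "Lp_norm q f = ennreal \<alpha>" "Lp_norm p g = ennreal \<beta>" using 3 by (auto simp: \<alpha>_def \<beta>_def)
      have pos: "0 < \<alpha>" "0 < \<beta>" using 3 n by (auto simp: not_le[symmetric] ennreal_neg)
      have "Lp_le t f \<alpha>" "Lp_le s g \<beta>"
        unfolding t_def s_def using n pos assms(6,7) by (auto intro: Lp_le_of_Lp_norm)
      from C(2)[OF i pos this] have "Lp_le (enn2real (inverse r)) (mult_op ?A (tensor_ft f g)) (C * \<alpha> * \<beta>)" by (simp only: u)
      from Lp_norm_le_of_Lp_le[OF assms(8) Tm this] have "Lp_norm r (mult_op ?A (tensor_ft f g)) \<le> ennreal (C * \<alpha> * \<beta>)"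
        using C(1) pos by simp
      then show ?thesis unfolding n bilinear_op_eq_mult_op using C(1) pos by (simp add: ennreal_mult)
    qed
  qed
  then show ?thesis by blast
qed

end
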